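(* Let $U$ be the set of star domains in $\mathbb{R}^d$ whose boundary functions have Lipschitz coefficient no more than $L$, let $X=\bigsqcup_{\Omega\in U}\mathcal{B}(\Omega)$ with the metric $d_X$, and let $\{\phi_n\}$, $\{\psi_n\}$ be the discretization and reconstruction mappings for $X$ given in the context. Then the metric space $(X,d_X)$ and the two sets of mappings $\{\phi_n\}$ and $\{\psi_n\}$ satisfy the discretization assumption (stated in the context), i.e., $$\lim_{n\to\infty}\sup_{f_\Omega\in K}d_X(f_\Omega,P_n(f_\Omega))=0$$ holds for any compact $K\subset X$, where $P_n=\psi_n\circ\phi_n$ is the projection mapping.
   Context: Discretization assumption for a metric space $(Z,d_Z)$: $\kappa:\mathbb{N}^*\to\mathbb{N}^*$ is a strictly increasing function ($\mathbb{N}^*$ the natural numbers), and $\{\phi_n\},\{\psi_n\}$ are two sets of mappings with $\phi_n\in C(Z,\mathbb{R}^{\kappa(n)})$, $\psi_n\in C(\phi_n(Z),Z)$, $P_n:=\psi_n\circ\phi_n\in C(Z,Z)$, satisfying $\lim_{n\to\infty}\sup_{z\in K}d_Z(z,P_n(z))=0$ for any compact $K\subset Z$. Then $\{\phi_n\}$ is called a discretization (encoder), $\{\psi_n\}$ a reconstruction (decoder), and $P_n$ the projection mapping. Star domains: let $S=\{e\in\mathbb{R}^d:\|e\|_2=1\}$. Taking the centroid of an open set $\Omega\subset\mathbb{R}^d$ as the origin, $\Omega$ is a star domain if its boundary can be expressed as a Lipschitz continuous function $b:S\to\mathbb{R}^+$, in which case (in these coordinates) $\Omega=\{0\neq x\in\mathbb{R}^d:\|x\|_2<b(x/\|x\|_2)\}\cup\{0\}$.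 Write $c_\Omega$ for the centroid of $\Omega$ and $b_\Omega$ for its boundary function. Metric on $U$: $d_U(\Omega_1,\Omega_2)=d_E(c_{\Omega_1},c_{\Omega_2})+\sup_{e\in S}|b_{\Omega_1}(e)-b_{\Omega_2}(e)|$, with $d_E$ the Euclidean metric. Deformation: $\Omega_0=B(0,1)$ is the open unit ball and $\mathcal{D}[\Omega](x)=c_\Omega+b_\Omega(x/\|x\|_2)\cdot x$ for $x\in\Omega_0$ (with value $c_\Omega$ at $x=0$). $\mathcal{B}(\Omega)$ is the set of bounded Borel functions on $\Omega$. Metric on $X$: $d_X(f_{\Omega_1},f_{\Omega_2})=d_U(\Omega_1,\Omega_2)+\|f_{\Omega_1}\circ\mathcal{D}[\Omega_1]-f_{\Omega_2}\circ\mathcal{D}[\Omega_2]\|_{L^2(\Omega_0)}$. Let $\sigma:X\to U\times\mathcal{B}(\Omega_0)$, $\sigma(f_\Omega)=(\Omega,f_\Omega\circ\mathcal{D}[\Omega])$. Discretization of $U$: $\phi_n^1(\Omega)=(c_\Omega,b_\Omega(e_1^n),\dots,b_\Omega(e_n^n))\in\mathbb{R}^{n+d}$, where $V_n=\{e_1^n,\dots,e_n^n\}\subset S$ are expected to be evenly selected. Let $\mathrm{conv}(V_n)$ be the convex hull of $V_n$; the non-simplex $(d-1)$-dimensional polytopes on its boundary are decomposed into small simplices, and $\mathrm{conv}(V_n)$ with this piecewise simplex boundary is denoted $V_n^s$. With $M_n$ the maximum diameter of the simplices on the boundary of $V_n^s$, the points are selected so that $\lim_{n\to\infty}M_n=0$.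 The reconstruction $\psi_n^1$ maps $\phi_n^1(\Omega)$ to the polytope which takes $\{c_\Omega+b_\Omega(e_i^n)\cdot e_i^n\}_{i=1}^n$ as its vertices and has the same simplex partition of the boundary as $V_n^s$. Discretization of $\mathcal{B}(\Omega_0)$: $\Omega_0=\bigsqcup_{i=1}^n\Omega_i^n$ is divided into $n$ mutually disjoint subdomains whose maximum diameter tends to $0$ as $n\to\infty$. With $m$ the Lebesgue measure, $\phi_n^2(f)=\left(\frac{1}{m(\Omega_1^n)}\int_{\Omega_1^n}f\,dx,\dots,\frac{1}{m(\Omega_n^n)}\int_{\Omega_n^n}f\,dx\right)\in\mathbb{R}^n$, and $\psi_n^2$ maps $\phi_n^2(f)$ to the piecewise constant function with value $\frac{1}{m(\Omega_i^n)}\int_{\Omega_i^n}f\,dx$ on $\Omega_i^n$, $1\le i\le n$. Discretization of $X$: with any strictly increasing $\kappa_1,\kappa_2:\mathbb{N}^*\to\mathbb{N}^*$, $$\phi_n(f_\Omega)=\left(\phi_{\kappa_1(n)}^1(\Omega),\phi_{\kappa_2(n)}^2(f_\Omega\circ\mathcal{D}[\Omega])\right)\in\mathbb{R}^{\kappa_1(n)+d+\kappa_2(n)},$$ $$\psi_n(\phi_n(f_\Omega))=\sigma^{-1}\left(\psi_{\kappa_1(n)}^1\big(\phi_{\kappa_1(n)}^1(\Omega)\big),\psi_{\kappa_2(n)}^2\big(\phi_{\kappa_2(n)}^2(f_\Omega\circ\mathcal{D}[\Omega])\big)\right),$$ so here $\kappa(n)=\kappa_1(n)+d+\kappa_2(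n)$.
   Formalization: The requirement that ψ_n maps φ_n(X) continuously into X fails for d ≥ 2 (polytopes interpolating large balls exceed the Lipschitz bound L); it is replaced by continuity of ψ_n on those codes in φ_n(X) that it decodes to functions on star domains of any Lipschitz coefficient. *)

theory Defs
  imports "HOL-Analysis.Analysis"
begin

text \<open>The topology of a pseudometric \<open>d\<close> on \<open>Z\<close>.  The locale \<^locale>\<open>Metric_space\<close> is not used
  because the distance \<open>dX\<close> on bounded Borel functions below vanishes on almost everywhere equal
  functions; passing to the quotient changes neither continuity nor compactness nor suprema.\<close>

definition pm_topology :: "'z set \<Rightarrow> ('z \<Rightarrow> 'z \<Rightarrow> real) \<Rightarrow> 'z topology" where
  "pm_topology Z d = topology (\<lambda>S. S \<subseteq> Z \<and> (\<forall>x\<in>S. \<exists>r>0. \<forall>y\<in>Z. d x y < r \<longrightarrow> y \<in> S))"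

lemma openin_pm_topology:
  "openin (pm_topology Z d) S \<longleftrightarrow> S \<subseteq> Z \<and> (\<forall>x\<in>S. \<exists>r>0. \<forall>y\<in>Z. d x y < r \<longrightarrow> y \<in> S)"
proof -
  have "istopology (\<lambda>S. S \<subseteq> Z \<and> (\<forall>x\<in>S. \<exists>r>0. \<forall>y\<in>Z. d x y < r \<longrightarrow> y \<in> S))"
    unfolding istopology_def
  proof (intro conjI allI impI)
    fix S T
    assume S: "S \<subseteq> Z \<and> (\<forall>x\<in>S. \<exists>r>0. \<forall>y\<in>Z. d x y < r \<longrightarrow> y \<in> S)"
      and T: "T \<subseteq> Z \<and> (\<forall>x\<in>T. \<exists>r>0. \<forall>y\<in>Z. d x y < r \<longrightarrow> y \<in> T)"
    show "S \<inter> T \<subseteq> Z" using S by blast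
    show "\<forall>x\<in>S \<inter> T. \<exists>r>0. \<forall>y\<in>Z. d x y < r \<longrightarrow> y \<in> S \<inter> T"
    proof
      fix x assume "x \<in> S \<inter> T"
      then obtain r s where "r > 0" "\<forall>y\<in>Z. d x y < r \<longrightarrow> y \<in> S"
        "s > 0" "\<forall>y\<in>Z. d x y < s \<longrightarrow> y \<in> T"
        using S T by blast
      then show "\<exists>r>0. \<forall>y\<in>Z. d x y < r \<longrightarrow> y \<in> S \<inter> T"
        by (intro exI[of _ "min r s"]) auto
    qed
  next
    fix \<K>
    assume K: "\<forall>S\<in>\<K>. S \<subseteq> Z \<and> (\<forall>x\<in>S. \<exists>r>0. \<forall>y\<in>Z. d x y < r \<longrightarrow> y \<in> S)"
    show "\<Union>\<K> \<subseteq> Z" using K by blast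
    show "\<forall>x\<in>\<Union>\<K>. \<exists>r>0. \<forall>y\<in>Z. d x y < r \<longrightarrow> y \<in> \<Union>\<K>"
    proof
      fix x assume "x \<in> \<Union>\<K>"
      then obtain S where S: "S \<in> \<K>" "x \<in> S" by blast
      then obtain r where "r > 0" "\<forall>y\<in>Z. d x y < r \<longrightarrow> y \<in> S" using K by blast
      then show "\<exists>r>0. \<forall>y\<in>Z. d x y < r \<longrightarrow> y \<in> \<Union>\<K>" using S(1) by blast
    qed
  qed
  then show ?thesis
    by (simp add: pm_topology_def)
qed

text \<open>\<open>\<real>\<^sup>k\<close> is the library's \<^const>\<open>Euclidean_space\<close> \<open>k\<close>.  The encoder lives on \<open>Z\<close>, and \<open>Z\<close>
  sits in an ambient space \<open>Y\<close>; the decoder is required to be continuous on the part of the code set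
  \<open>\<phi>\<^sub>n(Z)\<close> that it decodes into \<open>Y\<close>.  The ambient space is needed because interpolating polytopes
  may have a larger Lipschitz coefficient than the domains they interpolate: for a ball of large
  radius any bound \<open>L\<close> is exceeded.\<close>

definition discretization_assumption ::
  "'z set \<Rightarrow> 'z set \<Rightarrow> ('z \<Rightarrow> 'z \<Rightarrow> real) \<Rightarrow> (nat \<Rightarrow> nat) \<Rightarrow>
    (nat \<Rightarrow> 'z \<Rightarrow> nat \<Rightarrow> real) \<Rightarrow> (nat \<Rightarrow> (nat \<Rightarrow> real) \<Rightarrow> 'z) \<Rightarrow> bool" where
  "discretization_assumption Z Y d \<kappa> \<phi> \<psi> \<longleftrightarrow>
    Z \<subseteq> Y \<and>
    strict_mono_on {1..} \<kappa> \<and> \<kappa> ` {1..} \<subseteq> {1..} \<and>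
    (\<forall>n\<ge>1. continuous_map (pm_topology Z d) (Euclidean_space (\<kappa> n)) (\<phi> n)) \<and>
    (\<forall>n\<ge>1. continuous_map (subtopology (Euclidean_space (\<kappa> n)) {v \<in> \<phi> n ` Z. \<psi> n v \<in> Y})
                          (pm_topology Y d) (\<psi> n)) \<and>
    (\<forall>K. compactin (pm_topology Z d) K \<longrightarrow>
      (\<lambda>n. SUP z\<in>K. ennreal (d z (\<psi> n (\<phi> n z)))) \<longlonglongrightarrow> 0)"

definition centroid :: "'a::euclidean_space set \<Rightarrow> 'a" where
  "centroid \<Omega> = (LINT x:\<Omega>|lborel. x) /\<^sub>R measure lborel \<Omega>"

definition star_region :: "('a::euclidean_space \<Rightarrow> real) \<Rightarrow> 'a set" where
  "star_region b = {x. x \<noteq> 0 \<and> norm x < b (x /\<^sub>R norm x)} \<union> {0}"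

definition is_boundary_fun :: "'a::euclidean_space set \<Rightarrow> ('a \<Rightarrow> real) \<Rightarrow> bool" where
  "is_boundary_fun \<Omega> b \<longleftrightarrow>
    (\<exists>L. L-lipschitz_on (sphere 0 1) b) \<and> (\<forall>e\<in>sphere 0 1. 0 < b e) \<and>
    \<Omega> = (+) (centroid \<Omega>) ` star_region b"

definition star_domain :: "'a::euclidean_space set \<Rightarrow> bool" where
  "star_domain \<Omega> \<longleftrightarrow> open \<Omega> \<and> (\<exists>b. is_boundary_fun \<Omega> b)"

text \<open>An explicit expression for the boundary function (lemma \<open>bdry_eq\<close>).  It also makes sense for
  bounded open sets that are not star domains, which matters because a polytope interpolating a star
  domain at few points need not be star-shaped about its own centroid.\<close>

definition bdry :: "'a::euclidean_space set \<Rightarrow> 'a \<Rightarrow> real" where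
  "bdry \<Omega> e = Sup {t. 0 \<le> t \<and> centroid \<Omega> + t *\<^sub>R e \<in> \<Omega>}"

lemma bdry_eq:
  assumes b: "is_boundary_fun \<Omega> b" and e: "e \<in> sphere 0 1"
  shows "bdry \<Omega> e = b e"
proof -
  have pos: "0 < b e" and om: "\<Omega> = (+) (centroid \<Omega>) ` star_region b"
    using b e by (auto simp: is_boundary_fun_def)
  have ne: "norm e = 1" "e \<noteq> 0" using e by auto
  have "centroid \<Omega> + t *\<^sub>R e \<in> \<Omega> \<longleftrightarrow> t *\<^sub>R e \<in> star_region b" for t
    by (subst om) auto
  moreover have "t *\<^sub>R e \<in> star_region b \<longleftrightarrow> t < b e" if "0 \<le> t" for t
    using that ne pos by (cases "t = 0") (auto simp: star_region_def)
  ultimately have "{t. 0 \<le> t \<and> centroid \<Omega> + t *\<^sub>R e \<in> \<Omega>} = {0..<b e}"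
    by auto
  then show ?thesis
    using pos by (simp add: bdry_def)
qed

definition star_domains :: "real \<Rightarrow> 'a::euclidean_space set set" where
  "star_domains L = {\<Omega>. star_domain \<Omega> \<and> L-lipschitz_on (sphere 0 1) (bdry \<Omega>)}"

definition dU :: "'a::euclidean_space set \<Rightarrow> 'a set \<Rightarrow> real" where
  "dU \<Omega>1 \<Omega>2 = dist (centroid \<Omega>1) (centroid \<Omega>2) + (SUP e\<in>sphere 0 1. \<bar>bdry \<Omega>1 e - bdry \<Omega>2 e\<bar>)"

text \<open>At \<open>x = 0\<close> the value is \<open>centroid \<Omega>\<close>.\<close>

definition deform :: "'a::euclidean_space set \<Rightarrow> 'a \<Rightarrow> 'a" where
  "deform \<Omega> x = centroid \<Omega> + bdry \<Omega> (x /\<^sub>R norm x) *\<^sub>R x"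

definition bdd_borel :: "'a::euclidean_space set \<Rightarrow> ('a \<Rightarrow> real) set" where
  "bdd_borel \<Omega> =
    {f \<in> extensional \<Omega>. f \<in> borel_measurable (restrict_space borel \<Omega>) \<and> bounded (f ` \<Omega>)}"

text \<open>The disjoint union of the \<open>\<B>(\<Omega>)\<close>: a function \<open>f\<^sub>\<Omega>\<close> is the pair \<open>(\<Omega>, f)\<close>.\<close>

definition star_funs :: "real \<Rightarrow> ('a::euclidean_space set \<times> ('a \<Rightarrow> real)) set" where
  "star_funs L = Sigma (star_domains L) bdd_borel"

definition all_star_funs :: "('a::euclidean_space set \<times> ('a \<Rightarrow> real)) set" where
  "all_star_funs = Sigma {\<Omega>. star_domain \<Omega>} bdd_borel"

definition dX ::
  "'a::euclidean_space set \<times> ('a \<Rightarrow> real) \<Rightarrow> 'a set \<times> ('a \<Rightarrow> real) \<Rightarrow> real" where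
  "dX = (\<lambda>(\<Omega>1, f1) (\<Omega>2, f2). dU \<Omega>1 \<Omega>2 +
    sqrt (LINT x:ball 0 1|lborel. (f1 (deform \<Omega>1 x) - f2 (deform \<Omega>2 x))\<^sup>2))"

definition sigma_map ::
  "'a::euclidean_space set \<times> ('a \<Rightarrow> real) \<Rightarrow> 'a set \<times> ('a \<Rightarrow> real)" where
  "sigma_map = (\<lambda>(\<Omega>, f). (\<Omega>, restrict (f \<circ> deform \<Omega>) (ball 0 1)))"

definition sigma_inv ::
  "'a::euclidean_space set \<times> ('a \<Rightarrow> real) \<Rightarrow> 'a set \<times> ('a \<Rightarrow> real)" where
  "sigma_inv = (\<lambda>(\<Omega>, g).
    (\<Omega>, restrict (g \<circ> inv_into (ball 0 1) (deform \<Omega>)) (deform \<Omega> ` ball 0 1)))"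

lemma star_domain_deform_bij:
  fixes \<Omega> :: "'a::euclidean_space set"
  assumes "star_domain \<Omega>"
  shows "bij_betw (deform \<Omega>) (ball 0 1) \<Omega>"
proof -
  obtain b where b: "is_boundary_fun \<Omega> b" using assms by (auto simp: star_domain_def)
  have om: "\<Omega> = (+) (centroid \<Omega>) ` star_region b"
    and pos: "\<And>e. norm e = 1 \<Longrightarrow> 0 < b e"
    using b by (auto simp: is_boundary_fun_def)
  define h :: "'a \<Rightarrow> 'a" where "h x = b (x /\<^sub>R norm x) *\<^sub>R x" for x
  have nrm: "norm (x /\<^sub>R norm x) = 1" if "x \<noteq> 0" for x :: 'a
    using that by simp
  have pos': "0 < b (x /\<^sub>R norm x)" if "x \<noteq> 0" for x :: 'a
    using pos nrm that by blast
  have defh: "deform \<Omega> x = centroid \<Omega> + h x" for x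
  proof (cases "x = 0")
    case False
    then have "bdry \<Omega> (x /\<^sub>R norm x) = b (x /\<^sub>R norm x)"
      using bdry_eq[OF b] nrm by simp
    then show ?thesis by (simp add: deform_def h_def)
  qed (simp add: deform_def h_def)
  have dir: "h x /\<^sub>R norm (h x) = x /\<^sub>R norm x" for x
    using pos'[of x] by (cases "x = 0") (auto simp: h_def)
  have nh: "norm (h x) = b (x /\<^sub>R norm x) * norm x" for x
    using pos'[of x] by (cases "x = 0") (auto simp: h_def)
  have inj: "inj_on h (ball 0 1)"
  proof (rule inj_onI)
    fix x y assume eq: "h x = h y"
    have d: "x /\<^sub>R norm x = y /\<^sub>R norm y" using dir[of x] dir[of y] eq by simp
    show "x = y"
    proof (cases "x = 0")
      case True
      then show ?thesis using d by simp
    next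
      case False
      have "b (x /\<^sub>R norm x) *\<^sub>R x = b (x /\<^sub>R norm x) *\<^sub>R y"
        using eq d by (simp add: h_def)
      then show ?thesis using pos'[OF False] by simp
    qed
  qed
  have img: "h ` ball 0 1 = star_region b"
  proof (intro equalityI subsetI)
    fix y assume "y \<in> h ` ball 0 1"
    then obtain x where x: "norm x < 1" "y = h x" by auto
    show "y \<in> star_region b"
    proof (cases "x = 0")
      case True
      then show ?thesis using x by (simp add: h_def star_region_def)
    next
      case False
      have "y /\<^sub>R norm y = x /\<^sub>R norm x" using dir[of x] x by simp
      moreover have "norm y < b (x /\<^sub>R norm x)"
        using x pos'[OF False] nh[of x] by simp
      moreover have "y \<noteq> 0" using x False pos'[OF False] by (simp add: h_def)
      ultimately show ?thesis by (simp add: star_region_def)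
    qed
  next
    fix y assume y: "y \<in> star_region b"
    show "y \<in> h ` ball 0 1"
    proof (cases "y = 0")
      case True
      then show ?thesis by (auto intro!: image_eqI[of _ _ 0] simp: h_def)
    next
      case False
      define r where "r = b (y /\<^sub>R norm y)"
      define x where "x = y /\<^sub>R r"
      have r: "0 < r" "norm y < r" using y False pos' by (auto simp: star_region_def r_def)
      have "x /\<^sub>R norm x = y /\<^sub>R norm y" using r False by (simp add: x_def)
      then have "h x = r *\<^sub>R x" by (simp add: h_def r_def)
      then have "h x = y" using r by (simp add: x_def)
      moreover have "norm x < 1" using r by (simp add: x_def field_simps)
      ultimately show ?thesis by (intro image_eqI[of _ _ x]) auto
    qed
  qed
  have "deform \<Omega> ` ball 0 1 = (+) (centroid \<Omega>) ` (h ` ball 0 1)"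
    using defh by (auto simp: image_image)
  also have "\<dots> = \<Omega>" using img om by simp
  finally show ?thesis
    using inj defh by (auto simp: bij_betw_def inj_on_def)
qed

lemma sigma_inv_sigma_map:
  assumes "F \<in> all_star_funs"
  shows "sigma_inv (sigma_map F) = F"
proof -
  obtain \<Omega> f where F: "F = (\<Omega>, f)" by fastforce
  have st: "star_domain \<Omega>" and ext: "f \<in> extensional \<Omega>"
    using assms by (auto simp: F all_star_funs_def bdd_borel_def)
  note bij = star_domain_deform_bij[OF st]
  have im: "deform \<Omega> ` ball 0 1 = \<Omega>" using bij by (rule bij_betw_imp_surj_on)
  have "restrict (restrict (f \<circ> deform \<Omega>) (ball 0 1) \<circ> inv_into (ball 0 1) (deform \<Omega>)) \<Omega> = f"
  proof
    fix y
    show "restrict (restrict (f \<circ> deform \<Omega>) (ball 0 1) \<circ> inv_into (ball 0 1) (deform \<Omega>)) \<Omega> y = f y"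
    proof (cases "y \<in> \<Omega>")
      case True
      then have "inv_into (ball 0 1) (deform \<Omega>) y \<in> ball 0 1"
        "deform \<Omega> (inv_into (ball 0 1) (deform \<Omega>) y) = y"
        using im inv_into_into f_inv_into_f by metis+
      then show ?thesis using True by simp
    next
      case False
      then show ?thesis using ext by (simp add: extensional_def)
    qed
  qed
  then show ?thesis using im by (simp add: F sigma_map_def sigma_inv_def)
qed

text \<open>A fixed enumeration \<open>u\<^sub>0, \<dots>, u\<^bsub>d-1\<^esub>\<close> of the standard basis identifies the ambient space
  with \<open>\<real>\<^sup>d\<close>.  All finite families below are indexed from \<open>0\<close>.\<close>

definition basis_enum :: "nat \<Rightarrow> 'a::euclidean_space" where
  "basis_enum = (SOME u. bij_betw u {..<DIM('a)} Basis)"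

definition phi1 :: "(nat \<Rightarrow> nat \<Rightarrow> 'a) \<Rightarrow> nat \<Rightarrow> 'a::euclidean_space set \<Rightarrow> nat \<Rightarrow> real" where
  "phi1 e n \<Omega> = (\<lambda>k. if k < DIM('a) then centroid \<Omega> \<bullet> basis_enum k
                     else if k < n + DIM('a) then bdry \<Omega> (e n (k - DIM('a))) else 0)"

text \<open>\<open>T\<close> is the simplicial decomposition of the boundary of the convex hull of
  \<open>p\<^sub>0, \<dots>, p\<^bsub>n-1\<^esub>\<close>; a simplex is given by the set of indices of its vertices.\<close>

definition boundary_triangulation :: "nat \<Rightarrow> (nat \<Rightarrow> 'a::euclidean_space) \<Rightarrow> nat set set \<Rightarrow> bool" where
  "boundary_triangulation n p T \<longleftrightarrow>
    (\<forall>I\<in>T. (int DIM('a) - 1) simplex (convex hull (p ` I))) \<and>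
    triangulation ((\<lambda>I. convex hull (p ` I)) ` T) \<and>
    (\<Union>I\<in>T. convex hull (p ` I)) = frontier (convex hull (p ` {..<n}))"

text \<open>The open polytope with vertices \<open>c + \<beta>\<^sub>i p\<^sub>i\<close> and the simplicial boundary pattern \<open>T\<close>: the
  interior of the union of the pyramids with apex \<open>c\<close> over the simplices with vertices
  \<open>c + \<beta>\<^sub>i p\<^sub>i\<close>, \<open>i \<in> I\<close>, for \<open>I \<in> T\<close>.  The apex \<open>c\<close> is in general not the centroid of the result.\<close>

definition psi1 ::
  "(nat \<Rightarrow> nat \<Rightarrow> 'a) \<Rightarrow> (nat \<Rightarrow> nat set set) \<Rightarrow> nat \<Rightarrow> (nat \<Rightarrow> real) \<Rightarrow> 'a::euclidean_space set" where
  "psi1 e T n v =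
    (let c = (\<Sum>k<DIM('a). v k *\<^sub>R basis_enum k)
     in interior (\<Union>I\<in>T n. convex hull (insert c ((\<lambda>i. c + v (DIM('a) + i) *\<^sub>R e n i) ` I))))"

definition phi2 ::
  "(nat \<Rightarrow> nat \<Rightarrow> 'a::euclidean_space set) \<Rightarrow> nat \<Rightarrow> ('a \<Rightarrow> real) \<Rightarrow> nat \<Rightarrow> real" where
  "phi2 W n g = (\<lambda>i. if i < n then (LINT x:W n i|lborel. g x) / measure lborel (W n i) else 0)"

definition psi2 ::
  "(nat \<Rightarrow> nat \<Rightarrow> 'a::euclidean_space set) \<Rightarrow> nat \<Rightarrow> (nat \<Rightarrow> real) \<Rightarrow> 'a \<Rightarrow> real" where
  "psi2 W n w = restrict (\<lambda>x. \<Sum>i<n. w i * indicator (W n i) x) (ball 0 1)"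

definition phi ::
  "(nat \<Rightarrow> nat \<Rightarrow> 'a) \<Rightarrow> (nat \<Rightarrow> nat \<Rightarrow> 'a set) \<Rightarrow> (nat \<Rightarrow> nat) \<Rightarrow> (nat \<Rightarrow> nat) \<Rightarrow> nat \<Rightarrow>
    'a::euclidean_space set \<times> ('a \<Rightarrow> real) \<Rightarrow> nat \<Rightarrow> real" where
  "phi e W \<kappa>1 \<kappa>2 n F = (case sigma_map F of (\<Omega>, g) \<Rightarrow>
    (\<lambda>k. if k < \<kappa>1 n + DIM('a) then phi1 e (\<kappa>1 n) \<Omega> k
         else phi2 W (\<kappa>2 n) g (k - (\<kappa>1 n + DIM('a)))))"

definition psi ::
  "(nat \<Rightarrow> nat \<Rightarrow> 'a) \<Rightarrow> (nat \<Rightarrow> nat set set) \<Rightarrow> (nat \<Rightarrow> nat \<Rightarrow> 'a set) \<Rightarrow> (nat \<Rightarrow> nat) \<Rightarrow> (nat \<Rightarrow> nat) \<Rightarrow>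
    nat \<Rightarrow> (nat \<Rightarrow> real) \<Rightarrow> 'a::euclidean_space set \<times> ('a \<Rightarrow> real)" where
  "psi e T W \<kappa>1 \<kappa>2 n v = sigma_inv
    (psi1 e T (\<kappa>1 n) v, psi2 W (\<kappa>2 n) (\<lambda>i. v (\<kappa>1 n + DIM('a) + i)))"

end

theory Submission
  imports Defs
begin

text \<open>All perturbations of domains are compared multiplicatively: if \<open>A\<close> is the star region of a
  Lipschitz function with values in \<open>[m, M]\<close> and \<open>\<tau>\<^sup>-\<^sup>1 A \<subseteq> A' \<subseteq> \<tau> A\<close>, then centroid and boundary function of
  \<open>A'\<close> tend to those of \<open>A\<close> as \<open>\<tau> \<rightarrow> 1\<close>, at a rate depending only on \<open>m\<close>, \<open>M\<close> and the Lipschitz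
  constant.  Near a fixed domain these constants can be chosen uniformly.  A polytope interpolating \<open>A\<close> on a
  fine mesh lies between \<open>\<tau>\<^sup>-\<^sup>1 A\<close> and \<open>\<tau> A\<close>, because directions within one simplex differ by
  little and every ray from the origin meets the triangulated boundary.  Changing the vertex heights by factors close to 1
  also changes the polytope by such factors, whatever the index simplices are, which gives the continuity of the
  decoder for every \<open>n\<close>.  In the function component, the cell average is at
  least as close to \<open>g\<close> as any step function, in particular as one sampled from a continuous
  approximation of a fixed \<open>g\<^sub>0\<close>; so the error at \<open>g\<close> is at most \<open>\<parallel>g - g\<^sub>0\<parallel>\<close> plus a term tending to 0.
  Estimates that are uniform near each point are uniform on compact sets.\<close>

subsection \<open>Uniform limits on compact sets\<close>

text \<open>The difficulty is the choice of origin. \<open>dU\<close> measures each domain from its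
  own centroid, whereas a decoded polytope is built around an apex that is in general not its
  centroid, and it need not be star-shaped about that centroid. Hence the perturbed domain enters
  only as an open set with the two inclusions: its centroid is located first, and its rays from
  there are then compared with rays of the fixed star domain. Moving the origin costs an additive
  error, which a region with Lipschitz boundary function bounded away from 0 absorbs after a slight
  shrinking (\<open>star_region_absorb\<close>). This is why inclusions up to a factor are the
  convenient relation: shrinking composes with them, and volumes of the scaled regions bound the
  first moment. The boundary function of the perturbed domain also comes out positive, which makes
  its deformation injective; the deformation then cancels against \<open>sigma_inv\<close>, and the
  two components of \<open>dX\<close> can be estimated separately.\<close>

lemma topspace_pm_topology [simp]: "topspace (pm_topology Z d) = Z"
proof -
  have "openin (pm_topology Z d) Z"
    by (auto simp: openin_pm_topology intro: exI[of _ "1::real"])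
  then show ?thesis
    unfolding topspace_def openin_pm_topology by blast
qed

lemma openin_pm_ball:
  assumes tri: "\<And>x y z. \<lbrakk>x \<in> Z; y \<in> Z; z \<in> Z\<rbrakk> \<Longrightarrow> d x z \<le> d x y + d y z" and x: "x \<in> Z"
  shows "openin (pm_topology Z d) {y \<in> Z. d x y < r}"
  unfolding openin_pm_topology
proof (intro conjI ballI)
  fix y assume "y \<in> {y \<in> Z. d x y < r}"
  then show "\<exists>s>0. \<forall>z\<in>Z. d y z < s \<longrightarrow> z \<in> {y \<in> Z. d x y < r}"
    using tri[OF x, of y] by (intro exI[of _ "r - d x y"]) fastforce
qed auto

text \<open>Around each point the bound \<open>\<epsilon>\<close> holds on a whole ball from some
  index on; finitely many such balls cover \<open>K\<close>, and finitely many eventual bounds hold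
  simultaneously. In \<open>ennreal\<close> the supremum makes sense before it is known to be
  finite.\<close>

lemma compactin_pm_uniform_limit:
  assumes K: "compactin (pm_topology Z d) K"
    and tri: "\<And>x y z. \<lbrakk>x \<in> Z; y \<in> Z; z \<in> Z\<rbrakk> \<Longrightarrow> d x z \<le> d x y + d y z"
    and refl: "\<And>x. x \<in> Z \<Longrightarrow> d x x = 0"
    and loc: "\<And>x \<epsilon>. \<lbrakk>x \<in> Z; \<epsilon> > 0\<rbrakk> \<Longrightarrow>
      \<exists>r>0. \<forall>\<^sub>F n in sequentially. \<forall>y\<in>Z. d x y < r \<longrightarrow> E n y \<le> \<epsilon>"
  shows "(\<lambda>n. SUP y\<in>K. ennreal (E n y)) \<longlonglongrightarrow> 0"
proof (rule tendsto_0_if_Limsup_eq_0_ennreal)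
  have "\<forall>\<^sub>F n in sequentially. (SUP y\<in>K. ennreal (E n y)) \<le> ennreal \<epsilon>" if \<epsilon>: "\<epsilon> > 0" for \<epsilon> :: real
  proof -
    have KZ: "K \<subseteq> Z" using compactin_subset_topspace[OF K] by simp
    have "\<forall>x\<in>Z. \<exists>r>0. \<forall>\<^sub>F n in sequentially. \<forall>y\<in>Z. d x y < r \<longrightarrow> E n y \<le> \<epsilon>"
      using loc[OF _ \<epsilon>] by blast
    from bchoice[OF this] obtain r where r: "\<And>x. x \<in> Z \<Longrightarrow> r x > 0"
      "\<And>x. x \<in> Z \<Longrightarrow> \<forall>\<^sub>F n in sequentially. \<forall>y\<in>Z. d x y < r x \<longrightarrow> E n y \<le> \<epsilon>"
      by blast
    define B where "B x = {y \<in> Z. d x y < r x}" for x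
    have "\<forall>U\<in>B ` K. openin (pm_topology Z d) U"
      using KZ unfolding B_def by (auto intro!: openin_pm_ball tri)
    moreover have "K \<subseteq> \<Union>(B ` K)"
      using KZ r refl by (force simp: B_def)
    ultimately obtain F where F: "finite F" "F \<subseteq> B ` K" "K \<subseteq> \<Union>F"
      using K unfolding compactin_def by meson
    then obtain X where X: "finite X" "X \<subseteq> K" "F = B ` X"
      by (meson finite_subset_image)
    have "\<forall>\<^sub>F n in sequentially. \<forall>x\<in>X. \<forall>y\<in>Z. d x y < r x \<longrightarrow> E n y \<le> \<epsilon>"
      using X KZ r by (intro eventually_ball_finite) auto
    then show ?thesis
    proof eventually_elim
      case (elim n)
      show ?case
      proof (rule SUP_least)
        fix y assume "y \<in> K"
        then obtain x where "x \<in> X" "y \<in> B x" using F X by blast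
        then show "ennreal (E n y) \<le> ennreal \<epsilon>"
          using elim by (auto simp: B_def intro!: ennreal_leI)
      qed
    qed
  qed
  then have lim: "Limsup sequentially (\<lambda>n. SUP y\<in>K. ennreal (E n y)) \<le> ennreal \<epsilon>"
    if "\<epsilon> > 0" for \<epsilon> :: real
    using that by (intro Limsup_bounded) auto
  have "Limsup sequentially (\<lambda>n. SUP y\<in>K. ennreal (E n y)) \<le> 0"
    by (rule ennreal_le_epsilon) (simp add: lim)
  then show "Limsup sequentially (\<lambda>n. SUP y\<in>K. ennreal (E n y)) = 0" by simp
qed

text \<open>Serves both meshes, that of the boundary simplices and that of the cells of the ball.
  Boundedness makes \<open>diameter\<close>, a real supremum, dominate distances. For empty
  \<open>J n\<close> the value of \<open>MAX\<close> says nothing, but then the conclusion is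
  vacuous.\<close>

lemma eventually_mesh_le:
  fixes D :: "nat \<Rightarrow> 'b \<Rightarrow> 'a::metric_space set"
  assumes lim: "(\<lambda>n. MAX i\<in>J n. diameter (D n i)) \<longlonglongrightarrow> (0::real)"
    and fin: "\<And>n. finite (J n)" and bdd: "\<And>n i. n \<ge> 1 \<Longrightarrow> i \<in> J n \<Longrightarrow> bounded (D n i)" and h: "h > 0"
  shows "\<forall>\<^sub>F n in sequentially. \<forall>i\<in>J n. \<forall>x\<in>D n i. \<forall>y\<in>D n i. dist x y \<le> h"
  using order_tendstoD(2)[OF lim h] eventually_ge_at_top[of 1]
proof eventually_elim
  case (elim n)
  show ?case
  proof (intro ballI)
    fix i x y assume i: "i \<in> J n" "x \<in> D n i" "y \<in> D n i"
    have "dist x y \<le> diameter (D n i)"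
      using bdd[OF _ i(1)] elim i by (intro diameter_bounded_bound) auto
    also have "\<dots> \<le> (MAX i\<in>J n. diameter (D n i))"
      using fin i by (intro Max_ge) auto
    finally show "dist x y \<le> h" using elim by simp
  qed
qed

subsection \<open>Square integrable functions\<close>

text \<open>The weighted bound \<open>pt\<close> is integrated; with weights \<open>A\<close>,
  \<open>B\<close> equal to the two norms its right-hand side would become exactly
  \<open>(A + B)\<^sup>2\<close>. Adding \<open>\<epsilon> / 2\<close> keeps the weights positive,
  hence division legitimate, when a norm vanishes.\<close>

lemma L2_triangle:
  fixes f g :: "'b \<Rightarrow> real"
  assumes f: "f \<in> borel_measurable M" "integrable M (\<lambda>x. (f x)\<^sup>2)"
    and g: "g \<in> borel_measurable M" "integrable M (\<lambda>x. (g x)\<^sup>2)"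
  shows "sqrt (LINT x|M. (f x + g x)\<^sup>2) \<le> sqrt (LINT x|M. (f x)\<^sup>2) + sqrt (LINT x|M. (g x)\<^sup>2)"
proof (rule field_le_epsilon)
  fix \<epsilon> :: real assume \<epsilon>: "\<epsilon> > 0"
  define A where "A = sqrt (LINT x|M. (f x)\<^sup>2) + \<epsilon> / 2"
  define B where "B = sqrt (LINT x|M. (g x)\<^sup>2) + \<epsilon> / 2"
  have AB: "A > 0" "B > 0" using \<epsilon> by (auto simp: A_def B_def add_nonneg_pos)
  have "(LINT x|M. (f x)\<^sup>2) = (sqrt (LINT x|M. (f x)\<^sup>2))\<^sup>2" by simp
  also have "\<dots> \<le> A\<^sup>2" using \<epsilon> unfolding A_def by (intro power_mono) auto
  finally have fA: "(LINT x|M. (f x)\<^sup>2) \<le> A\<^sup>2" .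
  have "(LINT x|M. (g x)\<^sup>2) = (sqrt (LINT x|M. (g x)\<^sup>2))\<^sup>2" by simp
  also have "\<dots> \<le> B\<^sup>2" using \<epsilon> unfolding B_def by (intro power_mono) auto
  finally have gB: "(LINT x|M. (g x)\<^sup>2) \<le> B\<^sup>2" .
  have pt: "(a + b)\<^sup>2 \<le> (1 + B / A) * a\<^sup>2 + (1 + A / B) * b\<^sup>2" for a b :: real
  proof -
    have "(1 + B / A) * a\<^sup>2 + (1 + A / B) * b\<^sup>2 - (a + b)\<^sup>2 = (B * a - A * b)\<^sup>2 / (A * B)"
      using AB by (simp add: field_simps power2_eq_square)
    also have "\<dots> \<ge> 0" using AB by simp
    finally show ?thesis by simp
  qed
  have int: "integrable M (\<lambda>x. (1 + B / A) * (f x)\<^sup>2 + (1 + A / B) * (g x)\<^sup>2)"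
    using f g by simp
  have "(LINT x|M. (f x + g x)\<^sup>2) \<le> (LINT x|M. (1 + B / A) * (f x)\<^sup>2 + (1 + A / B) * (g x)\<^sup>2)"
    using pt order_trans[OF zero_le_power2 pt] by (intro integral_mono' int)
  also have "\<dots> = (1 + B / A) * (LINT x|M. (f x)\<^sup>2) + (1 + A / B) * (LINT x|M. (g x)\<^sup>2)"
    using f g by simp
  also have "\<dots> \<le> (1 + B / A) * A\<^sup>2 + (1 + A / B) * B\<^sup>2"
    using fA gB AB by (intro add_mono mult_left_mono) auto
  also have "\<dots> = (A + B)\<^sup>2" using AB by (simp add: field_simps power2_eq_square)
  finally have "sqrt (LINT x|M. (f x + g x)\<^sup>2) \<le> sqrt ((A + B)\<^sup>2)" by (rule real_sqrt_le_mono)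
  then show "sqrt (LINT x|M. (f x + g x)\<^sup>2) \<le>
      sqrt (LINT x|M. (f x)\<^sup>2) + sqrt (LINT x|M. (g x)\<^sup>2) + \<epsilon>"
    using AB by (simp add: A_def B_def)
qed

text \<open>All functions of the proof lie in this class: pullbacks to the ball, step functions,
  indicators, continuous approximants. It is closed under differences and products, so on a finite
  measure space every integrability question is settled at once.\<close>

definition bdd_measurable :: "'b measure \<Rightarrow> ('b \<Rightarrow> real) set" where
  "bdd_measurable M = {f \<in> borel_measurable M. \<exists>B. \<forall>x\<in>space M. \<bar>f x\<bar> \<le> B}"

definition L2norm :: "'b measure \<Rightarrow> ('b \<Rightarrow> real) \<Rightarrow> real" where
  "L2norm M f = sqrt (LINT x|M. (f x)\<^sup>2)"

lemma bdd_measurable_diff: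
  assumes "f \<in> bdd_measurable M" "g \<in> bdd_measurable M"
  shows "(\<lambda>x. f x - g x) \<in> bdd_measurable M"
proof -
  obtain B C where BC: "\<And>x. x \<in> space M \<Longrightarrow> \<bar>f x\<bar> \<le> B" "\<And>x. x \<in> space M \<Longrightarrow> \<bar>g x\<bar> \<le> C"
    using assms by (auto simp: bdd_measurable_def)
  have "\<bar>f x - g x\<bar> \<le> B + C" if "x \<in> space M" for x
    using BC[OF that] by linarith
  then show ?thesis using assms by (auto simp: bdd_measurable_def)
qed

lemma bdd_measurable_mult:
  assumes "f \<in> bdd_measurable M" "g \<in> bdd_measurable M"
  shows "(\<lambda>x. f x * g x) \<in> bdd_measurable M"
proof -
  obtain B C where BC: "\<And>x. x \<in> space M \<Longrightarrow> \<bar>f x\<bar> \<le> B" "\<And>x. x \<in> space M \<Longrightarrow> \<bar>g x\<bar> \<le> C"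
    using assms by (auto simp: bdd_measurable_def)
  have "\<bar>f x * g x\<bar> \<le> B * C" if "x \<in> space M" for x
    using BC[OF that] by (auto simp: abs_mult intro!: mult_mono)
  then show ?thesis using assms by (auto simp: bdd_measurable_def)
qed

lemma (in finite_measure) integrable_bdd_measurable:
  assumes "f \<in> bdd_measurable M"
  shows "integrable M f"
proof -
  obtain B where "\<And>x. x \<in> space M \<Longrightarrow> \<bar>f x\<bar> \<le> B" using assms by (auto simp: bdd_measurable_def)
  then show ?thesis
    using assms by (intro integrable_const_bound[of _ B]) (auto simp: bdd_measurable_def)
qed

lemma (in finite_measure) integrable_square_bdd_measurable:
  assumes "f \<in> bdd_measurable M"
  shows "integrable M (\<lambda>x. (f x)\<^sup>2)"
  using integrable_bdd_measurable[OF bdd_measurable_mult[OF assms assms]]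
  by (simp add: power2_eq_square)

lemma L2norm_cong: "(\<And>x. x \<in> space M \<Longrightarrow> f x = g x) \<Longrightarrow> L2norm M f = L2norm M g"
  unfolding L2norm_def by (intro arg_cong[where f = sqrt] Bochner_Integration.integral_cong) auto

lemma L2norm_minus_commute: "L2norm M (\<lambda>x. f x - g x) = L2norm M (\<lambda>x. g x - f x)"
  by (simp add: L2norm_def power2_commute)

lemma L2norm_nonneg: "0 \<le> L2norm M f"
  by (simp add: L2norm_def)

lemma (in finite_measure) L2norm_diff_triangle:
  assumes "f \<in> bdd_measurable M" "g \<in> bdd_measurable M" "h \<in> bdd_measurable M"
  shows "L2norm M (\<lambda>x. f x - h x) \<le> L2norm M (\<lambda>x. f x - g x) + L2norm M (\<lambda>x. g x - h x)"
proof -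
  have d: "(\<lambda>x. f x - g x) \<in> bdd_measurable M" "(\<lambda>x. g x - h x) \<in> bdd_measurable M"
    using assms by (auto intro: bdd_measurable_diff)
  show ?thesis
    using L2_triangle[of "\<lambda>x. f x - g x" M "\<lambda>x. g x - h x"] d integrable_square_bdd_measurable
    by (simp add: L2norm_def bdd_measurable_def)
qed

lemma (in finite_measure) L2norm_le_const:
  assumes f: "f \<in> bdd_measurable M" and c: "c \<ge> 0" "\<And>x. x \<in> space M \<Longrightarrow> \<bar>f x\<bar> \<le> c"
  shows "L2norm M f \<le> c * sqrt (measure M (space M))"
proof -
  have "(LINT x|M. (f x)\<^sup>2) \<le> (LINT x|M. c\<^sup>2)"
    using integrable_square_bdd_measurable[OF f] c
    by (intro integral_mono) (auto simp: abs_le_square_iff[symmetric])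
  also have "\<dots> = c\<^sup>2 * measure M (space M)" by simp
  finally have "L2norm M f \<le> sqrt (c\<^sup>2 * measure M (space M))"
    unfolding L2norm_def by (rule real_sqrt_le_mono)
  then show ?thesis using c by (simp add: real_sqrt_mult)
qed

text \<open>Cauchy-Schwarz against the constant 1: with total mass \<open>m\<close> and integral
  \<open>I\<close>, expand the nonnegative integral of \<open>(m * f x - I)\<^sup>2\<close>. The
  expansion carries a factor \<open>m\<close>, so the null space is treated apart.\<close>

lemma (in finite_measure) abs_integral_le_L2norm:
  assumes f: "f \<in> bdd_measurable M"
  shows "\<bar>LINT x|M. f x\<bar> \<le> sqrt (measure M (space M)) * L2norm M f"
proof -
  define m where "m = measure M (space M)"
  define I where "I = (LINT x|M. f x)"
  note i = integrable_bdd_measurable[OF f] integrable_square_bdd_measurable[OF f]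
  have "0 \<le> (LINT x|M. (m * f x - I)\<^sup>2)" by simp
  also have "\<dots> = (LINT x|M. m\<^sup>2 * (f x)\<^sup>2 - 2 * m * I * f x + I\<^sup>2)"
    by (simp add: power2_diff power_mult_distrib algebra_simps)
  also have "\<dots> = m\<^sup>2 * (LINT x|M. (f x)\<^sup>2) - 2 * m * I * I + I\<^sup>2 * m"
    using i by (simp add: m_def I_def)
  also have "\<dots> = m * (m * (LINT x|M. (f x)\<^sup>2) - I\<^sup>2)"
    by (simp add: power2_eq_square algebra_simps)
  finally have *: "0 \<le> m * (m * (LINT x|M. (f x)\<^sup>2) - I\<^sup>2)" .
  have "I\<^sup>2 \<le> m * (LINT x|M. (f x)\<^sup>2)"
  proof (cases "m = 0")
    case True
    then have "emeasure M (space M) = 0" by (simp add: m_def emeasure_eq_measure)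
    then have "AE x in M. f x = 0" by (intro AE_I[of _ _ "space M"]) auto
    then have "I = (LINT x|M. 0)"
      unfolding I_def using f by (intro integral_cong_AE) (auto simp: bdd_measurable_def)
    then show ?thesis using True by simp
  next
    case False
    then have "m > 0" by (simp add: m_def zero_less_measure_iff)
    then show ?thesis using * by (simp add: zero_le_mult_iff)
  qed
  then have "sqrt (I\<^sup>2) \<le> sqrt (m * (LINT x|M. (f x)\<^sup>2))" by (rule real_sqrt_le_mono)
  then show ?thesis by (simp add: real_sqrt_mult I_def m_def L2norm_def)
qed

subsection \<open>Star regions\<close>

lemma sphere_normalize: "x \<noteq> 0 \<Longrightarrow> x /\<^sub>R norm x \<in> sphere (0::'a::real_normed_vector) 1"
  by simp

lemma sphere_nonempty: "sphere (0::'a::euclidean_space) 1 \<noteq> {}"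
  by simp

lemma zero_in_star_region [simp]: "0 \<in> star_region b"
  by (simp add: star_region_def)

lemma star_region_iff: "x \<noteq> 0 \<Longrightarrow> x \<in> star_region b \<longleftrightarrow> norm x < b (x /\<^sub>R norm x)"
  by (simp add: star_region_def)

lemma star_region_cong:
  assumes "\<And>e. e \<in> sphere 0 1 \<Longrightarrow> b e = b' e"
  shows "star_region b = star_region b'"
proof -
  have "x \<in> star_region b \<longleftrightarrow> x \<in> star_region b'" for x
    using assms[OF sphere_normalize, of x] by (cases "x = 0") (auto simp: star_region_iff)
  then show ?thesis by blast
qed

lemma scaleR_in_star_region:
  assumes x: "x \<in> star_region b" and s: "0 \<le> s" "s \<le> 1"
  shows "s *\<^sub>R x \<in> star_region b"
proof (cases "x = 0 \<or> s = 0")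
  case False
  have dir: "(s *\<^sub>R x) /\<^sub>R norm (s *\<^sub>R x) = x /\<^sub>R norm x" using False s by simp
  have "norm (s *\<^sub>R x) \<le> norm x" using s by (simp add: mult_left_le_one_le)
  also have "norm x < b (x /\<^sub>R norm x)" using x False by (simp add: star_region_iff)
  finally have "norm (s *\<^sub>R x) < b ((s *\<^sub>R x) /\<^sub>R norm (s *\<^sub>R x))" unfolding dir .
  then show ?thesis using False star_region_iff[of "s *\<^sub>R x" b] by simp
qed auto

text \<open>Multiplied by \<open>norm x\<close>, the difference of the unit vectors is
  \<open>x - y\<close> plus a correction along \<open>y\<close> of length
  \<open>\<bar>norm y - norm x\<bar>\<close>; each term is at most \<open>dist x y\<close>.\<close>

lemma dist_normalize_le:
  fixes x y :: "'a::real_normed_vector"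
  assumes "x \<noteq> 0" "y \<noteq> 0"
  shows "dist (x /\<^sub>R norm x) (y /\<^sub>R norm y) \<le> 2 * dist x y / norm x"
proof -
  have "norm x * dist (x /\<^sub>R norm x) (y /\<^sub>R norm y) = norm (norm x *\<^sub>R (x /\<^sub>R norm x - y /\<^sub>R norm y))"
    by (simp add: dist_norm)
  also have "norm x *\<^sub>R (x /\<^sub>R norm x - y /\<^sub>R norm y) = (x - y) + (norm y - norm x) *\<^sub>R (y /\<^sub>R norm y)"
    using assms by (simp add: algebra_simps)
  also have "norm \<dots> \<le> norm (x - y) + norm ((norm y - norm x) *\<^sub>R (y /\<^sub>R norm y))"
    by (rule norm_triangle_ineq)
  also have "\<dots> \<le> 2 * dist x y"
    using norm_triangle_ineq3[of x y] sphere_normalize[OF assms(2)]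
    by (simp only: norm_scaleR dist_norm) (simp add: abs_minus_commute)
  finally show ?thesis using assms by (simp add: field_simps)
qed

text \<open>The constant \<open>\<delta>\<close> does not depend on \<open>b\<close>; this is what makes the later estimates uniform.\<close>

lemma star_region_absorb:
  fixes L m \<sigma> :: real
  assumes L: "0 \<le> L" and m: "0 < m" and \<sigma>: "\<sigma> < 1"
  obtains \<delta> where "\<delta> > 0"
    "\<And>(b :: 'a::euclidean_space \<Rightarrow> real) s w y.
      \<lbrakk>L-lipschitz_on (sphere 0 1) b; \<And>e. e \<in> sphere 0 1 \<Longrightarrow> m \<le> b e; 0 \<le> s; s \<le> \<sigma>;
       w \<in> star_region b; norm (y - s *\<^sub>R w) \<le> \<delta>\<rbrakk> \<Longrightarrow> y \<in> star_region b"
proof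
  \<comment> \<open>The ball of radius \<open>m\<close> lies in every such region, so only points
    with \<open>m \<le> norm y\<close> matter. The first bound keeps \<open>s *\<^sub>R w\<close>
    away from 0 for them, so directions can be compared. By the second, the margin
    \<open>(1 - \<sigma>) * m\<close> gained by shrinking pays for the radial error
    \<open>\<delta>\<close> and for the change \<open>L * (2 * \<delta> / m)\<close> of
    \<open>b\<close> between the two directions.\<close>
  define \<delta> where "\<delta> = min (m / 2) ((1 - \<sigma>) * m / (1 + 2 * L / m))"
  have den: "1 + 2 * L / m > 0" using L m by (simp add: add_pos_nonneg)
  show \<delta>: "\<delta> > 0" using m \<sigma> den by (simp add: \<delta>_def)
  have \<delta>1: "\<delta> \<le> m / 2" unfolding \<delta>_def by (rule min.cobounded1)
  have "\<delta> \<le> (1 - \<sigma>) * m / (1 + 2 * L / m)" unfolding \<delta>_def by (rule min.cobounded2)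
  then have \<delta>2: "\<delta> + L * (2 * \<delta> / m) \<le> (1 - \<sigma>) * m"
    using den by (simp add: pos_le_divide_eq algebra_simps)
  fix b :: "'a \<Rightarrow> real" and s w y
  assume b: "L-lipschitz_on (sphere 0 1) b" "\<And>e. e \<in> sphere 0 1 \<Longrightarrow> m \<le> b e"
    and s: "0 \<le> s" "s \<le> \<sigma>" and w: "w \<in> star_region b" and d: "norm (y - s *\<^sub>R w) \<le> \<delta>"
  consider "y = 0" | "y \<noteq> 0" "norm y < m" | "m \<le> norm y" by force
  then show "y \<in> star_region b"
  proof cases
    case 2
    then show ?thesis using b(2)[OF sphere_normalize[of y]] by (subst star_region_iff) auto
  next
    case 3
    have y0: "y \<noteq> 0" using 3 m by auto
    have "norm y \<le> norm (s *\<^sub>R w) + \<delta>"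
      using d norm_triangle_ineq3[of y "s *\<^sub>R w"] by linarith
    then have sw: "s *\<^sub>R w \<noteq> 0" using 3 \<delta>1 m by auto
    then have w0: "w \<noteq> 0" and s0: "s > 0" using s by auto
    define u where "u = y /\<^sub>R norm y"
    define v where "v = w /\<^sub>R norm w"
    have uv: "u \<in> sphere 0 1" "v \<in> sphere 0 1" using y0 w0 by (auto simp: u_def v_def)
    have "v = (s *\<^sub>R w) /\<^sub>R norm (s *\<^sub>R w)" using s0 by (simp add: v_def)
    then have "dist u v \<le> 2 * dist y (s *\<^sub>R w) / norm y"
      using dist_normalize_le[OF y0 sw] by (simp add: u_def)
    also have "\<dots> \<le> 2 * \<delta> / m"
      using 3 m d \<delta> by (intro frac_le) (auto simp: dist_norm)
    finally have "dist u v \<le> 2 * \<delta> / m" .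
    then have "L * dist u v \<le> L * (2 * \<delta> / m)" using L by (intro mult_left_mono) auto
    then have bb: "b v - L * (2 * \<delta> / m) \<le> b u"
      using lipschitz_onD[OF b(1) uv] by (simp add: dist_real_def abs_le_iff)
    have "norm w < b v" using w w0 by (simp add: star_region_iff v_def)
    then have "s * norm w < s * b v" using s0 by simp
    then have "norm y < s * b v + \<delta>"
      using \<open>norm y \<le> norm (s *\<^sub>R w) + \<delta>\<close> s by simp
    also have "s * b v \<le> \<sigma> * b v" using s b(2)[OF uv(2)] m by (intro mult_right_mono) auto
    also have "\<sigma> * b v + \<delta> \<le> b v - L * (2 * \<delta> / m)"
    proof -
      have "(1 - \<sigma>) * m \<le> (1 - \<sigma>) * b v" using b(2)[OF uv(2)] \<sigma> by (intro mult_left_mono) auto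
      then show ?thesis using \<delta>2 by (simp add: algebra_simps)
    qed
    also have "\<dots> \<le> b u" by (rule bb)
    finally show ?thesis using y0 by (simp add: star_region_iff u_def)
  qed auto
qed

text \<open>Replaces the existential witness in \<open>star_domain\<close> by the canonical function
  \<open>bdry\<close>, to which all later estimates refer.\<close>

lemma star_domain_bdry:
  assumes "star_domain \<Omega>"
  shows star_domain_open: "open \<Omega>"
    and bdry_lipschitz: "\<exists>L. L-lipschitz_on (sphere 0 1) (bdry \<Omega>)"
    and bdry_pos: "\<And>e. e \<in> sphere 0 1 \<Longrightarrow> 0 < bdry \<Omega> e"
    and in_star_domain_iff: "\<And>x. centroid \<Omega> + x \<in> \<Omega> \<longleftrightarrow> x \<in> star_region (bdry \<Omega>)"
proof -
  show "open \<Omega>" using assms by (simp add: star_domain_def)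
  obtain b where b: "is_boundary_fun \<Omega> b" using assms by (auto simp: star_domain_def)
  note eq = bdry_eq[OF b]
  show "\<exists>L. L-lipschitz_on (sphere 0 1) (bdry \<Omega>)"
    using b eq unfolding is_boundary_fun_def lipschitz_on_def by auto
  show "0 < bdry \<Omega> e" if "e \<in> sphere 0 1" for e
    using b eq[OF that] that by (simp add: is_boundary_fun_def)
  fix x
  have "\<Omega> = (+) (centroid \<Omega>) ` star_region b" using b by (simp add: is_boundary_fun_def)
  also have "star_region b = star_region (bdry \<Omega>)" using eq by (intro star_region_cong) simp
  finally have om: "\<Omega> = (+) (centroid \<Omega>) ` star_region (bdry \<Omega>)" .
  show "centroid \<Omega> + x \<in> \<Omega> \<longleftrightarrow> x \<in> star_region (bdry \<Omega>)"
    by (subst om) auto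
qed

subsection \<open>Stability of the centroid and the boundary function\<close>

lemma measure_lborel_scaleR:
  fixes A :: "'a::euclidean_space set"
  assumes A: "A \<in> sets borel" and r: "r > 0"
  shows "(*\<^sub>R) r ` A \<in> sets borel" "measure lborel ((*\<^sub>R) r ` A) = r ^ DIM('a) * measure lborel A"
proof -
  have "(*\<^sub>R) r ` A = (\<lambda>x. x /\<^sub>R r) -` A \<inter> space borel"
  proof -
    have "x \<in> (*\<^sub>R) r ` A" if "x /\<^sub>R r \<in> A" for x
      using that r by (intro image_eqI[of _ _ "x /\<^sub>R r"]) auto
    then show ?thesis using r by auto
  qed
  also have "\<dots> \<in> sets borel" using A by (intro measurable_sets) auto
  finally show B: "(*\<^sub>R) r ` A \<in> sets borel" .
  have "measure lebesgue ((\<lambda>x. r *\<^sub>R x + 0) ` A) = \<bar>r\<bar> ^ DIM('a) * measure lebesgue A"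
    by (rule measure_lebesgue_affine)
  then show "measure lborel ((*\<^sub>R) r ` A) = r ^ DIM('a) * measure lborel A"
    using A B r by (simp add: measure_completion)
qed

lemma bounded_borel_integrable:
  fixes A :: "'a::euclidean_space set"
  assumes A: "A \<in> sets borel" and bnd: "bounded A"
  shows "integrable lborel (indicator A :: 'a \<Rightarrow> real)" "set_integrable lborel A (\<lambda>x. x)"
proof -
  obtain M where M: "\<And>x. x \<in> A \<Longrightarrow> norm x \<le> M" using bnd by (auto simp: bounded_iff)
  have fin: "emeasure lborel A < \<infinity>" using bnd by (rule emeasure_bounded_finite)
  show "integrable lborel (indicator A :: 'a \<Rightarrow> real)" using A fin by simp
  have "integrable lborel (\<lambda>x. indicator A x * M)"
    using A fin by (intro integrable_mult_left) simp
  then show "set_integrable lborel A (\<lambda>x. x)"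
    unfolding set_integrable_def
  proof (rule Bochner_Integration.integrable_bound)
    show "(\<lambda>x. indicat_real A x *\<^sub>R x) \<in> borel_measurable lborel" using A by simp
    have "norm (indicat_real A x *\<^sub>R x) \<le> norm (indicat_real A x * M)" for x
      using M[of x] by (cases "x \<in> A") auto
    then show "AE x in lborel. norm (indicat_real A x *\<^sub>R x) \<le> norm (indicat_real A x * M)" by simp
  qed
qed

text \<open>Positive measure excludes division by zero, which would put the centroid of a null set
  at 0 wherever the set lies.\<close>

lemma centroid_translation:
  fixes A :: "'a::euclidean_space set"
  assumes A: "A \<in> sets borel" "bounded A" and pos: "0 < measure lborel A"
  shows "centroid ((+) c ` A) = c + centroid A"
proof -
  have ind: "indicator ((+) c ` A) (c + x) = (indicator A x :: real)" for x
    by (auto simp: indicator_def)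
  have im: "(+) c ` A = (\<lambda>x. x - c) -` A \<inter> space borel"
  proof -
    have "x \<in> (+) c ` A" if "x - c \<in> A" for x
      using that by (intro image_eqI[of _ _ "x - c"]) auto
    then show ?thesis by auto
  qed
  have B: "(+) c ` A \<in> sets borel" unfolding im using A by (intro measurable_sets) auto
  note i = bounded_borel_integrable[OF A]
  have "measure lborel ((+) c ` A) = measure lborel A"
    using measure_lebesgue_affine[of 1 c A] A B by (simp add: measure_completion add.commute cong: image_cong_simp)
  moreover have "(LINT x:(+) c ` A|lborel. x) = measure lborel A *\<^sub>R c + (LINT x:A|lborel. x)"
  proof -
    have "(LINT x:(+) c ` A|lborel. x) = (LINT x|distr lborel borel ((+) c). indicator ((+) c ` A) x *\<^sub>R x)"
      by (simp add: set_lebesgue_integral_def lborel_distr_plus)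
    also have "\<dots> = (LINT x|lborel. indicator A x *\<^sub>R c + indicator A x *\<^sub>R x)"
      using B by (subst integral_distr) (auto simp: ind scaleR_add_right)
    also have "\<dots> = (LINT x|lborel. indicator A x *\<^sub>R c) + (LINT x|lborel. indicator A x *\<^sub>R x)"
      using i by (intro Bochner_Integration.integral_add) (auto simp: set_integrable_def)
    also have "(LINT x|lborel. indicator A x *\<^sub>R c) = measure lborel A *\<^sub>R c"
      using i A by simp
    finally show ?thesis by (simp add: set_lebesgue_integral_def)
  qed
  ultimately show ?thesis using pos by (simp add: centroid_def scaleR_add_right)
qed

text \<open>Both sets lie between \<open>Q\<close>, the set \<open>A\<close> shrunk by
  \<open>\<tau>\<close>, and \<open>P\<close>, the set \<open>A\<close> enlarged by
  \<open>\<tau>\<close>. Their first moments therefore differ only by what lies in \<open>P\<close>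
  outside \<open>Q\<close>, where vectors have length at most \<open>\<tau> * M\<close>, and the
  moment of \<open>A\<close> is 0. Dividing by the volume of \<open>A'\<close>, which is at least
  that of \<open>Q\<close>, leaves the ratio of the volumes of \<open>P\<close> and
  \<open>Q\<close>, that is \<open>\<tau> ^ (2 * DIM('a))\<close>.\<close>

lemma norm_centroid_between_le:
  fixes A A' :: "'a::euclidean_space set"
  assumes A: "A \<in> sets borel" and A': "A' \<in> sets borel"
    and bnd: "\<And>x. x \<in> A \<Longrightarrow> norm x \<le> M" and pos: "0 < measure lborel A"
    and centr: "centroid A = 0" and \<tau>: "\<tau> \<ge> 1"
    and star: "\<And>x. x \<in> A \<Longrightarrow> x /\<^sub>R \<tau> \<in> A"
    and inner: "\<And>x. x \<in> A \<Longrightarrow> x /\<^sub>R \<tau> \<in> A'" and outer: "\<And>x. x \<in> A' \<Longrightarrow> x /\<^sub>R \<tau> \<in> A"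
  shows "0 < measure lborel A'" "norm (centroid A') \<le> M * \<tau> * (\<tau> ^ (2 * DIM('a)) - 1)"
proof -
  define P where "P = (*\<^sub>R) \<tau> ` A"
  define Q where "Q = (*\<^sub>R) (1 / \<tau>) ` A"
  have t0: "\<tau> > 0" using \<tau> by simp
  have PQ: "P \<in> sets borel" "Q \<in> sets borel" "measure lborel P = \<tau> ^ DIM('a) * measure lborel A"
    "measure lborel Q = (1 / \<tau>) ^ DIM('a) * measure lborel A"
    unfolding P_def Q_def using measure_lborel_scaleR[OF A] t0 by auto
  have subP: "B \<subseteq> P" if "\<And>x. x \<in> B \<Longrightarrow> x /\<^sub>R \<tau> \<in> A" for B
    unfolding P_def using that t0 by (auto intro!: image_eqI[of _ _ "_ /\<^sub>R \<tau>"])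
  have QA: "Q \<subseteq> A" "Q \<subseteq> A'" using star inner by (auto simp: Q_def divide_inverse)
  have AP: "A \<subseteq> P" "A' \<subseteq> P" using subP star outer by auto
  have M: "norm x \<le> \<tau> * M" if "x \<in> P" for x
    using that bnd t0 by (auto simp: P_def)
  have "bounded P" using M by (auto simp: bounded_iff)
  then have bd: "bounded A" "bounded A'" "bounded P" "bounded Q"
    using AP QA by (meson bounded_subset order_trans)+
  note iA = bounded_borel_integrable[OF A bd(1)] and iA' = bounded_borel_integrable[OF A' bd(2)]
    and iP = bounded_borel_integrable[OF PQ(1) bd(3)] and iQ = bounded_borel_integrable[OF PQ(2) bd(4)]
  have mQ: "measure lborel Q \<le> measure lborel A'"
    using QA A' PQ bd emeasure_bounded_finite[of A'] by (intro measure_mono_fmeasurable) (auto simp: fmeasurable_def)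
  have Qpos: "0 < measure lborel Q" using pos t0 PQ by simp
  then show pos': "0 < measure lborel A'" using mQ by linarith
  have "(LINT x:A|lborel. x) = 0" using centr pos by (simp add: centroid_def)
  then have "(LINT x:A'|lborel. x) = (LINT x:A'|lborel. x) - (LINT x:A|lborel. x)" by simp
  also have "\<dots> = (LINT x|lborel. indicator A' x *\<^sub>R x - indicator A x *\<^sub>R x)"
    using iA iA' by (simp add: set_lebesgue_integral_def set_integrable_def)
  finally have "norm (LINT x:A'|lborel. x) \<le> (LINT x|lborel. norm (indicator A' x *\<^sub>R x - indicator A x *\<^sub>R x))"
    by (metis integral_norm_bound)
  also have "\<dots> \<le> (LINT x|lborel. (indicator P x - indicator Q x) * (\<tau> * M))"
  proof (rule integral_mono')
    show "integrable lborel (\<lambda>x. (indicat_real P x - indicator Q x) * (\<tau> * M))" using iP iQ by simp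
    show "norm (indicat_real A' x *\<^sub>R x - indicator A x *\<^sub>R x) \<le> (indicator P x - indicator Q x) * (\<tau> * M)" for x
      using M[of x] QA AP order_trans[OF norm_ge_zero M[of x]] by (auto simp: indicator_def)
    then show "0 \<le> (indicator P x - indicator Q x) * (\<tau> * M)" for x :: 'a
      using norm_ge_zero order_trans by blast
  qed
  also have "\<dots> = (measure lborel P - measure lborel Q) * (\<tau> * M)"
    using iP iQ PQ by (simp add: Bochner_Integration.integral_diff)
  finally have I: "norm (LINT x:A'|lborel. x) \<le> (measure lborel P - measure lborel Q) * (\<tau> * M)" .
  have "norm (centroid A') = norm (LINT x:A'|lborel. x) / measure lborel A'"
    using pos' by (simp add: centroid_def divide_inverse)
  also have "\<dots> \<le> norm (LINT x:A'|lborel. x) / measure lborel Q"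
    using mQ Qpos by (intro divide_left_mono) auto
  also have "\<dots> \<le> (measure lborel P - measure lborel Q) * (\<tau> * M) / measure lborel Q"
    using I Qpos by (intro divide_right_mono) auto
  also have "\<dots> = (measure lborel P / measure lborel Q - 1) * (\<tau> * M)"
    using Qpos by (simp add: field_simps)
  also have "measure lborel P / measure lborel Q = \<tau> ^ (2 * DIM('a))"
    using pos t0 by (simp add: PQ field_simps power_mult power2_eq_square power_mult_distrib)
  finally show "norm (centroid A') \<le> M * \<tau> * (\<tau> ^ (2 * DIM('a)) - 1)" by (simp add: mult_ac)
qed


text \<open>\<open>\<Omega>\<close> need not be star-shaped about its centroid, so a ray may leave
  and re-enter it. The lower bound comes from a whole initial segment; the upper bound concerns
  every point of the ray and also makes the supremum in \<open>bdry\<close> well behaved.\<close>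

lemma bdry_between:
  assumes t: "0 < p" "\<And>t. \<lbrakk>0 \<le> t; t < p\<rbrakk> \<Longrightarrow> centroid \<Omega> + t *\<^sub>R e \<in> \<Omega>"
    and q: "\<And>t. \<lbrakk>0 \<le> t; centroid \<Omega> + t *\<^sub>R e \<in> \<Omega>\<rbrakk> \<Longrightarrow> t \<le> q"
  shows "p \<le> bdry \<Omega> e" "bdry \<Omega> e \<le> q"
proof -
  let ?S = "{t. 0 \<le> t \<and> centroid \<Omega> + t *\<^sub>R e \<in> \<Omega>}"
  have sub: "{0..<p} \<subseteq> ?S" using t by auto
  have bdd: "bdd_above ?S" using q by (intro bdd_aboveI[of _ q]) auto
  have "p = Sup {0..<p}" using t(1) by simp
  also have "\<dots> \<le> Sup ?S" using sub bdd t(1) by (intro cSup_subset_mono) auto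
  finally show "p \<le> bdry \<Omega> e" by (simp add: bdry_def)
  have "?S \<noteq> {}" using sub t(1) by auto
  then show "bdry \<Omega> e \<le> q" unfolding bdry_def using q by (intro cSup_least) auto
qed

text \<open>The centroid of \<open>\<Omega>\<close> is displaced by some \<open>a\<close>, made
  small by \<open>norm_centroid_between_le\<close>; the displacement is then absorbed by shrinking
  with a factor \<open>\<sigma>\<close>, and the rays from the new centroid are compared. Positivity
  of \<open>bdry \<Omega>\<close> is recorded because it makes \<open>deform \<Omega>\<close>
  injective without \<open>\<Omega>\<close> being known to be a star domain.\<close>

lemma star_domain_stability:
  fixes L m M \<epsilon> :: real
  assumes L: "0 \<le> L" and m: "0 < m" and M: "0 < M" and \<epsilon>: "0 < \<epsilon>"
  obtains \<tau> where "\<tau> > 1"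
    "\<And>\<Omega>0 \<Omega> :: 'a::euclidean_space set.
      \<lbrakk>star_domain \<Omega>0; L-lipschitz_on (sphere 0 1) (bdry \<Omega>0);
       \<And>e. e \<in> sphere 0 1 \<Longrightarrow> m \<le> bdry \<Omega>0 e; \<And>e. e \<in> sphere 0 1 \<Longrightarrow> bdry \<Omega>0 e \<le> M; open \<Omega>;
       \<And>x. centroid \<Omega>0 + x \<in> \<Omega>0 \<Longrightarrow> centroid \<Omega>0 + x /\<^sub>R \<tau> \<in> \<Omega>;
       \<And>x. centroid \<Omega>0 + x \<in> \<Omega> \<Longrightarrow> centroid \<Omega>0 + x /\<^sub>R \<tau> \<in> \<Omega>0\<rbrakk>
      \<Longrightarrow> dU \<Omega>0 \<Omega> \<le> \<epsilon> \<and> (\<forall>e\<in>sphere 0 1. 0 < bdry \<Omega> e)"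
proof -
  \<comment> \<open>\<open>\<rho>\<close> is the total factor allowed on boundary functions:
    \<open>(\<rho> - 1) * M = \<epsilon> / 2\<close>, the other half of \<open>\<epsilon>\<close>
    being for the centroids. One factor \<open>sqrt \<rho>\<close> is reserved for
    \<open>\<tau>\<close>, the other for \<open>1 / \<sigma>\<close>, so that
    \<open>\<tau> / \<sigma> \<le> \<rho>\<close>.\<close>
  define \<rho> where "\<rho> = 1 + \<epsilon> / (2 * M)"
  define \<sigma> where "\<sigma> = 1 / sqrt \<rho>"
  have \<rho>: "\<rho> > 1" and \<rho>M: "(\<rho> - 1) * M = \<epsilon> / 2" using M \<epsilon> by (auto simp: \<rho>_def)
  have sq: "sqrt \<rho> > 1" "sqrt \<rho> * sqrt \<rho> = \<rho>" using \<rho> by auto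
  have \<sigma>: "0 < \<sigma>" "\<sigma> < 1" using sq by (auto simp: \<sigma>_def)
  obtain \<delta> where \<delta>: "\<delta> > 0" and absorb:
    "\<And>(b :: 'a \<Rightarrow> real) s w y.
      \<lbrakk>L-lipschitz_on (sphere 0 1) b; \<And>e. e \<in> sphere 0 1 \<Longrightarrow> m \<le> b e; 0 \<le> s; s \<le> \<sigma>;
       w \<in> star_region b; norm (y - s *\<^sub>R w) \<le> \<delta>\<rbrakk> \<Longrightarrow> y \<in> star_region b"
    using star_region_absorb[OF L m \<sigma>(2)] by metis
  \<comment> \<open>The centroid bound of \<open>norm_centroid_between_le\<close> with one more
    factor \<open>\<tau>\<close>, since the inner inclusion is applied to a point enlarged by
    \<open>\<tau>\<close>, which enlarges the displacement too. \<open>D\<close> is continuous with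
    \<open>D 1 = 0\<close>.\<close>
  define D where "D \<tau> = \<tau> * (M * \<tau> * (\<tau> ^ (2 * DIM('a)) - 1))" for \<tau> :: real
  have "isCont D 1" unfolding D_def by (intro continuous_intros)
  then have "(D \<longlongrightarrow> D 1) (at_right 1)"
    by (simp add: isCont_def filterlim_at_split)
  moreover have "D 1 = 0" by (simp add: D_def)
  ultimately have "\<forall>\<^sub>F \<tau> in at_right 1. D \<tau> < min \<delta> (\<epsilon> / 2)"
    using \<delta> \<epsilon> by (intro order_tendstoD(2)) auto
  moreover have "\<forall>\<^sub>F \<tau> in at_right 1. \<tau> < sqrt \<rho>" using order_tendstoD(2)[OF tendsto_ident_at sq(1)] .
  moreover have "\<forall>\<^sub>F \<tau> in at_right 1. (1::real) < \<tau>" by (rule eventually_at_right_less)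
  ultimately have "\<forall>\<^sub>F \<tau> in at_right 1. D \<tau> < min \<delta> (\<epsilon> / 2) \<and> \<tau> < sqrt \<rho> \<and> 1 < \<tau>"
    by eventually_elim auto
  then obtain \<tau> where \<tau>: "D \<tau> < \<delta>" "D \<tau> < \<epsilon> / 2" "\<tau> < sqrt \<rho>" "1 < \<tau>"
    using eventually_happens'[OF trivial_limit_at_right_real] by fastforce
  have \<tau>\<sigma>: "\<tau> / \<sigma> \<le> \<rho>" "\<tau> / \<sigma> > 0"
  proof -
    have "\<tau> / \<sigma> = \<tau> * sqrt \<rho>" by (simp add: \<sigma>_def)
    also have "\<dots> \<le> sqrt \<rho> * sqrt \<rho>" using \<tau> sq(1) by (intro mult_right_mono) auto
    finally show "\<tau> / \<sigma> \<le> \<rho>" using sq by simp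
    show "\<tau> / \<sigma> > 0" using \<tau> \<sigma> by simp
  qed
  have key: "dU \<Omega>0 \<Omega> \<le> \<epsilon> \<and> (\<forall>e\<in>sphere 0 1. 0 < bdry \<Omega> e)"
    if st: "star_domain \<Omega>0" and lip: "L-lipschitz_on (sphere 0 1) (bdry \<Omega>0)"
      and ml: "\<And>e. e \<in> sphere 0 1 \<Longrightarrow> m \<le> bdry \<Omega>0 e"
      and Mu: "\<And>e. e \<in> sphere 0 1 \<Longrightarrow> bdry \<Omega>0 e \<le> M" and op: "open \<Omega>"
      and inn: "\<And>x. centroid \<Omega>0 + x \<in> \<Omega>0 \<Longrightarrow> centroid \<Omega>0 + x /\<^sub>R \<tau> \<in> \<Omega>"
      and out: "\<And>x. centroid \<Omega>0 + x \<in> \<Omega> \<Longrightarrow> centroid \<Omega>0 + x /\<^sub>R \<tau> \<in> \<Omega>0"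
    for \<Omega>0 \<Omega> :: "'a set"
  proof -
    define c where "c = centroid \<Omega>0"
    define b where "b = bdry \<Omega>0"
    define A where "A = star_region b"
    define A' where "A' = {x. c + x \<in> \<Omega>}"
    have iff: "c + x \<in> \<Omega>0 \<longleftrightarrow> x \<in> A" for x
      using in_star_domain_iff[OF st] by (simp add: c_def A_def b_def)
    have vim: "A = (\<lambda>x. c + x) -` \<Omega>0" "A' = (\<lambda>x. c + x) -` \<Omega>" using iff by (auto simp: A'_def)
    then have tr: "\<Omega>0 = (+) c ` A" "\<Omega> = (+) c ` A'"
      using surj_plus[of c] by (simp_all add: surj_image_vimage_eq)
    have opA: "open A" "open A'"
      using star_domain_open[OF st] op unfolding vim by (auto intro!: open_vimage continuous_intros)
    then have bor: "A \<in> sets borel" "A' \<in> sets borel" by auto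
    have lipb: "L-lipschitz_on (sphere 0 1) b" and mb: "\<And>e. e \<in> sphere 0 1 \<Longrightarrow> m \<le> b e"
      and bM: "\<And>e. e \<in> sphere 0 1 \<Longrightarrow> b e \<le> M" using lip ml Mu by (auto simp: b_def)
    have star: "s *\<^sub>R x \<in> A" if "x \<in> A" "0 \<le> s" "s \<le> 1" for x s
      using scaleR_in_star_region that by (auto simp: A_def)
    have AM: "norm x \<le> M" if "x \<in> A" for x
    proof (cases "x = 0")
      case False
      then have "norm x < b (x /\<^sub>R norm x)" using that by (simp add: A_def star_region_iff)
      then show ?thesis using bM[OF sphere_normalize[OF False]] by linarith
    qed (use M in auto)
    have inA: "x /\<^sub>R \<tau> \<in> A'" if "x \<in> A" for x
      using inn[of x] that iff[of x] by (simp add: A'_def c_def)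
    have outA: "x /\<^sub>R \<tau> \<in> A" if "x \<in> A'" for x
      using out[of x] that iff[of "x /\<^sub>R \<tau>"] by (simp add: A'_def c_def)
    have "bounded A" using AM by (auto simp: bounded_iff)
    have posA: "0 < measure lborel A"
    proof -
      have "A \<noteq> {}" using zero_in_star_region[of b] unfolding A_def by blast
      then have "\<not> negligible A" using open_not_negligible opA(1) by blast
      then have "emeasure lborel A \<noteq> 0"
        using bor(1) by (auto simp: negligible_iff_null_sets null_sets_def)
      then show ?thesis
        using emeasure_bounded_finite[OF \<open>bounded A\<close>] by (simp add: measure_def enn2real_positive_iff less_top zero_less_iff_neq_zero)
    qed
    have "centroid \<Omega>0 = c + centroid A"
      unfolding tr(1) by (rule centroid_translation[OF bor(1) \<open>bounded A\<close> posA])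
    then have cA: "centroid A = 0" by (simp add: c_def)
    define a where "a = centroid A'"
    have star\<tau>: "x /\<^sub>R \<tau> \<in> A" if "x \<in> A" for x
      using star[OF that, of "inverse \<tau>"] \<tau> by (simp add: inverse_le_1_iff)
    note nc = norm_centroid_between_le[OF bor AM posA cA less_imp_le[OF \<tau>(4)] star\<tau> inA outA]
    have "norm a \<le> M * \<tau> * (\<tau> ^ (2 * DIM('a)) - 1)" using nc(2) by (simp add: a_def)
    then have "\<tau> * norm a \<le> D \<tau>" using \<tau> by (simp add: D_def)
    moreover have "norm a \<le> \<tau> * norm a" using \<tau> by (simp add: mult_le_cancel_right1)
    ultimately have na: "\<tau> * norm a \<le> \<delta>" "norm a \<le> \<delta>" "norm a \<le> \<epsilon> / 2" using \<tau> by linarith+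
    have "bounded A'"
    proof -
      have "norm x \<le> \<tau> * M" if "x \<in> A'" for x
        using AM[OF outA[OF that]] \<tau> by (simp add: field_simps)
      then show ?thesis by (auto simp: bounded_iff)
    qed
    then have cO: "centroid \<Omega> = c + a"
      unfolding tr(2) a_def by (rule centroid_translation[OF bor(2) _ nc(1)])
    have ab: "y \<in> A" if "w \<in> A" "norm (y - \<sigma> *\<^sub>R w) \<le> \<delta>" for w y
      using absorb[OF lipb mb, of \<sigma> w y] \<sigma> that by (simp add: A_def)
    have bd: "b e / \<rho> \<le> bdry \<Omega> e \<and> bdry \<Omega> e \<le> \<rho> * b e" if e: "e \<in> sphere 0 1" for e
    proof -
      have be: "b e > 0" using mb[OF e] m by simp
      have e1: "norm e = 1" "e \<noteq> 0" using e by auto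
      have mem: "t *\<^sub>R e \<in> A \<longleftrightarrow> t < b e" if "0 \<le> t" for t
        using that e1 be by (cases "t = 0") (auto simp: A_def star_region_iff)
      have low: "centroid \<Omega> + t *\<^sub>R e \<in> \<Omega>" if t: "0 \<le> t" "t < b e / \<rho>" for t
      proof -
        have "t * (\<tau> / \<sigma>) \<le> t * \<rho>" using t \<tau>\<sigma> by (intro mult_left_mono) auto
        also have "\<dots> < b e" using t \<rho> by (simp add: field_simps)
        finally have "t * (\<tau> / \<sigma>) < b e" .
        moreover have "0 \<le> t * (\<tau> / \<sigma>)" using t \<tau>\<sigma> by (intro mult_nonneg_nonneg) auto
        ultimately have w: "(t * (\<tau> / \<sigma>)) *\<^sub>R e \<in> A" using mem by blast
        \<comment> \<open>To find \<open>a + t *\<^sub>R e\<close> in \<open>A'\<close>, its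
          multiple by \<open>\<tau>\<close> has to lie in \<open>A\<close>; the point of
          \<open>A\<close> on the ray through \<open>e\<close> is chosen so that, shrunk by
          \<open>\<sigma>\<close>, it misses this multiple only by
          \<open>\<tau> *\<^sub>R a\<close>.\<close>
        have "\<tau> *\<^sub>R (a + t *\<^sub>R e) - \<sigma> *\<^sub>R ((t * (\<tau> / \<sigma>)) *\<^sub>R e) = \<tau> *\<^sub>R a"
          using \<sigma> by (simp add: algebra_simps)
        then have "norm (\<tau> *\<^sub>R (a + t *\<^sub>R e) - \<sigma> *\<^sub>R ((t * (\<tau> / \<sigma>)) *\<^sub>R e)) \<le> \<delta>"
          using na \<tau> by simp
        from inA[OF ab[OF w this]] have "a + t *\<^sub>R e \<in> A'" using \<tau> by simp
        then show ?thesis by (simp add: A'_def cO add.assoc)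
      qed
      have up: "t \<le> \<rho> * b e" if t: "0 \<le> t" "centroid \<Omega> + t *\<^sub>R e \<in> \<Omega>" for t
      proof -
        have "a + t *\<^sub>R e \<in> A'" using t by (simp add: A'_def cO add.assoc)
        then have w: "(a + t *\<^sub>R e) /\<^sub>R \<tau> \<in> A" by (rule outA)
        \<comment> \<open>Conversely, the known point of \<open>A\<close> is shrunk by
          \<open>\<sigma>\<close> and moved by a multiple of \<open>a\<close> back onto the ray from
          the old centroid, where membership in \<open>A\<close> reads off a bound on
          \<open>t\<close>.\<close>
        have "(\<sigma> * t / \<tau>) *\<^sub>R e - \<sigma> *\<^sub>R ((a + t *\<^sub>R e) /\<^sub>R \<tau>) = - ((\<sigma> / \<tau>) *\<^sub>R a)"
          by (simp add: algebra_simps divide_inverse)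
        moreover have "norm ((\<sigma> / \<tau>) *\<^sub>R a) \<le> 1 * norm a"
          unfolding norm_scaleR using \<sigma> \<tau> by (intro mult_right_mono) auto
        ultimately have "norm ((\<sigma> * t / \<tau>) *\<^sub>R e - \<sigma> *\<^sub>R ((a + t *\<^sub>R e) /\<^sub>R \<tau>)) \<le> \<delta>"
          using na by (simp only: norm_minus_cancel)
        from ab[OF w this] have "\<sigma> * t / \<tau> < b e"
          using mem[of "\<sigma> * t / \<tau>"] t \<sigma> \<tau> by simp
        then have "t < (\<tau> / \<sigma>) * b e" using \<sigma> \<tau> by (simp add: field_simps)
        also have "\<dots> \<le> \<rho> * b e" using \<tau>\<sigma> be by (intro mult_right_mono) auto
        finally show ?thesis by simp
      qed
      show ?thesis using bdry_between[of "b e / \<rho>" \<Omega> e "\<rho> * b e"] low up be \<rho> by auto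
    qed
    have diff: "\<bar>b e - bdry \<Omega> e\<bar> \<le> \<epsilon> / 2" if e: "e \<in> sphere 0 1" for e
    proof -
      have be: "b e > 0" using mb[OF e] m by simp
      have le: "(\<rho> - 1) * b e \<le> \<epsilon> / 2" using \<rho>M \<rho> bM[OF e] by (metis less_imp_le diff_gt_0_iff_gt mult_left_mono)
      \<comment> \<open>That is, \<open>1 / \<rho>\<close> is at least
        \<open>1 - (\<rho> - 1)\<close>, so the lower bound \<open>b e / \<rho>\<close> loses no
        more than the upper bound gains.\<close>
      have "(2 - \<rho>) * \<rho> \<le> 1" using zero_le_power2[of "\<rho> - 1"] by (simp add: power2_eq_square algebra_simps)
      then have "(2 - \<rho>) * \<rho> * b e \<le> b e" using be by simp
      then have "(2 - \<rho>) * b e \<le> b e / \<rho>" using \<rho> by (simp add: field_simps)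
      then show ?thesis
        using bd[OF e] le unfolding abs_le_iff left_diff_distrib by linarith
    qed
    have "dU \<Omega>0 \<Omega> \<le> \<epsilon> / 2 + \<epsilon> / 2"
      unfolding dU_def
    proof (rule add_mono)
      show "dist (centroid \<Omega>0) (centroid \<Omega>) \<le> \<epsilon> / 2" using na cO by (simp add: c_def dist_norm)
      show "(SUP e\<in>sphere 0 1. \<bar>bdry \<Omega>0 e - bdry \<Omega> e\<bar>) \<le> \<epsilon> / 2"
        using diff sphere_nonempty by (intro cSUP_least) (auto simp: b_def)
    qed
    moreover have "0 < bdry \<Omega> e" if e: "e \<in> sphere 0 1" for e
    proof -
      have "0 < b e / \<rho>" using mb[OF e] m \<rho> by simp
      then show ?thesis using bd[OF e] by linarith
    qed
    ultimately show ?thesis by simp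
  qed
  show thesis
    by (rule that[of \<tau>]) (use \<tau>(4) key in \<open>auto\<close>)
qed

text \<open>Polytopes are compared by scaling about their apexes, \<open>c0\<close> and
  \<open>c\<close>, whereas \<open>star_domain_stability\<close> scales about the centroid of
  \<open>\<Omega>0\<close>. Changing the centre adds an error of at most
  \<open>(s - 1) * R + s * dist c c0\<close>, where \<open>R\<close> is the distance of
  \<open>c0\<close> from the centroid, and \<open>star_region_absorb\<close> takes it up. Needed for
  the decoder, where both apexes differ from the centroid.\<close>

lemma star_domain_recentre:
  fixes \<Omega>0 :: "'a::euclidean_space set"
  assumes st: "star_domain \<Omega>0" and lip: "L-lipschitz_on (sphere 0 1) (bdry \<Omega>0)"
    and m: "0 < m" "\<And>e. e \<in> sphere 0 1 \<Longrightarrow> m \<le> bdry \<Omega>0 e" and \<tau>: "\<tau> > 1"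
  obtains \<eta> s0 where "\<eta> > 0" "s0 > 1"
    "\<And>c s \<Omega> x. \<lbrakk>dist c c0 \<le> \<eta>; 1 \<le> s; s \<le> s0; \<And>x. c0 + x \<in> \<Omega>0 \<Longrightarrow> c + x /\<^sub>R s \<in> \<Omega>;
       centroid \<Omega>0 + x \<in> \<Omega>0\<rbrakk> \<Longrightarrow> centroid \<Omega>0 + x /\<^sub>R \<tau> \<in> \<Omega>"
    "\<And>c s \<Omega> x. \<lbrakk>dist c c0 \<le> \<eta>; 1 \<le> s; s \<le> s0; \<And>x. c + x \<in> \<Omega> \<Longrightarrow> c0 + x /\<^sub>R s \<in> \<Omega>0;
       centroid \<Omega>0 + x \<in> \<Omega>\<rbrakk> \<Longrightarrow> centroid \<Omega>0 + x /\<^sub>R \<tau> \<in> \<Omega>0"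
proof -
  define C where "C = centroid \<Omega>0"
  define R where "R = dist C c0"
  define \<sigma> where "\<sigma> = 1 / sqrt \<tau>"
  have sq: "sqrt \<tau> > 1" "sqrt \<tau> * sqrt \<tau> = \<tau>" "R \<ge> 0" using \<tau> by (auto simp: R_def)
  have \<sigma>: "0 < \<sigma>" "\<sigma> < 1" using sq by (auto simp: \<sigma>_def)
  have L: "0 \<le> L" using lip by (rule lipschitz_on_nonneg)
  obtain \<delta> where \<delta>: "\<delta> > 0" and absorb: "\<And>(b :: 'a \<Rightarrow> real) s w y.
      \<lbrakk>L-lipschitz_on (sphere 0 1) b; \<And>e. e \<in> sphere 0 1 \<Longrightarrow> m \<le> b e; 0 \<le> s; s \<le> \<sigma>;
       w \<in> star_region b; norm (y - s *\<^sub>R w) \<le> \<delta>\<rbrakk> \<Longrightarrow> y \<in> star_region b"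
    using star_region_absorb[OF L m(1) \<sigma>(2)] by metis
  \<comment> \<open>The bounds \<open>s0\<close> and \<open>\<eta>\<close> each limit one summand of
    the error to \<open>\<delta> / 2\<close>, and \<open>s \<le> sqrt \<tau>\<close> gives
    \<open>s / \<tau> \<le> \<sigma>\<close>. \<open>R + 1\<close> avoids dividing by 0 when
    \<open>c0\<close> is the centroid.\<close>
  define s0 where "s0 = min (sqrt \<tau>) (1 + \<delta> / (2 * (R + 1)))"
  define \<eta> where "\<eta> = \<delta> / (2 * sqrt \<tau>)"
  have iff: "C + x \<in> \<Omega>0 \<longleftrightarrow> x \<in> star_region (bdry \<Omega>0)" for x
    using in_star_domain_iff[OF st] by (simp add: C_def)
  have err: "(s - 1) * R + s * dist c c0 \<le> \<delta>" "s / \<tau> \<le> \<sigma>"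
    if c: "dist c c0 \<le> \<eta>" and s: "1 \<le> s" "s \<le> s0" for c s
  proof -
    have s': "s \<le> sqrt \<tau>" "s - 1 \<le> \<delta> / (2 * (R + 1))" using s by (auto simp: s0_def)
    have "(s - 1) * R \<le> \<delta> / (2 * (R + 1)) * (R + 1)"
      using s' sq s \<delta> by (intro mult_mono) auto
    also have "\<dots> = \<delta> / 2" using sq by (simp add: field_simps)
    finally have 1: "(s - 1) * R \<le> \<delta> / 2" .
    have "s * dist c c0 \<le> sqrt \<tau> * \<eta>" using s' c s sq by (intro mult_mono) auto
    also have "\<dots> = \<delta> / 2" using sq by (simp add: \<eta>_def)
    finally show "(s - 1) * R + s * dist c c0 \<le> \<delta>" using 1 by simp
    have "s / \<tau> \<le> sqrt \<tau> / \<tau>" using s' \<tau> by (intro divide_right_mono) auto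
    also have "\<dots> = \<sigma>" using sq(1,2) \<tau> by (simp add: \<sigma>_def field_simps)
    finally show "s / \<tau> \<le> \<sigma>" .
  qed
  have inn: "C + z /\<^sub>R \<tau> \<in> \<Omega>"
    if c: "dist c c0 \<le> \<eta>" and s: "1 \<le> s" "s \<le> s0" and h: "\<And>x. c0 + x \<in> \<Omega>0 \<Longrightarrow> c + x /\<^sub>R s \<in> \<Omega>"
      and z: "C + z \<in> \<Omega>0" for c s \<Omega> z
  proof -
    \<comment> \<open>Solved for backwards: \<open>C + y\<close> is the point that the hypothesis
      \<open>h\<close> sends to the target \<open>C + z /\<^sub>R \<tau>\<close>.\<close>
    define y where "y = (c0 - C) + s *\<^sub>R (C - c) + (s / \<tau>) *\<^sub>R z"
    have "y - (s / \<tau>) *\<^sub>R z = (s - 1) *\<^sub>R (C - c0) - s *\<^sub>R (c - c0)"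
      by (simp add: y_def algebra_simps)
    also have "norm \<dots> \<le> norm ((s - 1) *\<^sub>R (C - c0)) + norm (s *\<^sub>R (c - c0))"
      by (rule norm_triangle_ineq4)
    also have "\<dots> = (s - 1) * R + s * dist c c0" using s by (simp add: R_def dist_norm)
    also have "\<dots> \<le> \<delta>" by (rule err(1)[OF c s])
    finally have "y \<in> star_region (bdry \<Omega>0)"
      using err(2)[OF c s] s \<tau> z iff by (intro absorb[OF lip m(2), of "s / \<tau>" z y]) auto
    then have "c0 + (C - c0 + y) \<in> \<Omega>0" using iff by simp
    from h[OF this] have "c + (C - c0 + y) /\<^sub>R s \<in> \<Omega>" .
    moreover have "c + (C - c0 + y) /\<^sub>R s = C + z /\<^sub>R \<tau>"
      using s \<tau> by (simp add: y_def scaleR_add_right divide_inverse)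
    ultimately show ?thesis by simp
  qed
  have out: "C + x /\<^sub>R \<tau> \<in> \<Omega>0"
    if c: "dist c c0 \<le> \<eta>" and s: "1 \<le> s" "s \<le> s0" and h: "\<And>x. c + x \<in> \<Omega> \<Longrightarrow> c0 + x /\<^sub>R s \<in> \<Omega>0"
      and x: "C + x \<in> \<Omega>" for c s \<Omega> x
  proof -
    \<comment> \<open>The image of \<open>C + x\<close> under the hypothesis \<open>h\<close>, seen
      from \<open>C\<close>. Shrunk by \<open>s / \<tau>\<close> it differs from
      \<open>x /\<^sub>R \<tau>\<close> only through the two changes of centre.\<close>
    define w where "w = c0 - C + (C + x - c) /\<^sub>R s"
    have "c0 + (C + x - c) /\<^sub>R s \<in> \<Omega>0" using x by (intro h) simp
    then have w: "w \<in> star_region (bdry \<Omega>0)" using iff[of w] by (simp add: w_def add.assoc[symmetric])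
    have sw: "s *\<^sub>R w = s *\<^sub>R (c0 - C) + (C + x - c)"
      using s by (simp add: w_def scaleR_add_right)
    have "x /\<^sub>R \<tau> - (s / \<tau>) *\<^sub>R w = (x - s *\<^sub>R w) /\<^sub>R \<tau>"
      by (simp add: scaleR_diff_right divide_inverse)
    also have "x - s *\<^sub>R w = (s - 1) *\<^sub>R (C - c0) + (c - c0)"
      unfolding sw by (simp add: algebra_simps)
    finally have "norm (x /\<^sub>R \<tau> - (s / \<tau>) *\<^sub>R w) = norm ((s - 1) *\<^sub>R (C - c0) + (c - c0)) / \<tau>"
      using \<tau> by (simp add: divide_inverse)
    also have "\<dots> \<le> norm ((s - 1) *\<^sub>R (C - c0) + (c - c0))"
      using \<tau> by (simp add: divide_le_eq mult_le_cancel_left1)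
    also have "\<dots> \<le> norm ((s - 1) *\<^sub>R (C - c0)) + norm (c - c0)"
      by (rule norm_triangle_ineq)
    also have "\<dots> \<le> (s - 1) * R + s * dist c c0"
      using s by (simp add: R_def dist_norm mult_le_cancel_right1)
    also have "\<dots> \<le> \<delta>" by (rule err(1)[OF c s])
    finally have e: "norm (x /\<^sub>R \<tau> - (s / \<tau>) *\<^sub>R w) \<le> \<delta>" .
    have "0 \<le> s / \<tau>" using s \<tau> by simp
    then have "x /\<^sub>R \<tau> \<in> star_region (bdry \<Omega>0)"
      using absorb[OF lip m(2) _ err(2)[OF c s] w e] by blast
    then show ?thesis using iff by simp
  qed
  have "\<delta> / (2 * (R + 1)) > 0" using \<delta> sq(3) by (intro divide_pos_pos) auto
  then have pos: "\<eta> > 0" "s0 > 1" using \<delta> sq(1) by (simp_all add: \<eta>_def s0_def)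
  show thesis
  proof (rule that[OF pos])
    fix c s \<Omega> x
    assume "dist c c0 \<le> \<eta>" "1 \<le> s" "s \<le> s0" "\<And>x. c0 + x \<in> \<Omega>0 \<Longrightarrow> c + x /\<^sub>R s \<in> \<Omega>"
      "centroid \<Omega>0 + x \<in> \<Omega>0"
    then show "centroid \<Omega>0 + x /\<^sub>R \<tau> \<in> \<Omega>" unfolding C_def[symmetric] by (rule inn)
  next
    fix c s \<Omega> x
    assume "dist c c0 \<le> \<eta>" "1 \<le> s" "s \<le> s0" "\<And>x. c + x \<in> \<Omega> \<Longrightarrow> c0 + x /\<^sub>R s \<in> \<Omega>0"
      "centroid \<Omega>0 + x \<in> \<Omega>"
    then show "centroid \<Omega>0 + x /\<^sub>R \<tau> \<in> \<Omega>0" unfolding C_def[symmetric] by (rule out)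
  qed
qed

subsection \<open>Star-shaped polytopes\<close>

text \<open>Coefficients are attached to indices rather than to points, so \<open>f\<close> may take
  a value twice, and vertices can be rescaled individually while their coefficients are
  adjusted.\<close>

lemma convex_hull_indexed_image:
  fixes f :: "'b \<Rightarrow> 'a::real_vector"
  assumes I: "finite I"
  shows "convex hull (f ` I) = {\<Sum>i\<in>I. u i *\<^sub>R f i |u. (\<forall>i\<in>I. 0 \<le> u i) \<and> sum u I = (1::real)}"
    (is "_ = ?R")
proof (intro equalityI hull_minimal subsetI)
  fix x assume "x \<in> f ` I"
  then obtain i where i: "i \<in> I" "x = f i" by blast
  have "(\<Sum>j\<in>I. (if j = i then 1 else 0) *\<^sub>R f j) = (\<Sum>j\<in>I. if j = i then f j else 0)"
    by (intro sum.cong) auto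
  then show "x \<in> ?R"
    using i I by (intro CollectI exI[of _ "\<lambda>j. if j = i then 1 else 0"]) auto
next
  show "convex ?R"
  proof (rule convexI)
    fix x y and a b :: real assume "x \<in> ?R" "y \<in> ?R" and ab: "0 \<le> a" "0 \<le> b" "a + b = 1"
    then obtain u v where u: "x = (\<Sum>i\<in>I. u i *\<^sub>R f i)" "\<forall>i\<in>I. 0 \<le> u i" "sum u I = 1"
      and v: "y = (\<Sum>i\<in>I. v i *\<^sub>R f i)" "\<forall>i\<in>I. 0 \<le> v i" "sum v I = 1" by blast
    show "a *\<^sub>R x + b *\<^sub>R y \<in> ?R"
      using u v ab by (intro CollectI exI[of _ "\<lambda>i. a * u i + b * v i"])
        (auto simp: sum.distrib scaleR_add_left scaleR_sum_right sum_distrib_left[symmetric])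
  qed
next
  fix x assume "x \<in> ?R"
  then obtain u where u: "x = (\<Sum>i\<in>I. u i *\<^sub>R f i)" "\<forall>i\<in>I. 0 \<le> u i" "sum u I = 1" by blast
  show "x \<in> convex hull (f ` I)"
    unfolding u(1) using u by (intro convex_sum[OF I convex_convex_hull]) (auto intro: hull_inc)
qed

text \<open>The apex 0, indexed by \<open>None\<close>, takes the missing weight
  \<open>1 - sum u I\<close> and contributes nothing to the sum.\<close>

lemma convex_hull_insert_0_image:
  fixes f :: "'b \<Rightarrow> 'a::real_vector"
  assumes I: "finite I"
  shows "convex hull (insert 0 (f ` I)) =
    {\<Sum>i\<in>I. u i *\<^sub>R f i |u. (\<forall>i\<in>I. 0 \<le> u i) \<and> sum u I \<le> (1::real)}"
proof -
  let ?g = "case_option 0 f" and ?J = "insert None (Some ` I)"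
  have sum: "(\<Sum>i\<in>?J. h i) = h None + (\<Sum>i\<in>I. h (Some i))" for h :: "'b option \<Rightarrow> 'c::comm_monoid_add"
    using I by (subst sum.insert) (auto simp: sum.reindex)
  have "insert 0 (f ` I) = ?g ` ?J" by force
  then have "convex hull (insert 0 (f ` I)) =
      {\<Sum>i\<in>?J. u i *\<^sub>R ?g i |u. (\<forall>i\<in>?J. 0 \<le> u i) \<and> sum u ?J = (1::real)}"
    using convex_hull_indexed_image[of ?J ?g] I by simp
  also have "\<dots> = {\<Sum>i\<in>I. u i *\<^sub>R f i |u. (\<forall>i\<in>I. 0 \<le> u i) \<and> sum u I \<le> (1::real)}"
  proof (intro equalityI subsetI)
    fix x assume "x \<in> {\<Sum>i\<in>?J. u i *\<^sub>R ?g i |u. (\<forall>i\<in>?J. 0 \<le> u i) \<and> sum u ?J = (1::real)}"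
    then obtain u :: "'b option \<Rightarrow> real" where "x = (\<Sum>i\<in>?J. u i *\<^sub>R ?g i)" "\<forall>i\<in>?J. 0 \<le> u i" "sum u ?J = 1"
      by blast
    then show "x \<in> {\<Sum>i\<in>I. u i *\<^sub>R f i |u. (\<forall>i\<in>I. 0 \<le> u i) \<and> sum u I \<le> (1::real)}"
      unfolding sum by (intro CollectI exI[of _ "u \<circ> Some"]) auto
  next
    fix x assume "x \<in> {\<Sum>i\<in>I. u i *\<^sub>R f i |u. (\<forall>i\<in>I. 0 \<le> u i) \<and> sum u I \<le> (1::real)}"
    then obtain u :: "'b \<Rightarrow> real" where u: "x = (\<Sum>i\<in>I. u i *\<^sub>R f i)" "\<forall>i\<in>I. 0 \<le> u i" "sum u I \<le> 1" by blast
    show "x \<in> {\<Sum>i\<in>?J. u i *\<^sub>R ?g i |u. (\<forall>i\<in>?J. 0 \<le> u i) \<and> sum u ?J = (1::real)}"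
      using u by (intro CollectI exI[of _ "case_option (1 - sum u I) u"]) (auto simp: sum)
  qed
  finally show ?thesis .
qed

lemma subconvex_sum_in_pyramids:
  fixes f :: "'b \<Rightarrow> 'a::real_vector" and u :: "'b \<Rightarrow> real"
  assumes "finite I" "I \<in> T" "\<forall>i\<in>I. 0 \<le> u i" "sum u I \<le> 1"
  shows "(\<Sum>i\<in>I. u i *\<^sub>R f i) \<in> (\<Union>I\<in>T. convex hull (insert 0 (f ` I)))"
proof -
  have "(\<Sum>i\<in>I. u i *\<^sub>R f i) \<in> convex hull (insert 0 (f ` I))"
    using assms unfolding convex_hull_insert_0_image[OF assms(1)] by blast
  then show ?thesis using assms(2) by blast
qed

text \<open>The polytope of \<open>psi1\<close> moved so that its apex is the origin; directions
  \<open>p\<close> and heights \<open>\<beta>\<close> are kept apart because the comparisons change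
  only the heights.\<close>

definition star_polytope ::
    "nat set set \<Rightarrow> (nat \<Rightarrow> 'a::euclidean_space) \<Rightarrow> (nat \<Rightarrow> real) \<Rightarrow> 'a set" where
  "star_polytope T p \<beta> = interior (\<Union>I\<in>T. convex hull (insert 0 ((\<lambda>i. \<beta> i *\<^sub>R p i) ` I)))"

lemma psi1_eq_star_polytope:
  "psi1 e T n v = (+) (\<Sum>k<DIM('a). v k *\<^sub>R basis_enum k) `
     star_polytope (T n) (e n) (\<lambda>i. v (DIM('a) + i))"
  for e :: "nat \<Rightarrow> nat \<Rightarrow> 'a::euclidean_space"
proof -
  define c :: 'a where "c = (\<Sum>k<DIM('a). v k *\<^sub>R basis_enum k)"
  have "insert c ((\<lambda>i. c + v (DIM('a) + i) *\<^sub>R e n i) ` I) =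
      (+) c ` insert 0 ((\<lambda>i. v (DIM('a) + i) *\<^sub>R e n i) ` I)" for I
    by (auto simp: image_image)
  then show ?thesis
    unfolding psi1_def star_polytope_def Let_def c_def[symmetric]
    by (simp only: convex_hull_translation image_UN[symmetric] interior_translation)
qed

text \<open>\<open>star_polytope\<close> is an interior, so inclusions between unions of pyramids
  have to be carried over to interiors; scaling maps open sets to open sets.\<close>

lemma interior_scaleR_subset:
  fixes S S' :: "'a::real_normed_vector set"
  assumes x: "x \<in> interior S" and s: "s \<noteq> 0" and sub: "\<And>x. x \<in> S \<Longrightarrow> x /\<^sub>R s \<in> S'"
  shows "x /\<^sub>R s \<in> interior S'"
proof (rule interiorI)
  show "open ((*\<^sub>R) (inverse s) ` interior S)" using s by (intro open_scaling) auto
  show "x /\<^sub>R s \<in> (*\<^sub>R) (inverse s) ` interior S" using x by blast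
  show "(*\<^sub>R) (inverse s) ` interior S \<subseteq> S'" using sub interior_subset by blast
qed

text \<open>Each pyramid is treated by itself: the coefficient of vertex \<open>i\<close> is
  multiplied by \<open>\<beta> i / (s * \<beta>' i) \<le> 1\<close>, so the total weight stays at
  most 1 and the point remains in the pyramid over the same \<open>I\<close>.\<close>

lemma star_polytope_mono:
  assumes fin: "\<And>I. I \<in> T \<Longrightarrow> finite I" and s: "s > 0"
    and \<beta>: "\<And>I i. I \<in> T \<Longrightarrow> i \<in> I \<Longrightarrow> 0 \<le> \<beta> i" "\<And>I i. I \<in> T \<Longrightarrow> i \<in> I \<Longrightarrow> 0 < \<beta>' i"
      "\<And>I i. I \<in> T \<Longrightarrow> i \<in> I \<Longrightarrow> \<beta> i \<le> s * \<beta>' i"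
    and x: "x \<in> star_polytope T p \<beta>"
  shows "x /\<^sub>R s \<in> star_polytope T p \<beta>'"
  using x unfolding star_polytope_def
proof (rule interior_scaleR_subset)
  fix x assume "x \<in> (\<Union>I\<in>T. convex hull (insert 0 ((\<lambda>i. \<beta> i *\<^sub>R p i) ` I)))"
  then obtain I u where I: "I \<in> T" and u: "\<forall>i\<in>I. 0 \<le> u i" "sum u I \<le> 1"
    "x = (\<Sum>i\<in>I. u i *\<^sub>R \<beta> i *\<^sub>R p i)"
    using fin by (auto simp: convex_hull_insert_0_image)
  define u' where "u' i = u i * (\<beta> i / (s * \<beta>' i))" for i
  have q: "0 \<le> \<beta> i / (s * \<beta>' i)" "\<beta> i / (s * \<beta>' i) \<le> 1" if "i \<in> I" for i
    using \<beta>(1,2,3)[OF I that] s by (auto simp: divide_le_eq)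
  have "sum u' I \<le> sum u I"
    unfolding u'_def by (intro sum_mono mult_left_le) (use u q in blast)+
  moreover have "\<forall>i\<in>I. 0 \<le> u' i" unfolding u'_def using u q by (blast intro: mult_nonneg_nonneg)
  moreover have "x /\<^sub>R s = (\<Sum>i\<in>I. u' i *\<^sub>R \<beta>' i *\<^sub>R p i)"
    unfolding u(3) scaleR_sum_right
  proof (intro sum.cong refl)
    fix i assume "i \<in> I"
    then have "\<beta>' i \<noteq> 0" using \<beta>(2)[OF I] by force
    then show "(u i *\<^sub>R \<beta> i *\<^sub>R p i) /\<^sub>R s = u' i *\<^sub>R \<beta>' i *\<^sub>R p i"
      using s by (simp add: u'_def field_simps)
  qed
  ultimately show "x /\<^sub>R s \<in> (\<Union>I\<in>T. convex hull (insert 0 ((\<lambda>i. \<beta>' i *\<^sub>R p i) ` I)))"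
    using subconvex_sum_in_pyramids[OF fin[OF I] I, of u' "\<lambda>i. \<beta>' i *\<^sub>R p i"] u(2) by simp
qed (use s in auto)

text \<open>Two effects determine the constant. Within one simplex directions differ by at most
  \<open>2 * h\<close>, so values of \<open>b\<close> differ by a factor of at most
  \<open>1 + 2 * L * h / m\<close>. A flat simplex with unit vertices dips below the sphere by at
  most \<open>h\<close>; this costs the factor \<open>1 / (1 - h)\<close> in the inner
  inclusion.\<close>

lemma star_polytope_approx:
  fixes p :: "nat \<Rightarrow> 'a::euclidean_space"
  assumes L: "L-lipschitz_on (sphere 0 1) b" and m: "0 < m" "\<And>e. e \<in> sphere 0 1 \<Longrightarrow> m \<le> b e"
    and fin: "\<And>I. I \<in> T \<Longrightarrow> finite I" and p: "\<And>I i. I \<in> T \<Longrightarrow> i \<in> I \<Longrightarrow> p i \<in> sphere 0 1"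
    and mesh: "\<And>I x y. \<lbrakk>I \<in> T; x \<in> convex hull (p ` I); y \<in> convex hull (p ` I)\<rbrakk> \<Longrightarrow> dist x y \<le> h"
    and h: "0 < h" "h < 1" and \<tau>: "(1 + 2 * L * h / m) / (1 - h) < \<tau>"
  shows star_polytope_approx_outer:
      "\<And>x. x \<in> star_polytope T p (b \<circ> p) \<Longrightarrow> x /\<^sub>R \<tau> \<in> star_region b"
    and star_polytope_approx_inner:
      "\<And>P x. \<lbrakk>bounded P; 0 \<in> interior P; (\<Union>I\<in>T. convex hull (p ` I)) = frontier P;
        open (star_region b); x \<in> star_region b\<rbrakk> \<Longrightarrow> x /\<^sub>R \<tau> \<in> star_polytope T p (b \<circ> p)"
proof -
  define \<kappa> where "\<kappa> = 1 + 2 * L * h / m"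
  have L0: "0 \<le> L" using L by (rule lipschitz_on_nonneg)
  have \<kappa>: "\<kappa> \<ge> 1" using L0 m h by (simp add: \<kappa>_def)
  have "\<kappa> / (1 - h) < \<tau>" using \<tau> by (simp add: \<kappa>_def)
  then have \<tau>': "\<kappa> < \<tau> * (1 - h)" using h by (simp add: pos_divide_less_eq)
  have "0 < \<tau> * (1 - h)" using \<tau>' \<kappa> by linarith
  then have \<tau>0: "\<tau> > 0" using h by (simp add: zero_less_mult_iff)
  have "\<tau> * (1 - h) \<le> \<tau>" using \<tau>0 h by (simp add: mult_left_le)
  then have \<kappa>\<tau>: "\<kappa> < \<tau>" using \<tau>' by simp
  have near: "q \<noteq> 0 \<and> 1 - h \<le> norm q \<and> b (p j) \<le> \<kappa> * b (q /\<^sub>R norm q) \<and> b (q /\<^sub>R norm q) \<le> \<kappa> * b (p j)"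
    if I: "I \<in> T" "j \<in> I" and q: "q \<in> convex hull (p ` I)" for I j q
  proof -
    have pj: "p j \<in> sphere 0 1" using p I by blast
    then have pj1: "norm (p j) = 1" "p j \<noteq> 0" by auto
    have d: "dist (p j) q \<le> h" by (rule mesh[OF I(1) hull_inc[OF imageI[OF I(2)]] q])
    then have "norm (p j) - norm q \<le> h" using norm_triangle_ineq2[of "p j" q] by (simp add: dist_norm)
    then have nq: "1 - h \<le> norm q" using pj1 by simp
    then have q0: "q \<noteq> 0" using h by auto
    define u where "u = q /\<^sub>R norm q"
    have u: "u \<in> sphere 0 1" using q0 by (simp add: u_def)
    have "dist (p j) u \<le> 2 * h" using dist_normalize_le[OF pj1(2) q0] d pj1 by (simp add: u_def)
    then have "L * dist (p j) u \<le> L * (2 * h)" using L0 by (intro mult_left_mono)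
    then have "\<bar>b (p j) - b u\<bar> \<le> 2 * L * h"
      using lipschitz_onD[OF L pj u] by (simp add: dist_real_def mult_ac)
    then have "b (p j) \<le> b u + 2 * L * h" "b u \<le> b (p j) + 2 * L * h" by linarith+
    moreover have "2 * L * h \<le> 2 * L * h / m * b e" if "e \<in> sphere 0 1" for e
    proof -
      have "2 * L * h / m * m \<le> 2 * L * h / m * b e"
        using m(2)[OF that] L0 h m(1) by (intro mult_left_mono) auto
      then show ?thesis using m(1) by simp
    qed
    from this[OF pj] this[OF u] have "2 * L * h \<le> 2 * L * h / m * b (p j)" "2 * L * h \<le> 2 * L * h / m * b u" .
    ultimately have "b (p j) \<le> \<kappa> * b u" "b u \<le> \<kappa> * b (p j)"
      unfolding \<kappa>_def distrib_right by linarith+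
    then show ?thesis using q0 nq by (simp add: u_def)
  qed
  let ?S = "\<Union>I\<in>T. convex hull (insert 0 ((\<lambda>i. (b \<circ> p) i *\<^sub>R p i) ` I))"
  {
    fix y assume "y \<in> star_polytope T p (b \<circ> p)"
    then have "y \<in> ?S" using interior_subset unfolding star_polytope_def by blast
    then obtain I u where I: "I \<in> T" and u: "\<forall>i\<in>I. 0 \<le> u i" "sum u I \<le> 1"
      "y = (\<Sum>i\<in>I. u i *\<^sub>R b (p i) *\<^sub>R p i)"
      using fin by (auto simp: convex_hull_insert_0_image)
    define \<mu> where "\<mu> = (\<Sum>i\<in>I. u i * b (p i))"
    have pos: "0 < b (p i)" if "i \<in> I" for i using m(2)[OF p[OF I that]] m(1) by simp
    have nn: "\<forall>i\<in>I. 0 \<le> u i * b (p i)" using u(1) pos by (blast intro: mult_nonneg_nonneg less_imp_le)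
    show "y /\<^sub>R \<tau> \<in> star_region b"
    proof (cases "y = 0")
      case False
      have "\<mu> \<noteq> 0"
      proof
        assume "\<mu> = 0"
        then have "\<forall>i\<in>I. u i * b (p i) = 0"
          using nn fin[OF I] by (simp add: \<mu>_def sum_nonneg_eq_0_iff)
        then have "y = 0" by (auto simp: u(3) intro!: sum.neutral)
        then show False using False by simp
      qed
      then have \<mu>: "\<mu> > 0" using nn by (simp add: \<mu>_def order_less_le sum_nonneg)
      \<comment> \<open>The point in the direction of \<open>y\<close> that is a convex combination
        of the unit vertices \<open>p i\<close>, so that \<open>near\<close> applies to it.\<close>
      define q where "q = y /\<^sub>R \<mu>"
      have "q = (\<Sum>i\<in>I. (u i * b (p i) / \<mu>) *\<^sub>R p i)"
        by (simp add: q_def u(3) scaleR_sum_right divide_inverse mult_ac)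
      moreover have "(\<Sum>i\<in>I. u i * b (p i) / \<mu>) = 1"
        using \<mu> by (simp add: sum_divide_distrib[symmetric] \<mu>_def)
      ultimately have q: "q \<in> convex hull (p ` I)"
        using nn \<mu> fin[OF I] by (auto simp: convex_hull_indexed_image intro!: exI[of _ "\<lambda>i. u i * b (p i) / \<mu>"])
      have dir: "q /\<^sub>R norm q = y /\<^sub>R norm y" using \<mu> by (simp add: q_def)
      define v where "v = y /\<^sub>R norm y"
      have v: "v \<in> sphere 0 1" using False by (simp add: v_def)
      have "norm y \<le> (\<Sum>i\<in>I. norm (u i *\<^sub>R b (p i) *\<^sub>R p i))" unfolding u(3) by (rule norm_sum)
      also have "\<dots> \<le> (\<Sum>i\<in>I. u i * (\<kappa> * b v))"
      proof (rule sum_mono)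
        fix i assume i: "i \<in> I"
        have "norm (u i *\<^sub>R b (p i) *\<^sub>R p i) = u i * b (p i)"
          using i u pos[OF i] p[OF I i] by simp
        also have "\<dots> \<le> u i * (\<kappa> * b v)"
          using near[OF I i q] i u unfolding dir v_def by (intro mult_left_mono) auto
        finally show "norm (u i *\<^sub>R b (p i) *\<^sub>R p i) \<le> u i * (\<kappa> * b v)" .
      qed
      also have "\<dots> = sum u I * (\<kappa> * b v)" by (simp add: sum_distrib_right)
      also have "\<dots> \<le> 1 * (\<kappa> * b v)" using u m(2)[OF v] m(1) \<kappa> by (intro mult_right_mono) auto
      also have "\<dots> < \<tau> * b v" using m(2)[OF v] m(1) \<kappa>\<tau> by simp
      finally have *: "norm (y /\<^sub>R \<tau>) < b v" using \<tau>0 by (simp add: field_simps)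
      have "(y /\<^sub>R \<tau>) /\<^sub>R norm (y /\<^sub>R \<tau>) = v" using \<tau>0 by (simp add: v_def)
      then show ?thesis using * False \<tau>0 by (subst star_region_iff) (auto simp del: norm_scaleR)
    qed simp
  }
  fix P x assume P: "bounded P" "0 \<in> interior P" "(\<Union>I\<in>T. convex hull (p ` I)) = frontier P"
    and op: "open (star_region b)" and x: "x \<in> star_region b"
  have ray: "\<exists>d>0. \<exists>I\<in>T. d *\<^sub>R l \<in> convex hull (p ` I)" if l: "l \<noteq> 0" for l
  proof -
    obtain d where "0 < d" "0 + d *\<^sub>R l \<in> frontier P" using ray_to_frontier[OF P(1,2) l] by blast
    then have "d > 0" "d *\<^sub>R l \<in> (\<Union>I\<in>T. convex hull (p ` I))" unfolding P(3) by simp_all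
    then show ?thesis by blast
  qed
  \<comment> \<open>As the region is open, it is enough to scale it into the union of pyramids
    before taking interiors.\<close>
  have "x \<in> interior (star_region b)" using x op by (simp add: interior_open)
  then show "x /\<^sub>R \<tau> \<in> star_polytope T p (b \<circ> p)"
    unfolding star_polytope_def
  proof (rule interior_scaleR_subset)
    fix x assume x: "x \<in> star_region b"
    show "x /\<^sub>R \<tau> \<in> ?S"
    proof (cases "x = 0")
      case True
      \<comment> \<open>For the centre any ray will do: it shows that \<open>T\<close> is nonempty,
        and every pyramid contains its apex.\<close>
      obtain l :: 'a where "l \<noteq> 0" using nonzero_Basis nonempty_Basis by blast
      then obtain I where "I \<in> T" using ray by blast
      then show ?thesis using True by (auto intro!: bexI[of _ I] hull_inc)
    next
      case False
      then obtain d I where d: "d > 0" and I: "I \<in> T" "d *\<^sub>R x \<in> convex hull (p ` I)" using ray by blast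
      then obtain u where u: "\<forall>i\<in>I. 0 \<le> u i" "sum u I = 1" "d *\<^sub>R x = (\<Sum>i\<in>I. u i *\<^sub>R p i)"
        using fin[OF I(1)] by (auto simp: convex_hull_indexed_image)
      have "I \<noteq> {}" using u(2) by auto
      then obtain j where j: "j \<in> I" by blast
      define v where "v = x /\<^sub>R norm x"
      have dir: "(d *\<^sub>R x) /\<^sub>R norm (d *\<^sub>R x) = v" using d by (simp add: v_def)
      note nr = near[OF I(1) _ I(2), unfolded dir]
      have v: "v \<in> sphere 0 1" using False by (simp add: v_def)
      have bv: "b v > 0" using m(2)[OF v] m(1) by simp
      have xb: "norm x < b v" using x False by (simp add: star_region_iff v_def)
      have "1 - h \<le> d * norm x" using nr[OF j] d by simp
      also have "\<dots> \<le> d * b v" using d xb by simp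
      finally have dv: "1 - h \<le> d * b v" .
      then have "\<tau> * (1 - h) \<le> \<tau> * (d * b v)" using \<tau>0 by (intro mult_left_mono) auto
      then have "\<kappa> \<le> d * \<tau> * b v" using \<tau>' by (simp only: mult_ac)
      then have k: "\<kappa> / (d * \<tau> * b v) \<le> 1" using \<tau>0 d bv by (simp add: divide_le_eq_1)
      \<comment> \<open>The combination for \<open>d *\<^sub>R x\<close> in the vertices
        \<open>p i\<close>, divided by \<open>d * \<tau>\<close> and rewritten in the raised
        vertices \<open>b (p i) *\<^sub>R p i\<close>.\<close>
      define u' where "u' i = u i / (d * \<tau> * b (p i))" for i
      have pos: "0 < b (p i)" if "i \<in> I" for i using m(2)[OF p[OF I(1) that]] m(1) by simp
      have "sum u' I \<le> (\<Sum>i\<in>I. u i * (\<kappa> / (d * \<tau> * b v)))"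
      proof (rule sum_mono)
        fix i assume i: "i \<in> I"
        have "1 / (d * \<tau> * b (p i)) \<le> \<kappa> / (d * \<tau> * b v)"
          using nr[OF i] pos[OF i] bv d \<tau>0 by (simp add: field_simps)
        then have "u i * (1 / (d * \<tau> * b (p i))) \<le> u i * (\<kappa> / (d * \<tau> * b v))"
          using u i by (intro mult_left_mono) auto
        then show "u' i \<le> u i * (\<kappa> / (d * \<tau> * b v))" by (simp add: u'_def)
      qed
      also have "\<dots> = sum u I * (\<kappa> / (d * \<tau> * b v))" by (rule sum_distrib_right[symmetric])
      also have "\<dots> \<le> 1" using u k by simp
      finally have "sum u' I \<le> 1" .
      moreover have "\<forall>i\<in>I. 0 \<le> u' i" using u pos d \<tau>0 by (auto simp: u'_def intro!: divide_nonneg_pos)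
      moreover have "x /\<^sub>R \<tau> = (\<Sum>i\<in>I. u' i *\<^sub>R (b \<circ> p) i *\<^sub>R p i)"
      proof -
        have "x /\<^sub>R \<tau> = (d *\<^sub>R x) /\<^sub>R (d * \<tau>)" using d by simp
        also have "\<dots> = (\<Sum>i\<in>I. (u i / (d * \<tau>)) *\<^sub>R p i)"
          by (simp add: u(3) scaleR_sum_right divide_inverse mult_ac)
        also have "\<dots> = (\<Sum>i\<in>I. u' i *\<^sub>R (b \<circ> p) i *\<^sub>R p i)"
        proof (intro sum.cong refl)
          fix i assume "i \<in> I"
          then show "(u i / (d * \<tau>)) *\<^sub>R p i = u' i *\<^sub>R (b \<circ> p) i *\<^sub>R p i"
            using pos[of i] by (simp add: u'_def)
        qed
        finally show ?thesis .
      qed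
      ultimately show ?thesis
        using subconvex_sum_in_pyramids[OF fin[OF I(1)] I(1), of u' "\<lambda>i. (b \<circ> p) i *\<^sub>R p i"] by simp
    qed
  qed (use \<tau>0 in auto)
qed

subsection \<open>Cell averages on the unit ball\<close>

abbreviation ball_measure :: "'a::euclidean_space measure" where
  "ball_measure \<equiv> restrict_space lborel (ball 0 1)"

lemma finite_ball_measure: "finite_measure (ball_measure :: 'a::euclidean_space measure)"
proof (rule finite_measureI)
  have "emeasure lborel (ball (0::'a) 1) < \<infinity>" by (rule emeasure_bounded_finite) auto
  then show "emeasure ball_measure (space (ball_measure :: 'a measure)) \<noteq> \<infinity>"
    by (simp add: emeasure_restrict_space space_restrict_space)
qed

lemma space_ball_measure [simp]: "space ball_measure = ball 0 1"
  by (simp add: space_restrict_space)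

lemma L2norm_ball: "L2norm ball_measure f = sqrt (LINT x:ball 0 1|lborel. (f x)\<^sup>2)"
  by (simp add: L2norm_def set_lebesgue_integral_def integral_restrict_space)

lemma set_integral_ball_measure:
  assumes "A \<subseteq> ball 0 1" "\<And>x. x \<in> A \<Longrightarrow> f x = g x"
  shows "(LINT x:A|lborel. f x) = (LINT x|ball_measure. indicator A x * (g x :: real))"
proof -
  have "(LINT x:A|lborel. f x) = (LINT x|lborel. indicator (ball 0 1) x *\<^sub>R (indicator A x * g x))"
    unfolding set_lebesgue_integral_def
    using assms by (intro Bochner_Integration.integral_cong) (auto simp: indicator_def)
  then show ?thesis by (simp add: integral_restrict_space)
qed

lemma continuous_bdd_measurable_ball:
  fixes h :: "'a::euclidean_space \<Rightarrow> real"
  assumes h: "continuous_on UNIV h"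
  shows "h \<in> bdd_measurable ball_measure"
proof -
  have "compact (h ` cball 0 1)"
    using h by (intro compact_continuous_image) (auto intro: continuous_on_subset)
  then obtain B where B: "\<And>x. x \<in> cball 0 1 \<Longrightarrow> \<bar>h x\<bar> \<le> B"
    using compact_imp_bounded bounded_iff by (metis imageI real_norm_def)
  have "h \<in> borel_measurable lborel" using borel_measurable_continuous_onI[OF h] by simp
  then have "h \<in> borel_measurable ball_measure" by (rule measurable_restrict_space1)
  then show ?thesis using B by (auto simp: bdd_measurable_def intro!: exI[of _ B])
qed

text \<open>Extended by 0, \<open>G\<close> is almost everywhere a pointwise limit of continuous
  functions. Truncated at the bound of \<open>G\<close>, they are dominated by a constant, and
  dominated convergence turns the limit into one in mean square.\<close>

lemma continuous_L2_approximation: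
  fixes G :: "'a::euclidean_space \<Rightarrow> real"
  assumes G: "G \<in> bdd_measurable ball_measure" and \<epsilon>: "\<epsilon> > 0"
  obtains h where "continuous_on UNIV h" "L2norm ball_measure (\<lambda>x. G x - h x) < \<epsilon>"
proof -
  interpret finite_measure "ball_measure :: 'a measure" by (rule finite_ball_measure)
  have "\<exists>B. \<forall>x\<in>ball 0 1. \<bar>G x\<bar> \<le> B" using G by (simp add: bdd_measurable_def)
  then obtain B where B: "\<And>x. x \<in> ball 0 1 \<Longrightarrow> \<bar>G x\<bar> \<le> B" by blast
  have "\<bar>G 0\<bar> \<le> B" by (rule B) simp
  then have B0: "0 \<le> B" by linarith
  define G' where "G' x = indicator (ball 0 1) x *\<^sub>R G x" for x
  have "G' \<in> borel_measurable lborel"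
    using G unfolding G'_def bdd_measurable_def
    by (subst borel_measurable_restrict_space_iff[symmetric]) auto
  then have "G' \<in> borel_measurable lebesgue" by (rule measurable_completion)
  then have "G' measurable_on UNIV" by (rule lebesgue_measurable_imp_measurable_on) simp
  then obtain N g where N: "negligible N" and g: "\<And>n. continuous_on UNIV (g n)"
    and lim: "\<And>x. x \<notin> N \<Longrightarrow> (\<lambda>n. g n x) \<longlonglongrightarrow> G' x"
    by (auto simp: measurable_on_def)
  \<comment> \<open>Truncation keeps the limit, since \<open>G\<close> itself takes values between
    \<open>- B\<close> and \<open>B\<close> on the ball.\<close>
  define h where "h n x = max (- B) (min B (g n x))" for n :: nat and x
  have hc: "continuous_on UNIV (h n)" for n
    unfolding h_def by (intro continuous_intros g)
  have hB: "\<bar>h n x\<bar> \<le> B" for n x using B0 by (auto simp: h_def)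
  note hm = continuous_bdd_measurable_ball[OF hc]
  have "AE x in lebesgue. x \<notin> N" using N by (intro AE_not_in) (simp add: negligible_iff_null_sets)
  then have "AE x in lborel. x \<notin> N" by (simp add: AE_completion_iff)
  then have ae: "AE x in ball_measure. x \<notin> N" by (auto simp: AE_restrict_space_iff elim: eventually_mono)
  have "(\<lambda>n. LINT x|ball_measure. (G x - h n x)\<^sup>2) \<longlonglongrightarrow> (LINT x|(ball_measure :: 'a measure). 0)"
  proof (rule integral_dominated_convergence)
    show "integrable (ball_measure :: 'a measure) (\<lambda>x. (2 * B)\<^sup>2)" by simp
    show "(\<lambda>x. (G x - h n x)\<^sup>2) \<in> borel_measurable ball_measure" for n
      using G hm[of n] by (auto simp: bdd_measurable_def)
    show "AE x in ball_measure. (\<lambda>n. (G x - h n x)\<^sup>2) \<longlonglongrightarrow> 0"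
      using ae AE_space
    proof eventually_elim
      case (elim x)
      then have x: "x \<in> ball 0 1" "G' x = G x" by (auto simp: G'_def)
      have "(\<lambda>n. h n x) \<longlonglongrightarrow> max (- B) (min B (G x))"
        unfolding h_def using lim[of x] elim x(2) by (intro tendsto_intros) auto
      also have "max (- B) (min B (G x)) = G x" using B[OF x(1)] by auto
      finally have "(\<lambda>n. (G x - h n x)\<^sup>2) \<longlonglongrightarrow> (G x - G x)\<^sup>2" by (intro tendsto_intros)
      then show ?case by simp
    qed
    show "AE x in ball_measure. norm ((G x - h n x)\<^sup>2) \<le> (2 * B)\<^sup>2" for n
      using AE_space
    proof eventually_elim
      case (elim x)
      then have "\<bar>G x - h n x\<bar> \<le> 2 * B" using B[of x] hB[of n x] by auto
      then show ?case using power_mono[of "\<bar>G x - h n x\<bar>" "2 * B" 2] by simp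
    qed
  qed auto
  then have "(\<lambda>n. L2norm ball_measure (\<lambda>x. G x - h n x)) \<longlonglongrightarrow> sqrt 0"
    unfolding L2norm_def by (intro tendsto_real_sqrt) simp
  then have "\<forall>\<^sub>F n in sequentially. L2norm ball_measure (\<lambda>x. G x - h n x) < \<epsilon>"
    using \<epsilon> by (intro order_tendstoD(2)) auto
  then obtain n where "L2norm ball_measure (\<lambda>x. G x - h n x) < \<epsilon>"
    by (auto simp: eventually_sequentially)
  then show ?thesis using that hc by blast
qed

section \<open>Step functions and averages over cells\<close>

definition cell_step :: "nat \<Rightarrow> (nat \<Rightarrow> 'b set) \<Rightarrow> (nat \<Rightarrow> real) \<Rightarrow> 'b \<Rightarrow> real" where
  "cell_step n D c x = (\<Sum>i<n. c i * indicator (D i) x)"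

definition cell_average :: "'b measure \<Rightarrow> (nat \<Rightarrow> 'b set) \<Rightarrow> ('b \<Rightarrow> real) \<Rightarrow> nat \<Rightarrow> real" where
  "cell_average M D G i = (LINT x|M. indicator (D i) x * G x) / measure M (D i)"

lemma cell_step_eq:
  assumes "disjoint_family_on D {..<n}" "i < n" "x \<in> D i"
  shows "cell_step n D c x = c i"
proof -
  have "x \<notin> D j" if "j < n" "j \<noteq> i" for j
    using disjoint_family_onD[OF assms(1), of i j] assms that by auto
  then have "cell_step n D c x = (\<Sum>j<n. if j = i then c i else 0)"
    unfolding cell_step_def using assms by (intro sum.cong) (auto simp: indicator_def)
  then show ?thesis using assms by simp
qed

lemma indicator_bdd_measurable: "A \<in> sets M \<Longrightarrow> indicator A \<in> bdd_measurable M"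
  unfolding bdd_measurable_def by (auto intro!: exI[of _ 1] simp: indicator_def)

lemma cell_step_bdd_measurable:
  assumes "\<And>i. i < n \<Longrightarrow> D i \<in> sets M"
  shows "cell_step n D c \<in> bdd_measurable M"
proof -
  have "cell_step n D c \<in> borel_measurable M"
    unfolding cell_step_def[abs_def] using assms by (intro borel_measurable_sum borel_measurable_times) auto
  moreover have "\<bar>cell_step n D c x\<bar> \<le> (\<Sum>i<n. \<bar>c i\<bar>)" for x
    unfolding cell_step_def by (rule order_trans[OF sum_abs]) (intro sum_mono, simp add: abs_mult indicator_def)
  ultimately show ?thesis by (auto simp: bdd_measurable_def)
qed

text \<open>The squared error is a sum over cells, and on each cell it is a quadratic polynomial in
  the value \<open>d\<close>; completing the square puts its minimum at the mean
  \<open>J / w\<close>.\<close>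

lemma (in finite_measure) L2norm_cell_average_le:
  assumes D: "\<And>i. i < n \<Longrightarrow> D i \<in> sets M" "disjoint_family_on D {..<n}" "(\<Union>i<n. D i) = space M"
    and G: "G \<in> bdd_measurable M"
  shows "L2norm M (\<lambda>x. G x - cell_step n D (cell_average M D G) x) \<le> L2norm M (\<lambda>x. G x - cell_step n D c x)"
proof -
  let ?I = "\<lambda>i c. LINT x|M. indicator (D i) x * (G x - c)\<^sup>2"
  have ind: "indicator (D i) \<in> bdd_measurable M" if "i < n" for i
    using D(1)[OF that] by (rule indicator_bdd_measurable)
  have const: "(\<lambda>_. c) \<in> bdd_measurable M" for c :: real by (auto simp: bdd_measurable_def)
  have Gc: "(\<lambda>x. (G x - c)\<^sup>2) \<in> bdd_measurable M" for c
    unfolding power2_eq_square by (intro bdd_measurable_mult bdd_measurable_diff G const)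
  have split: "(LINT x|M. (G x - cell_step n D c x)\<^sup>2) = (\<Sum>i<n. ?I i (c i))" for c
  proof -
    have "(LINT x|M. (G x - cell_step n D c x)\<^sup>2) = (LINT x|M. (\<Sum>i<n. indicator (D i) x * (G x - c i)\<^sup>2))"
    proof (intro Bochner_Integration.integral_cong refl)
      fix x assume "x \<in> space M"
      then obtain i where i: "i < n" "x \<in> D i" using D(3) by blast
      have "x \<notin> D j" if "j < n" "j \<noteq> i" for j
        using disjoint_family_onD[OF D(2), of i j] i that by auto
      then have "(\<Sum>j<n. indicator (D j) x * (G x - c j)\<^sup>2) = (\<Sum>j<n. if j = i then (G x - c i)\<^sup>2 else 0)"
        using i by (intro sum.cong) (auto simp: indicator_def)
      then show "(G x - cell_step n D c x)\<^sup>2 = (\<Sum>i<n. indicator (D i) x * (G x - c i)\<^sup>2)"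
        using i cell_step_eq[OF D(2) i] by simp
    qed
    also have "\<dots> = (\<Sum>i<n. ?I i (c i))"
      using ind Gc by (intro Bochner_Integration.integral_sum integrable_bdd_measurable bdd_measurable_mult) auto
    finally show ?thesis .
  qed
  have "?I i (cell_average M D G i) \<le> ?I i d" if i: "i < n" for i d
  proof -
    define w where "w = measure M (D i)"
    define J where "J = (LINT x|M. indicator (D i) x * G x)"
    have iG: "integrable M (\<lambda>x. indicator (D i) x * G x)"
      by (intro integrable_bdd_measurable bdd_measurable_mult ind i G)
    have iG2: "integrable M (\<lambda>x. indicator (D i) x * (G x)\<^sup>2)"
      unfolding power2_eq_square by (intro integrable_bdd_measurable bdd_measurable_mult ind i G)
    have i1: "integrable M (indicator (D i) :: _ \<Rightarrow> real)"
      by (intro integrable_bdd_measurable ind i)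
    have ex: "?I i d = (LINT x|M. indicator (D i) x * (G x)\<^sup>2) - 2 * d * J + d\<^sup>2 * w" for d
    proof -
      have "?I i d = (LINT x|M. indicator (D i) x * (G x)\<^sup>2 - 2 * d * (indicator (D i) x * G x) + d\<^sup>2 * indicator (D i) x)"
        by (intro Bochner_Integration.integral_cong) (auto simp: power2_diff algebra_simps)
      also have "\<dots> = (LINT x|M. indicator (D i) x * (G x)\<^sup>2) - 2 * d * J + d\<^sup>2 * w"
        using iG iG2 i1 D(1)[OF i] by (simp add: J_def w_def)
      finally show ?thesis .
    qed
    have "?I i d - ?I i (J / w) \<ge> 0"
    \<comment> \<open>On a null cell division by zero makes the average 0, but there every value
      gives the same error.\<close>
    proof (cases "w = 0")
      case True
      then have "D i \<in> null_sets M" using D(1)[OF i] by (auto simp: w_def emeasure_eq_measure null_sets_def)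
      then have "AE x in M. indicator (D i) x * G x = 0"
        by (rule AE_not_in[THEN eventually_mono]) simp
      then have "J = 0" unfolding J_def by (rule integral_eq_zero_AE)
      then show ?thesis unfolding ex using True by simp
    next
      case False
      then have "w > 0" by (simp add: w_def zero_less_measure_iff)
      then have "?I i d - ?I i (J / w) = w * (d - J / w)\<^sup>2"
        unfolding ex by (simp add: power2_diff power_divide algebra_simps) (simp add: power2_eq_square)
      then show ?thesis using \<open>w > 0\<close> by simp
    qed
    then show ?thesis by (simp add: cell_average_def J_def w_def)
  qed
  then show ?thesis unfolding L2norm_def split by (intro real_sqrt_le_mono sum_mono) auto
qed

text \<open>The competing step function is sampled from an approximant \<open>h\<close> of
  \<open>G0\<close> and does not depend on \<open>G\<close>. Hence one threshold for
  \<open>n\<close> serves all \<open>G\<close>, and \<open>G\<close> enters only through its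
  distance from \<open>G0\<close>.\<close>

lemma cell_average_converges:
  fixes W :: "nat \<Rightarrow> nat \<Rightarrow> 'a::euclidean_space set"
  assumes borel: "\<And>n i. n \<ge> 1 \<Longrightarrow> i < n \<Longrightarrow> W n i \<in> sets borel"
    and disj: "\<And>n. n \<ge> 1 \<Longrightarrow> disjoint_family_on (W n) {..<n}"
    and cover: "\<And>n. n \<ge> 1 \<Longrightarrow> (\<Union>i<n. W n i) = ball 0 1"
    and mesh: "(\<lambda>n. MAX i\<in>{..<n}. diameter (W n i)) \<longlonglongrightarrow> 0"
    and G0: "G0 \<in> bdd_measurable ball_measure" and \<epsilon>: "\<epsilon> > 0"
  shows "\<forall>\<^sub>F n in sequentially. \<forall>G\<in>bdd_measurable ball_measure.
    L2norm ball_measure (\<lambda>x. G x - cell_step n (W n) (cell_average ball_measure (W n) G) x)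
      \<le> L2norm ball_measure (\<lambda>x. G x - G0 x) + \<epsilon>"
proof -
  interpret finite_measure "ball_measure :: 'a measure" by (rule finite_ball_measure)
  obtain h where h: "continuous_on UNIV h" "L2norm ball_measure (\<lambda>x. G0 x - h x) < \<epsilon> / 2"
    using continuous_L2_approximation[OF G0, of "\<epsilon> / 2"] \<epsilon> by auto
  note hm = continuous_bdd_measurable_ball[OF h(1)]
  define m where "m = sqrt (measure (ball_measure :: 'a measure) (space ball_measure))"
  \<comment> \<open>A uniform error \<open>\<eta>\<close> on the ball has \<open>L2norm\<close> at
    most \<open>\<eta> * m\<close>, which is at most \<open>\<epsilon> / 2\<close>.\<close>
  define \<eta> where "\<eta> = \<epsilon> / (2 * (m + 1))"
  have m: "m \<ge> 0" by (simp add: m_def)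
  have \<eta>: "\<eta> > 0" "\<eta> * m \<le> \<epsilon> / 2" using \<epsilon> m by (auto simp: \<eta>_def field_simps)
  have "uniformly_continuous_on (cball 0 1) h"
    using h(1) by (intro compact_uniformly_continuous) (auto intro: continuous_on_subset)
  then obtain \<delta> where \<delta>: "\<delta> > 0" and
    uc: "\<And>x y. \<lbrakk>x \<in> cball 0 1; y \<in> cball 0 1; dist y x < \<delta>\<rbrakk> \<Longrightarrow> dist (h y) (h x) < \<eta>"
    using \<eta>(1) unfolding uniformly_continuous_on_def by meson
  have bW: "bounded (W n i)" if "n \<ge> 1" "i \<in> {..<n}" for n i
    using cover[OF that(1)] that(2) bounded_subset[OF bounded_ball[of 0 1]] by blast
  have "\<forall>\<^sub>F n in sequentially. \<forall>i\<in>{..<n}. \<forall>x\<in>W n i. \<forall>y\<in>W n i. dist x y \<le> \<delta> / 2"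
    using \<delta> bW by (intro eventually_mesh_le[OF mesh]) auto
  then show ?thesis
    using eventually_ge_at_top[of 1]
  proof eventually_elim
    case (elim n)
    then have n: "n \<ge> 1" by simp
    have sets: "W n i \<in> sets ball_measure" if "i < n" for i
      using borel[OF n that] cover[OF n] that by (auto simp: sets_restrict_space_iff)
    \<comment> \<open>For an empty cell the chosen point is arbitrary; the value there is never
      taken at any point of the ball.\<close>
    define c where "c i = h (SOME x. x \<in> W n i)" for i
    have step: "\<bar>h x - cell_step n (W n) c x\<bar> \<le> \<eta>" if x: "x \<in> ball 0 1" for x
    proof -
      obtain i where i: "i < n" "x \<in> W n i" using cover[OF n] x by blast
      define y where "y = (SOME x. x \<in> W n i)"
      have y: "y \<in> W n i" unfolding y_def using i(2) by (rule someI)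
      then have "y \<in> ball 0 1" using cover[OF n] i by blast
      moreover have "dist x y < \<delta>" using elim(1) i y \<delta> by fastforce
      ultimately have "dist (h x) (h y) < \<eta>" using x by (intro uc) auto
      then show ?thesis using cell_step_eq[OF disj[OF n] i] by (simp add: c_def y_def dist_real_def)
    qed
    note sm = cell_step_bdd_measurable[OF sets, where c = c]
    have "L2norm ball_measure (\<lambda>x. h x - cell_step n (W n) c x) \<le> \<eta> * m"
      unfolding m_def using \<eta> step hm sm by (intro L2norm_le_const bdd_measurable_diff) auto
    then have hs: "L2norm ball_measure (\<lambda>x. h x - cell_step n (W n) c x) \<le> \<epsilon> / 2" using \<eta> by simp
    show ?case
    proof
      fix G :: "'a \<Rightarrow> real" assume G: "G \<in> bdd_measurable ball_measure"
      have "L2norm ball_measure (\<lambda>x. G x - cell_step n (W n) (cell_average ball_measure (W n) G) x)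
          \<le> L2norm ball_measure (\<lambda>x. G x - cell_step n (W n) c x)"
        using sets disj[OF n] cover[OF n] G by (intro L2norm_cell_average_le) auto
      also have "\<dots> \<le> L2norm ball_measure (\<lambda>x. G x - G0 x) + L2norm ball_measure (\<lambda>x. G0 x - cell_step n (W n) c x)"
        by (rule L2norm_diff_triangle[OF G G0 sm])
      also have "L2norm ball_measure (\<lambda>x. G0 x - cell_step n (W n) c x) \<le>
          L2norm ball_measure (\<lambda>x. G0 x - h x) + L2norm ball_measure (\<lambda>x. h x - cell_step n (W n) c x)"
        by (rule L2norm_diff_triangle[OF G0 hm sm])
      finally show "L2norm ball_measure (\<lambda>x. G x - cell_step n (W n) (cell_average ball_measure (W n) G) x)
          \<le> L2norm ball_measure (\<lambda>x. G x - G0 x) + \<epsilon>"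
        using h(2) hs by simp
    qed
  qed
qed

subsection \<open>The metrics on domains and on functions\<close>

lemma bdry_bounds:
  fixes \<Omega> :: "'a::euclidean_space set"
  assumes "star_domain \<Omega>"
  obtains m M where "0 < m" "\<And>e. e \<in> sphere 0 1 \<Longrightarrow> m \<le> bdry \<Omega> e" "\<And>e. e \<in> sphere 0 1 \<Longrightarrow> bdry \<Omega> e \<le> M"
proof -
  have c: "continuous_on (sphere 0 1) (bdry \<Omega>)"
    using bdry_lipschitz[OF assms] lipschitz_on_continuous_on by blast
  have cs: "compact (sphere (0::'a) 1)" by simp
  obtain e0 where e0: "e0 \<in> sphere 0 1" "\<And>e. e \<in> sphere 0 1 \<Longrightarrow> bdry \<Omega> e0 \<le> bdry \<Omega> e"
    using continuous_attains_inf[OF cs sphere_nonempty c] by blast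
  obtain e1 where e1: "\<And>e. e \<in> sphere 0 1 \<Longrightarrow> bdry \<Omega> e \<le> bdry \<Omega> e1"
    using continuous_attains_sup[OF cs sphere_nonempty c] by blast
  show ?thesis using that[OF bdry_pos[OF assms e0(1)] e0(2) e1] by blast
qed

text \<open>For star domains the boundary functions are bounded, so the real supremum in
  \<open>dU\<close> dominates its members. \<open>dU_ge\<close> keeps both summands together, as the
  triangle inequality requires.\<close>

lemma dU_bounds:
  fixes \<Omega>1 \<Omega>2 :: "'a::euclidean_space set"
  assumes "star_domain \<Omega>1" "star_domain \<Omega>2"
  shows dist_centroid_le_dU: "dist (centroid \<Omega>1) (centroid \<Omega>2) \<le> dU \<Omega>1 \<Omega>2"
    and bdry_diff_le_dU: "\<And>e. e \<in> sphere 0 1 \<Longrightarrow> \<bar>bdry \<Omega>1 e - bdry \<Omega>2 e\<bar> \<le> dU \<Omega>1 \<Omega>2"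
    and dU_ge: "\<And>e. e \<in> sphere 0 1 \<Longrightarrow>
      dist (centroid \<Omega>1) (centroid \<Omega>2) + \<bar>bdry \<Omega>1 e - bdry \<Omega>2 e\<bar> \<le> dU \<Omega>1 \<Omega>2"
proof -
  obtain m1 M1 where 1: "0 < m1" "\<And>e. e \<in> sphere 0 1 \<Longrightarrow> m1 \<le> bdry \<Omega>1 e" "\<And>e. e \<in> sphere 0 1 \<Longrightarrow> bdry \<Omega>1 e \<le> M1"
    using bdry_bounds[OF assms(1)] by blast
  obtain m2 M2 where 2: "0 < m2" "\<And>e. e \<in> sphere 0 1 \<Longrightarrow> m2 \<le> bdry \<Omega>2 e" "\<And>e. e \<in> sphere 0 1 \<Longrightarrow> bdry \<Omega>2 e \<le> M2"
    using bdry_bounds[OF assms(2)] by blast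
  have b: "\<bar>bdry \<Omega>1 e - bdry \<Omega>2 e\<bar> \<le> M1 + M2" if "e \<in> sphere 0 1" for e
    using 1(1) 2(1) 1(2,3)[OF that] 2(2,3)[OF that] by linarith
  then have bdd: "bdd_above ((\<lambda>e. \<bar>bdry \<Omega>1 e - bdry \<Omega>2 e\<bar>) ` sphere 0 1)"
    by (intro bdd_aboveI2)
  show ge: "dist (centroid \<Omega>1) (centroid \<Omega>2) + \<bar>bdry \<Omega>1 e - bdry \<Omega>2 e\<bar> \<le> dU \<Omega>1 \<Omega>2" if "e \<in> sphere 0 1" for e
    unfolding dU_def by (intro add_left_mono cSUP_upper that bdd)
  show "\<bar>bdry \<Omega>1 e - bdry \<Omega>2 e\<bar> \<le> dU \<Omega>1 \<Omega>2" if "e \<in> sphere 0 1" for e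
    using ge[OF that] zero_le_dist[of "centroid \<Omega>1" "centroid \<Omega>2"] by linarith
  obtain e :: 'a where "e \<in> sphere 0 1" using sphere_nonempty by blast
  then show "dist (centroid \<Omega>1) (centroid \<Omega>2) \<le> dU \<Omega>1 \<Omega>2"
    using ge[of e] by linarith
qed

lemma dU_triangle:
  fixes \<Omega>1 \<Omega>2 \<Omega>3 :: "'a::euclidean_space set"
  assumes "star_domain \<Omega>1" "star_domain \<Omega>2" "star_domain \<Omega>3"
  shows "dU \<Omega>1 \<Omega>3 \<le> dU \<Omega>1 \<Omega>2 + dU \<Omega>2 \<Omega>3"
proof -
  have "\<bar>bdry \<Omega>1 e - bdry \<Omega>3 e\<bar> \<le> dU \<Omega>1 \<Omega>2 + dU \<Omega>2 \<Omega>3 - dist (centroid \<Omega>1) (centroid \<Omega>3)"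
    if "e \<in> sphere 0 1" for e
    using dU_ge[OF assms(1,2) that] dU_ge[OF assms(2,3) that]
      dist_triangle[of "centroid \<Omega>1" "centroid \<Omega>3" "centroid \<Omega>2"] by linarith
  then have "(SUP e\<in>sphere 0 1. \<bar>bdry \<Omega>1 e - bdry \<Omega>3 e\<bar>) \<le>
      dU \<Omega>1 \<Omega>2 + dU \<Omega>2 \<Omega>3 - dist (centroid \<Omega>1) (centroid \<Omega>3)"
    using sphere_nonempty by (intro cSUP_least) auto
  then show ?thesis unfolding dU_def[of \<Omega>1 \<Omega>3] by linarith
qed

lemma dX_eq:
  "dX (\<Omega>1, f1) (\<Omega>2, f2) = dU \<Omega>1 \<Omega>2 + L2norm ball_measure (\<lambda>x. f1 (deform \<Omega>1 x) - f2 (deform \<Omega>2 x))"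
  by (simp add: dX_def L2norm_ball)

text \<open>\<open>deform \<Omega>\<close> is continuous away from the origin, where the direction
  is undefined, and one exceptional point does not affect Borel measurability.\<close>

lemma pullback_bdd_measurable:
  fixes f :: "'a::euclidean_space \<Rightarrow> real"
  assumes st: "star_domain \<Omega>" and f: "f \<in> bdd_borel \<Omega>"
  shows "(\<lambda>x. f (deform \<Omega> x)) \<in> bdd_measurable ball_measure"
proof -
  have c: "continuous_on (sphere 0 1) (bdry \<Omega>)"
    using bdry_lipschitz[OF st] lipschitz_on_continuous_on by blast
  have im: "deform \<Omega> ` ball 0 1 = \<Omega>"
    using star_domain_deform_bij[OF st] by (rule bij_betw_imp_surj_on)
  have "continuous_on (- {0}) (\<lambda>x::'a. x /\<^sub>R norm x)" by (intro continuous_intros) auto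
  then have "continuous_on (- {0}) (\<lambda>x. bdry \<Omega> (x /\<^sub>R norm x))"
    by (rule continuous_on_compose2[OF c]) (use sphere_normalize in blast)
  then have "continuous_on (- {0}) (deform \<Omega>)"
    unfolding deform_def[abs_def] by (intro continuous_intros)
  then have "deform \<Omega> \<in> borel_measurable lborel"
    using borel_measurable_continuous_countable_exceptions[of "{0}"] by simp
  then have "deform \<Omega> \<in> measurable ball_measure (restrict_space borel \<Omega>)"
    by (rule measurable_restrict_space3) (use im in blast)
  then have "(\<lambda>x. f (deform \<Omega> x)) \<in> borel_measurable ball_measure"
    using f unfolding bdd_borel_def by (auto intro: measurable_compose)
  moreover have "\<exists>B. \<forall>x\<in>\<Omega>. \<bar>f x\<bar> \<le> B"
    using f by (simp add: bdd_borel_def bounded_iff)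
  then have "\<exists>B. \<forall>x\<in>ball 0 1. \<bar>f (deform \<Omega> x)\<bar> \<le> B"
    using im by blast
  ultimately show ?thesis by (simp add: bdd_measurable_def)
qed

lemma star_funsD:
  assumes "(\<Omega>, f) \<in> star_funs L"
  shows "star_domain \<Omega>" "L-lipschitz_on (sphere 0 1) (bdry \<Omega>)" "f \<in> bdd_borel \<Omega>"
    "(\<lambda>x. f (deform \<Omega> x)) \<in> bdd_measurable ball_measure"
  using assms pullback_bdd_measurable by (auto simp: star_funs_def star_domains_def)

lemma dX_triangle:
  fixes F1 F2 F3 :: "'a::euclidean_space set \<times> ('a \<Rightarrow> real)"
  assumes "F1 \<in> star_funs L" "F2 \<in> star_funs L" "F3 \<in> star_funs L"
  shows "dX F1 F3 \<le> dX F1 F2 + dX F2 F3"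
proof -
  obtain \<Omega>1 f1 \<Omega>2 f2 \<Omega>3 f3 where F: "F1 = (\<Omega>1, f1)" "F2 = (\<Omega>2, f2)" "F3 = (\<Omega>3, f3)"
    by (metis surj_pair)
  note d = star_funsD[OF assms(1)[unfolded F]] star_funsD[OF assms(2)[unfolded F]] star_funsD[OF assms(3)[unfolded F]]
  show ?thesis
    unfolding F dX_eq
    using dU_triangle[OF d(1,5,9)] finite_measure.L2norm_diff_triangle[OF finite_ball_measure d(4,8,12)]
    by linarith
qed

lemma dX_refl: "dX F F = 0"
proof -
  obtain \<Omega> f where "F = (\<Omega>, f)" by (metis surj_pair)
  then show ?thesis using sphere_nonempty by (simp add: dX_eq dU_def L2norm_def)
qed

text \<open>Meant for decoded polytopes, to which \<open>star_domain_deform_bij\<close> may not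
  apply. The map preserves rays and scales each by a positive factor.\<close>

lemma deform_inj_on:
  fixes \<Omega> :: "'a::euclidean_space set"
  assumes pos: "\<And>e. e \<in> sphere 0 1 \<Longrightarrow> 0 < bdry \<Omega> e"
  shows "inj_on (deform \<Omega>) (ball 0 1)"
proof (rule inj_onI)
  fix x y assume "deform \<Omega> x = deform \<Omega> y"
  then have eq: "bdry \<Omega> (x /\<^sub>R norm x) *\<^sub>R x = bdry \<Omega> (y /\<^sub>R norm y) *\<^sub>R y" (is "?a *\<^sub>R x = ?b *\<^sub>R y")
    by (simp add: deform_def)
  have a: "0 < ?a" if "x \<noteq> 0" using pos sphere_normalize[OF that] by blast
  have b: "0 < ?b" if "y \<noteq> 0" using pos sphere_normalize[OF that] by blast
  have "x = 0 \<longleftrightarrow> y = 0" using eq a b by (metis order_less_irrefl scaleR_eq_0_iff)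
  show "x = y"
  proof (cases "x = 0 \<or> y = 0")
    case True
    then show ?thesis using \<open>x = 0 \<longleftrightarrow> y = 0\<close> by blast
  next
    case False
    then have ab: "?a > 0" "?b > 0" using a b by auto
    have "x /\<^sub>R norm x = (?a *\<^sub>R x) /\<^sub>R norm (?a *\<^sub>R x)" using ab(1) by simp
    also have "\<dots> = y /\<^sub>R norm y" unfolding eq using ab(2) by simp
    finally have "?a *\<^sub>R x = ?a *\<^sub>R y" using eq by simp
    then show ?thesis using ab by simp
  qed
qed

lemma sigma_inv_deform:
  assumes "sigma_inv (\<Omega>, g) = (\<Omega>', f)" "inj_on (deform \<Omega>) (ball 0 1)"
  shows "\<Omega>' = \<Omega>" "\<And>x. x \<in> ball 0 1 \<Longrightarrow> f (deform \<Omega> x) = g x"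
  using assms by (auto simp: sigma_inv_def)

text \<open>The deformation in \<open>dX\<close> undoes the one in \<open>sigma_inv\<close>, so the
  geometry of \<open>\<Omega>\<close> disappears from the function component.\<close>

lemma dX_sigma_inv:
  fixes \<Omega> :: "'a::euclidean_space set"
  assumes "inj_on (deform \<Omega>) (ball 0 1)"
  shows "dX (\<Omega>0, f0) (sigma_inv (\<Omega>, g)) =
    dU \<Omega>0 \<Omega> + L2norm ball_measure (\<lambda>x. f0 (deform \<Omega>0 x) - g x)"
proof -
  obtain f where f: "sigma_inv (\<Omega>, g) = (\<Omega>, f)"
    by (simp add: sigma_inv_def)
  show ?thesis
    unfolding f dX_eq using sigma_inv_deform(2)[OF f assms]
    by (intro arg_cong2[where f = "(+)"] refl L2norm_cong) simp
qed

lemma psi2_eq_cell_step: "x \<in> ball 0 1 \<Longrightarrow> psi2 W n w x = cell_step n (W n) w x"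
  by (simp add: psi2_def cell_step_def)

subsection \<open>Continuity of the encoder\<close>

lemma continuous_map_pm_Euclidean_space:
  assumes zero: "\<And>x k. x \<in> Z \<Longrightarrow> N \<le> k \<Longrightarrow> f x k = 0"
    and lip: "\<And>k. \<exists>C\<ge>0. \<forall>x\<in>Z. \<forall>y\<in>Z. \<bar>f x k - f y k\<bar> \<le> C * d x y"
  shows "continuous_map (pm_topology Z d) (Euclidean_space N) f"
proof -
  have "continuous_map (pm_topology Z d) euclideanreal (\<lambda>x. f x k)" for k
    unfolding continuous_map_def
  proof (intro conjI allI impI)
    fix U :: "real set" assume "openin euclidean U"
    then have U: "open U" by simp
    obtain C where C0: "C \<ge> 0" and C: "\<And>x y. x \<in> Z \<Longrightarrow> y \<in> Z \<Longrightarrow> \<bar>f x k - f y k\<bar> \<le> C * d x y" using lip by blast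
    show "openin (pm_topology Z d) {x \<in> topspace (pm_topology Z d). f x k \<in> U}"
      unfolding openin_pm_topology
    proof (intro conjI ballI)
      fix x assume "x \<in> {x \<in> topspace (pm_topology Z d). f x k \<in> U}"
      then have x: "x \<in> Z" "f x k \<in> U" by auto
      obtain \<epsilon> where \<epsilon>: "\<epsilon> > 0" "\<And>t. dist t (f x k) < \<epsilon> \<Longrightarrow> t \<in> U"
        using U x(2) unfolding open_dist by blast
      have "f y k \<in> U" if y: "y \<in> Z" "d x y < \<epsilon> / (C + 1)" for y
      proof -
        have "\<bar>f x k - f y k\<bar> < \<epsilon>"
        \<comment> \<open>\<open>d\<close> is an arbitrary real function here, so its sign has to be
          examined; \<open>C + 1\<close> allows for \<open>C = 0\<close>.\<close>
        proof (cases "d x y \<le> 0")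
          case True
          then have "C * d x y \<le> 0" using C0 by (intro mult_nonneg_nonpos)
          then show ?thesis using C[OF x(1) y(1)] \<epsilon>(1) by linarith
        next
          case False
          then have "C * d x y \<le> (C + 1) * d x y" by (intro mult_right_mono) auto
          also have "\<dots> < \<epsilon>" using y(2) C0 by (simp add: field_simps)
          finally show ?thesis using C[OF x(1) y(1)] by linarith
        qed
        then show ?thesis using \<epsilon>(2) by (simp add: dist_real_def abs_minus_commute)
      qed
      moreover have "\<epsilon> / (C + 1) > 0" using \<epsilon> C0 by simp
      ultimately show "\<exists>r>0. \<forall>y\<in>Z. d x y < r \<longrightarrow> y \<in> {x \<in> topspace (pm_topology Z d). f x k \<in> U}"
        by auto
    qed auto
  qed auto
  then show ?thesis
    using zero unfolding Euclidean_space_def continuous_map_in_subtopology continuous_map_componentwise_UNIV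
    by auto
qed


section \<open>The coordinates of the code\<close>

lemma basis_enum_bij: "bij_betw (basis_enum :: nat \<Rightarrow> 'a::euclidean_space) {..<DIM('a)} Basis"
proof -
  have "\<exists>u :: nat \<Rightarrow> 'a. bij_betw u {..<DIM('a)} Basis"
    using ex_bij_betw_nat_finite[of "Basis :: 'a set"] by (simp add: lessThan_atLeast0)
  then show ?thesis unfolding basis_enum_def by (rule someI_ex)
qed

lemma norm_basis_enum: "k < DIM('a) \<Longrightarrow> norm (basis_enum k :: 'a::euclidean_space) = 1"
  using bij_betwE[OF basis_enum_bij] by (auto intro: norm_Basis)

lemma sum_basis_enum: "(\<Sum>k<DIM('a). (x \<bullet> basis_enum k) *\<^sub>R basis_enum k) = (x :: 'a::euclidean_space)"
  using sum.reindex_bij_betw[OF basis_enum_bij, of "\<lambda>b. (x \<bullet> b) *\<^sub>R b"] by (simp add: euclidean_representation)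

text \<open>Cauchy-Schwarz on the cell. The constant depends on the cell, which suffices for
  continuity at a fixed \<open>n\<close>; for a null cell both sides are 0.\<close>

lemma (in finite_measure) cell_average_diff_le:
  assumes D: "D i \<in> sets M" and G: "G \<in> bdd_measurable M" "H \<in> bdd_measurable M"
  shows "\<bar>cell_average M D G i - cell_average M D H i\<bar> \<le>
    sqrt (measure M (space M)) / measure M (D i) * L2norm M (\<lambda>x. G x - H x)"
proof -
  note ind = indicator_bdd_measurable[OF D] and GH = bdd_measurable_diff[OF G]
  have d: "(\<lambda>x. indicator (D i) x * (G x - H x)) \<in> bdd_measurable M"
    by (intro bdd_measurable_mult ind GH)
  have "L2norm M (\<lambda>x. indicator (D i) x * (G x - H x)) \<le> L2norm M (\<lambda>x. G x - H x)"
    unfolding L2norm_def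
    by (intro real_sqrt_le_mono integral_mono integrable_square_bdd_measurable d GH) (auto simp: indicator_def)
  moreover have "\<bar>LINT x|M. indicator (D i) x * (G x - H x)\<bar> \<le>
      sqrt (measure M (space M)) * L2norm M (\<lambda>x. indicator (D i) x * (G x - H x))"
    by (rule abs_integral_le_L2norm[OF d])
  ultimately have *: "\<bar>LINT x|M. indicator (D i) x * (G x - H x)\<bar> \<le>
      sqrt (measure M (space M)) * L2norm M (\<lambda>x. G x - H x)"
    by (meson mult_left_mono order_trans real_sqrt_ge_zero measure_nonneg)
  have "(LINT x|M. indicator (D i) x * (G x - H x)) =
      (LINT x|M. indicator (D i) x * G x - indicator (D i) x * H x)"
    by (simp add: right_diff_distrib)
  also have "\<dots> = (LINT x|M. indicator (D i) x * G x) - (LINT x|M. indicator (D i) x * H x)"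
    by (intro Bochner_Integration.integral_diff integrable_bdd_measurable bdd_measurable_mult ind G)
  finally have "cell_average M D G i - cell_average M D H i =
      (LINT x|M. indicator (D i) x * (G x - H x)) / measure M (D i)"
    by (simp add: cell_average_def diff_divide_distrib)
  then show ?thesis using * by (simp add: abs_divide divide_right_mono)
qed

lemma phi2_eq_cell_average:
  fixes W :: "nat \<Rightarrow> nat \<Rightarrow> 'a::euclidean_space set"
  assumes "i < n" "W n i \<in> sets borel" "W n i \<subseteq> ball 0 1"
  shows "phi2 W n (restrict (f \<circ> deform \<Omega>) (ball 0 1)) i =
    cell_average ball_measure (W n) (\<lambda>x. f (deform \<Omega> x)) i"
proof -
  have "measure lborel (W n i) = measure ball_measure (W n i)"
    using assms by (simp add: measure_restrict_space)
  moreover have "(LINT x:W n i|lborel. restrict (f \<circ> deform \<Omega>) (ball 0 1) x) =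
      (LINT x|ball_measure. indicator (W n i) x * f (deform \<Omega> x))"
    using assms(3) by (intro set_integral_ball_measure) auto
  ultimately show ?thesis
    unfolding phi2_def cell_average_def using assms(1) by (simp only: if_True)
qed

context
  fixes e :: "nat \<Rightarrow> nat \<Rightarrow> 'a::euclidean_space" and W :: "nat \<Rightarrow> nat \<Rightarrow> 'a set" and \<kappa>1 \<kappa>2 :: "nat \<Rightarrow> nat" and n :: nat
  assumes unit: "\<And>i. i < \<kappa>1 n \<Longrightarrow> e (\<kappa>1 n) i \<in> sphere 0 1"
    and cells: "\<And>i. i < \<kappa>2 n \<Longrightarrow> W (\<kappa>2 n) i \<in> sets borel" "\<And>i. i < \<kappa>2 n \<Longrightarrow> W (\<kappa>2 n) i \<subseteq> ball 0 1"
begin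

lemma phi_simps:
  shows phi_centroid: "k < DIM('a) \<Longrightarrow> phi e W \<kappa>1 \<kappa>2 n (\<Omega>, f) k = centroid \<Omega> \<bullet> basis_enum k"
    and phi_bdry: "i < \<kappa>1 n \<Longrightarrow> phi e W \<kappa>1 \<kappa>2 n (\<Omega>, f) (DIM('a) + i) = bdry \<Omega> (e (\<kappa>1 n) i)"
    and phi_average: "i < \<kappa>2 n \<Longrightarrow> phi e W \<kappa>1 \<kappa>2 n (\<Omega>, f) (\<kappa>1 n + DIM('a) + i) =
      cell_average ball_measure (W (\<kappa>2 n)) (\<lambda>x. f (deform \<Omega> x)) i"
    and phi_zero: "\<kappa>2 n \<le> i \<Longrightarrow> phi e W \<kappa>1 \<kappa>2 n (\<Omega>, f) (\<kappa>1 n + DIM('a) + i) = 0"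
  by (simp_all add: phi_def sigma_map_def phi1_def phi2_eq_cell_average cells add.commute) (simp add: phi2_def)

text \<open>Every coordinate is Lipschitz for \<open>dX\<close>: centroid and boundary coordinates
  through \<open>dU\<close> with constant 1, averages through the \<open>L2norm\<close> component
  with a constant of their cell.\<close>

lemma phi_continuous:
  "continuous_map (pm_topology (star_funs L) dX) (Euclidean_space (\<kappa>1 n + DIM('a) + \<kappa>2 n)) (phi e W \<kappa>1 \<kappa>2 n)"
proof (rule continuous_map_pm_Euclidean_space)
  fix F :: "'a set \<times> ('a \<Rightarrow> real)" and k
  assume "\<kappa>1 n + DIM('a) + \<kappa>2 n \<le> k"
  then have "\<kappa>2 n \<le> k - (\<kappa>1 n + DIM('a))" "k = \<kappa>1 n + DIM('a) + (k - (\<kappa>1 n + DIM('a)))" by auto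
  then obtain i where "\<kappa>2 n \<le> i" "k = \<kappa>1 n + DIM('a) + i" by blast
  then show "phi e W \<kappa>1 \<kappa>2 n F k = 0" using phi_zero by (cases F) simp
next
  fix k
  define C where "C = (if k < \<kappa>1 n + DIM('a) then 1 else sqrt (measure (ball_measure :: 'a measure) (space ball_measure)) /
      measure (ball_measure :: 'a measure) (W (\<kappa>2 n) (k - (\<kappa>1 n + DIM('a)))))"
  have "\<bar>phi e W \<kappa>1 \<kappa>2 n F k - phi e W \<kappa>1 \<kappa>2 n F' k\<bar> \<le> C * dX F F'"
    if "F \<in> star_funs L" "F' \<in> star_funs L" for F F'
  proof -
    obtain \<Omega> f \<Omega>' f' where F: "F = (\<Omega>, f)" "F' = (\<Omega>', f')" by (metis surj_pair)
    note d = star_funsD[OF that(1)[unfolded F]] star_funsD[OF that(2)[unfolded F]]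
    have X: "dU \<Omega> \<Omega>' \<le> dX F F'" "L2norm ball_measure (\<lambda>x. f (deform \<Omega> x) - f' (deform \<Omega>' x)) \<le> dX F F'"
      using L2norm_nonneg[of ball_measure "\<lambda>x. f (deform \<Omega> x) - f' (deform \<Omega>' x)"]
        dist_centroid_le_dU[OF d(1,5)] zero_le_dist[of "centroid \<Omega>" "centroid \<Omega>'"]
      unfolding F dX_eq by linarith+
    have "k < DIM('a) \<or> (k = DIM('a) + (k - DIM('a)) \<and> k - DIM('a) < \<kappa>1 n) \<or>
        k = \<kappa>1 n + DIM('a) + (k - (\<kappa>1 n + DIM('a)))" by linarith
    then consider "k < DIM('a)" | i where "i < \<kappa>1 n" "k = DIM('a) + i"
      | i where "i < \<kappa>2 n" "k = \<kappa>1 n + DIM('a) + i" | i where "\<kappa>2 n \<le> i" "k = \<kappa>1 n + DIM('a) + i"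
      using linorder_not_le by blast
    then show ?thesis
    proof cases
      case 1
      have "\<bar>(centroid \<Omega> - centroid \<Omega>') \<bullet> basis_enum k\<bar> \<le> dist (centroid \<Omega>) (centroid \<Omega>')"
        using Cauchy_Schwarz_ineq2[of "centroid \<Omega> - centroid \<Omega>'" "basis_enum k"] norm_basis_enum[OF 1]
        by (simp add: dist_norm)
      then show ?thesis
        using X(1) dist_centroid_le_dU[OF d(1,5)] 1 by (simp add: F phi_centroid C_def inner_diff_left)
    next
      case 2
      then show ?thesis
        using X(1) bdry_diff_le_dU[OF d(1,5) unit[OF 2(1)]] by (simp add: F phi_bdry C_def)
    next
      case 3
      have "W (\<kappa>2 n) i \<in> sets ball_measure" using cells 3 by (auto simp: sets_restrict_space_iff)
      then have "\<bar>phi e W \<kappa>1 \<kappa>2 n F k - phi e W \<kappa>1 \<kappa>2 n F' k\<bar> \<le>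
          C * L2norm ball_measure (\<lambda>x. f (deform \<Omega> x) - f' (deform \<Omega>' x))"
        using finite_measure.cell_average_diff_le[OF finite_ball_measure _ d(4,8)] 3
        by (simp add: F phi_average C_def)
      also have "\<dots> \<le> C * dX F F'" using X(2) by (intro mult_left_mono) (auto simp: C_def)
      finally show ?thesis .
    next
      case 4
      have "0 \<le> C * dX F F'"
        using order_trans[OF L2norm_nonneg X(2)] by (intro mult_nonneg_nonneg) (auto simp: C_def)
      then show ?thesis using 4 by (simp add: F phi_zero)
    qed
  qed
  moreover have "C \<ge> 0" by (simp add: C_def)
  ultimately show "\<exists>C\<ge>0. \<forall>F\<in>star_funs L. \<forall>F'\<in>star_funs L.
      \<bar>phi e W \<kappa>1 \<kappa>2 n F k - phi e W \<kappa>1 \<kappa>2 n F' k\<bar> \<le> C * dX F F'" by blast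
qed

end

subsection \<open>Continuity of the decoder\<close>

lemma continuous_map_Euclidean_space_pm:
  fixes \<psi> :: "(nat \<Rightarrow> real) \<Rightarrow> 'z"
  assumes im: "\<psi> ` D \<subseteq> Y"
    and cont: "\<And>v r. \<lbrakk>v \<in> D; r > 0\<rbrakk> \<Longrightarrow>
      \<exists>\<delta>>0. \<forall>w\<in>D. (\<forall>k<N. \<bar>w k - v k\<bar> < \<delta>) \<longrightarrow> d (\<psi> v) (\<psi> w) < r"
  shows "continuous_map (subtopology (Euclidean_space N) D) (pm_topology Y d) \<psi>"
  unfolding continuous_map_def
proof (intro conjI allI impI)
  let ?X = "subtopology (Euclidean_space N) D"
  show "\<psi> \<in> topspace ?X \<rightarrow> topspace (pm_topology Y d)" using im by auto
  fix S assume S: "openin (pm_topology Y d) S"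
  show "openin ?X {v \<in> topspace ?X. \<psi> v \<in> S}"
  proof (subst openin_subopen, rule ballI)
    fix v assume "v \<in> {v \<in> topspace ?X. \<psi> v \<in> S}"
    then have v: "v \<in> topspace ?X" "v \<in> D" "\<psi> v \<in> S" by auto
    obtain r where r: "r > 0" "\<And>y. y \<in> Y \<Longrightarrow> d (\<psi> v) y < r \<Longrightarrow> y \<in> S"
      using S v(3) unfolding openin_pm_topology by blast
    obtain \<delta> where \<delta>: "\<delta> > 0" "\<And>w. w \<in> D \<Longrightarrow> (\<forall>k<N. \<bar>w k - v k\<bar> < \<delta>) \<Longrightarrow> d (\<psi> v) (\<psi> w) < r"
      using cont[OF v(2) r(1)] by blast
    define B where "B = {w. \<forall>k<N. \<bar>w k - v k\<bar> < \<delta>}"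
    \<comment> \<open>Only finitely many factors of the box are proper subsets, so it is a basic
      open set of the product topology.\<close>
    have "B = (\<Pi>\<^sub>E k\<in>UNIV. if k < N then ball (v k) \<delta> else UNIV)"
      by (auto simp: B_def PiE_def Pi_iff dist_real_def abs_minus_commute split: if_splits)
    moreover have "openin (powertop_real UNIV) (\<Pi>\<^sub>E k\<in>UNIV. if k < N then ball (v k) \<delta> else UNIV)"
      by (intro product_topology_basis) (auto intro!: finite_subset[of _ "{..<N}"] split: if_splits)
    ultimately have "openin (powertop_real UNIV) B" by simp
    then have "openin ?X (B \<inter> topspace ?X)"
      unfolding Euclidean_space_def subtopology_subtopology by (auto simp: openin_subtopology)
    moreover have "v \<in> B \<inter> topspace ?X" using v \<delta> by (simp add: B_def)
    moreover have "B \<inter> topspace ?X \<subseteq> {v \<in> topspace ?X. \<psi> v \<in> S}"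
      using \<delta>(2) r(2) im by (auto simp: B_def)
    ultimately show "\<exists>T. openin ?X T \<and> v \<in> T \<and> T \<subseteq> {v \<in> topspace ?X. \<psi> v \<in> S}" by blast
  qed
qed

lemma open_psi1: "open (psi1 e T n v)"
  by (simp add: psi1_def Let_def)

text \<open>The polytopes of \<open>v\<close> and \<open>w\<close> have the same index simplices, so
  \<open>star_polytope_mono\<close> compares them up to the factor \<open>s\<close> about their
  apexes. \<open>star_domain_recentre\<close> turns this into a comparison about the centroid of the
  polytope of \<open>v\<close>, and \<open>star_domain_stability\<close> concludes.\<close>

lemma psi1_close:
  fixes e :: "nat \<Rightarrow> nat \<Rightarrow> 'a::euclidean_space"
  assumes T: "\<And>I. I \<in> T n \<Longrightarrow> I \<subseteq> {..<n}" and st: "star_domain (psi1 e T n v)"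
    and pos: "\<And>i. i < n \<Longrightarrow> 0 < v (DIM('a) + i)" and r: "r > 0"
  obtains \<delta> where "\<delta> > 0"
    "\<And>w. (\<And>k. k < n + DIM('a) \<Longrightarrow> \<bar>w k - v k\<bar> < \<delta>) \<Longrightarrow> dU (psi1 e T n v) (psi1 e T n w) \<le> r"
proof -
  define c :: "(nat \<Rightarrow> real) \<Rightarrow> 'a" where "c w = (\<Sum>k<DIM('a). w k *\<^sub>R basis_enum k)" for w
  define P where "P w = star_polytope (T n) (e n) (\<lambda>i. w (DIM('a) + i))" for w
  have psi1: "psi1 e T n w = (+) (c w) ` P w" for w
    by (simp add: psi1_eq_star_polytope c_def P_def)
  have mem: "c w + x \<in> psi1 e T n w \<longleftrightarrow> x \<in> P w" for w x
    unfolding psi1 by auto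
  obtain L where lip: "L-lipschitz_on (sphere 0 1) (bdry (psi1 e T n v))" using bdry_lipschitz[OF st] by blast
  obtain m M where m: "0 < m" "\<And>e'. e' \<in> sphere 0 1 \<Longrightarrow> m \<le> bdry (psi1 e T n v) e'"
    and M: "\<And>e'. e' \<in> sphere 0 1 \<Longrightarrow> bdry (psi1 e T n v) e' \<le> M"
    using bdry_bounds[OF st] by blast
  obtain e0 :: 'a where "e0 \<in> sphere 0 1" using sphere_nonempty by blast
  then have M0: "0 < M" using m(1) m(2)[of e0] M[of e0] by linarith
  obtain \<tau> where \<tau>: "\<tau> > 1" and stab: "\<And>\<Omega>0 \<Omega> :: 'a set.
      \<lbrakk>star_domain \<Omega>0; L-lipschitz_on (sphere 0 1) (bdry \<Omega>0);
       \<And>e. e \<in> sphere 0 1 \<Longrightarrow> m \<le> bdry \<Omega>0 e; \<And>e. e \<in> sphere 0 1 \<Longrightarrow> bdry \<Omega>0 e \<le> M; open \<Omega>;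
       \<And>x. centroid \<Omega>0 + x \<in> \<Omega>0 \<Longrightarrow> centroid \<Omega>0 + x /\<^sub>R \<tau> \<in> \<Omega>;
       \<And>x. centroid \<Omega>0 + x \<in> \<Omega> \<Longrightarrow> centroid \<Omega>0 + x /\<^sub>R \<tau> \<in> \<Omega>0\<rbrakk>
      \<Longrightarrow> dU \<Omega>0 \<Omega> \<le> r \<and> (\<forall>e\<in>sphere 0 1. 0 < bdry \<Omega> e)"
    using star_domain_stability[OF lipschitz_on_nonneg[OF lip] m(1) M0 r, where ?'a = 'a] by blast
  obtain \<eta> s where \<eta>: "\<eta> > 0" and s: "s > 1"
    and inn: "\<And>c' s' \<Omega> x. \<lbrakk>dist c' (c v) \<le> \<eta>; 1 \<le> s'; s' \<le> s;
       \<And>x. c v + x \<in> psi1 e T n v \<Longrightarrow> c' + x /\<^sub>R s' \<in> \<Omega>; centroid (psi1 e T n v) + x \<in> psi1 e T n v\<rbrakk>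
       \<Longrightarrow> centroid (psi1 e T n v) + x /\<^sub>R \<tau> \<in> \<Omega>"
    and out: "\<And>c' s' \<Omega> x. \<lbrakk>dist c' (c v) \<le> \<eta>; 1 \<le> s'; s' \<le> s;
       \<And>x. c' + x \<in> \<Omega> \<Longrightarrow> c v + x /\<^sub>R s' \<in> psi1 e T n v; centroid (psi1 e T n v) + x \<in> \<Omega>\<rbrakk>
       \<Longrightarrow> centroid (psi1 e T n v) + x /\<^sub>R \<tau> \<in> psi1 e T n v"
    using star_domain_recentre[OF st lip m \<tau>, of "c v"] by blast
  have "\<exists>\<beta>0>0. \<forall>i<n. \<beta>0 \<le> v (DIM('a) + i)"
  proof (intro exI conjI allI impI)
    \<comment> \<open>The inserted 1 keeps the minimum defined and positive for
      \<open>n = 0\<close>.\<close>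
    let ?B = "insert 1 ((\<lambda>i. v (DIM('a) + i)) ` {..<n})"
    show "0 < Min ?B" using pos by (subst Min_gr_iff) auto
    show "Min ?B \<le> v (DIM('a) + i)" if "i < n" for i using that by (intro Min_le) auto
  qed
  then obtain \<beta>0 where \<beta>0: "\<beta>0 > 0" "\<And>i. i < n \<Longrightarrow> \<beta>0 \<le> v (DIM('a) + i)" by blast
  \<comment> \<open>In turn: the heights of \<open>w\<close> stay at least
    \<open>\<beta>0 / 2\<close>; corresponding heights differ by a factor of at most
    \<open>s\<close>; the apex, a sum over \<open>DIM('a)\<close> coordinates, moves by at most
    \<open>\<eta>\<close>.\<close>
  define \<delta> where "\<delta> = min (\<beta>0 / 2) (min ((s - 1) * (\<beta>0 / 2)) (\<eta> / DIM('a)))"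
  have \<delta>0: "\<delta> > 0" using \<beta>0 s \<eta> by (simp add: \<delta>_def)
  have \<delta>: "\<delta> \<le> \<beta>0 / 2" "\<delta> \<le> (s - 1) * (\<beta>0 / 2)" "\<delta> \<le> \<eta> / DIM('a)"
    unfolding \<delta>_def by linarith+
  have "dU (psi1 e T n v) (psi1 e T n w) \<le> r" if w: "\<And>k. k < n + DIM('a) \<Longrightarrow> \<bar>w k - v k\<bar> < \<delta>" for w
  proof -
    have "dist (c w) (c v) = norm (\<Sum>k<DIM('a). (w k - v k) *\<^sub>R (basis_enum k :: 'a))"
      by (simp add: dist_norm c_def sum_subtractf scaleR_left_diff_distrib)
    also have "\<dots> \<le> (\<Sum>k<DIM('a). norm ((w k - v k) *\<^sub>R (basis_enum k :: 'a)))" by (rule norm_sum)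
    also have "\<dots> \<le> (\<Sum>k<DIM('a). \<eta> / DIM('a))"
    proof (rule sum_mono)
      fix k assume "k \<in> {..<DIM('a)}"
      then have "norm ((w k - v k) *\<^sub>R (basis_enum k :: 'a)) = \<bar>w k - v k\<bar>" "\<bar>w k - v k\<bar> < \<delta>"
        using w[of k] by (auto simp: norm_basis_enum)
      then show "norm ((w k - v k) *\<^sub>R (basis_enum k :: 'a)) \<le> \<eta> / DIM('a)" using \<delta>(3) by linarith
    qed
    finally have cw: "dist (c w) (c v) \<le> \<eta>" by simp
    have \<beta>: "0 < w (DIM('a) + i)" "w (DIM('a) + i) \<le> s * v (DIM('a) + i)" "v (DIM('a) + i) \<le> s * w (DIM('a) + i)"
      if i: "i < n" for i
    proof -
      define a where "a = v (DIM('a) + i)"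
      define b where "b = w (DIM('a) + i)"
      have ab: "\<bar>b - a\<bar> < \<delta>" "\<beta>0 \<le> a" using w[of "DIM('a) + i"] \<beta>0(2)[OF i] i by (auto simp: a_def b_def)
      have b: "\<beta>0 / 2 \<le> b" using ab \<delta>(1) by linarith
      have "(s - 1) * (\<beta>0 / 2) \<le> (s - 1) * b" "(s - 1) * (\<beta>0 / 2) \<le> (s - 1) * a"
        using b ab(2) s \<beta>0(1) by (intro mult_left_mono; linarith)+
      then have "b \<le> s * a" "a \<le> s * b" using ab(1) \<delta>(2) unfolding left_diff_distrib by linarith+
      then show "0 < w (DIM('a) + i)" "w (DIM('a) + i) \<le> s * v (DIM('a) + i)" "v (DIM('a) + i) \<le> s * w (DIM('a) + i)"
        using b \<beta>0(1) by (simp_all add: a_def b_def)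
    qed
    have fin: "finite I" if "I \<in> T n" for I using T[OF that] finite_subset by blast
    have lt: "i < n" if "I \<in> T n" "i \<in> I" for I i using T[OF that(1)] that(2) by blast
    have Pvw: "x /\<^sub>R s \<in> P w" if "x \<in> P v" for x
      using that s unfolding P_def
      by (intro star_polytope_mono[of "T n" s "\<lambda>i. v (DIM('a) + i)"]) (auto intro: fin \<beta> lt less_imp_le[OF pos])
    have Pwv: "x /\<^sub>R s \<in> P v" if "x \<in> P w" for x
      using that s unfolding P_def
      by (intro star_polytope_mono[of "T n" s "\<lambda>i. w (DIM('a) + i)"]) (auto intro: fin \<beta> lt pos less_imp_le[OF \<beta>(1)])
    have vw: "c w + x /\<^sub>R s \<in> psi1 e T n w" if "c v + x \<in> psi1 e T n v" for x
      using that Pvw by (simp add: mem)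
    have I: "centroid (psi1 e T n v) + x /\<^sub>R \<tau> \<in> psi1 e T n w"
      if "centroid (psi1 e T n v) + x \<in> psi1 e T n v" for x
      by (rule inn[OF cw less_imp_le[OF s] order_refl vw that])
    have wv: "c v + x /\<^sub>R s \<in> psi1 e T n v" if "c w + x \<in> psi1 e T n w" for x
      using that Pwv by (simp add: mem)
    have O: "centroid (psi1 e T n v) + x /\<^sub>R \<tau> \<in> psi1 e T n v"
      if "centroid (psi1 e T n v) + x \<in> psi1 e T n w" for x
      by (rule out[OF cw less_imp_le[OF s] order_refl wv that])
    show ?thesis by (rule stab[OF st lip m(2) M open_psi1 I O, THEN conjunct1])
  qed
  then show thesis using that \<delta>0 by blast
qed

lemma (in finite_measure) L2norm_cell_step_diff_le:
  assumes D: "\<And>i. i < n \<Longrightarrow> D i \<in> sets M" and d: "\<And>i. i < n \<Longrightarrow> \<bar>c i - c' i\<bar> \<le> \<delta>" and \<delta>: "\<delta> \<ge> 0"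
  shows "L2norm M (\<lambda>x. cell_step n D c x - cell_step n D c' x) \<le> n * \<delta> * sqrt (measure M (space M))"
proof (rule L2norm_le_const)
  show "(\<lambda>x. cell_step n D c x - cell_step n D c' x) \<in> bdd_measurable M"
    using D by (intro bdd_measurable_diff cell_step_bdd_measurable)
  fix x
  have "\<bar>cell_step n D c x - cell_step n D c' x\<bar> = \<bar>\<Sum>i<n. (c i - c' i) * indicator (D i) x\<bar>"
    by (simp add: cell_step_def sum_subtractf left_diff_distrib)
  also have "\<dots> \<le> (\<Sum>i<n. \<bar>(c i - c' i) * indicator (D i) x\<bar>)" by (rule sum_abs)
  also have "\<dots> \<le> (\<Sum>i<n. \<delta>)" using d \<delta> by (intro sum_mono) (auto simp: indicator_def abs_mult)
  finally show "\<bar>cell_step n D c x - cell_step n D c' x\<bar> \<le> n * \<delta>" by simp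
qed (use \<delta> in simp)

lemma psi_in_all_star_funs:
  assumes "psi e T W \<kappa>1 \<kappa>2 n v \<in> all_star_funs"
  shows "star_domain (psi1 e T (\<kappa>1 n) v)"
proof -
  obtain f where "psi e T W \<kappa>1 \<kappa>2 n v = (psi1 e T (\<kappa>1 n) v, f)"
    by (simp add: psi_def sigma_inv_def)
  then show ?thesis using assms by (simp add: all_star_funs_def)
qed

text \<open>By \<open>dX_sigma_inv\<close> the distance splits into \<open>dU\<close> of two
  polytopes and the \<open>L2norm\<close> distance of two step functions on the same cells. Positive
  heights allow the ratios of vertex heights to be compared.\<close>

lemma psi_continuous:
  fixes e :: "nat \<Rightarrow> nat \<Rightarrow> 'a::euclidean_space"
  assumes T: "\<And>I. I \<in> T (\<kappa>1 n) \<Longrightarrow> I \<subseteq> {..<\<kappa>1 n}"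
    and cells: "\<And>i. i < \<kappa>2 n \<Longrightarrow> W (\<kappa>2 n) i \<in> sets ball_measure"
    and D: "\<And>v. v \<in> D \<Longrightarrow> psi e T W \<kappa>1 \<kappa>2 n v \<in> all_star_funs"
      "\<And>v i. v \<in> D \<Longrightarrow> i < \<kappa>1 n \<Longrightarrow> 0 < v (DIM('a) + i)"
  shows "continuous_map (subtopology (Euclidean_space (\<kappa>1 n + DIM('a) + \<kappa>2 n)) D)
    (pm_topology all_star_funs dX) (psi e T W \<kappa>1 \<kappa>2 n)"
proof (rule continuous_map_Euclidean_space_pm)
  interpret finite_measure "ball_measure :: 'a measure" by (rule finite_ball_measure)
  show "psi e T W \<kappa>1 \<kappa>2 n ` D \<subseteq> all_star_funs" using D(1) by blast
  fix v and r :: real assume v: "v \<in> D" and r: "r > 0"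
  have stD: "star_domain (psi1 e T (\<kappa>1 n) w)" if "w \<in> D" for w
    by (rule psi_in_all_star_funs[OF D(1)[OF that]])
  \<comment> \<open>One third of \<open>r\<close> for each component leaves room for the strict
    inequality.\<close>
  obtain \<delta>1 where \<delta>1: "\<delta>1 > 0" "\<And>w. (\<And>k. k < \<kappa>1 n + DIM('a) \<Longrightarrow> \<bar>w k - v k\<bar> < \<delta>1) \<Longrightarrow>
      dU (psi1 e T (\<kappa>1 n) v) (psi1 e T (\<kappa>1 n) w) \<le> r / 3"
    using psi1_close[of T "\<kappa>1 n" e v "r / 3"] T stD[OF v] D(2)[OF v] r by auto
  define m where "m = sqrt (measure (ball_measure :: 'a measure) (space ball_measure))"
  define \<delta>2 where "\<delta>2 = r / (3 * (\<kappa>2 n * m + 1))"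
  have m: "0 \<le> \<kappa>2 n * m" by (simp add: m_def)
  then have \<delta>2: "\<delta>2 > 0" "\<kappa>2 n * \<delta>2 * m \<le> r / 3" using r by (auto simp: \<delta>2_def field_simps)
  show "\<exists>\<delta>>0. \<forall>w\<in>D. (\<forall>k<\<kappa>1 n + DIM('a) + \<kappa>2 n. \<bar>w k - v k\<bar> < \<delta>) \<longrightarrow>
      dX (psi e T W \<kappa>1 \<kappa>2 n v) (psi e T W \<kappa>1 \<kappa>2 n w) < r"
  proof (intro exI conjI ballI impI)
    show "min \<delta>1 \<delta>2 > 0" using \<delta>1 \<delta>2 by simp
    fix w assume w: "w \<in> D" and wv: "\<forall>k<\<kappa>1 n + DIM('a) + \<kappa>2 n. \<bar>w k - v k\<bar> < min \<delta>1 \<delta>2"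
    define g where "g u = psi2 W (\<kappa>2 n) (\<lambda>i. u (\<kappa>1 n + DIM('a) + i))" for u
    have psi: "psi e T W \<kappa>1 \<kappa>2 n u = sigma_inv (psi1 e T (\<kappa>1 n) u, g u)" for u
      by (simp add: psi_def g_def)
    have inj: "inj_on (deform (psi1 e T (\<kappa>1 n) u)) (ball 0 1)" if "u \<in> D" for u
      using deform_inj_on bdry_pos[OF stD[OF that]] by blast
    obtain f where f: "sigma_inv (psi1 e T (\<kappa>1 n) v, g v) = (psi1 e T (\<kappa>1 n) v, f)"
      by (simp add: sigma_inv_def)
    have "dX (psi e T W \<kappa>1 \<kappa>2 n v) (psi e T W \<kappa>1 \<kappa>2 n w) =
        dU (psi1 e T (\<kappa>1 n) v) (psi1 e T (\<kappa>1 n) w) +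
        L2norm ball_measure (\<lambda>x. f (deform (psi1 e T (\<kappa>1 n) v) x) - g w x)"
      unfolding psi f by (rule dX_sigma_inv[OF inj[OF w]])
    also have "L2norm ball_measure (\<lambda>x. f (deform (psi1 e T (\<kappa>1 n) v) x) - g w x) =
        L2norm ball_measure (\<lambda>x. cell_step (\<kappa>2 n) (W (\<kappa>2 n)) (\<lambda>i. v (\<kappa>1 n + DIM('a) + i)) x -
          cell_step (\<kappa>2 n) (W (\<kappa>2 n)) (\<lambda>i. w (\<kappa>1 n + DIM('a) + i)) x)"
      using sigma_inv_deform(2)[OF f inj[OF v]]
      by (intro L2norm_cong) (simp add: g_def psi2_eq_cell_step)
    also have "\<dots> \<le> \<kappa>2 n * \<delta>2 * m"
    proof -
      have "\<bar>v (\<kappa>1 n + DIM('a) + i) - w (\<kappa>1 n + DIM('a) + i)\<bar> \<le> \<delta>2" if "i < \<kappa>2 n" for i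
        using wv[rule_format, of "\<kappa>1 n + DIM('a) + i"] that by (simp add: abs_minus_commute)
      then show ?thesis
        unfolding m_def using cells \<delta>2(1) by (intro L2norm_cell_step_diff_le) auto
    qed
    finally show "dX (psi e T W \<kappa>1 \<kappa>2 n v) (psi e T W \<kappa>1 \<kappa>2 n w) < r"
      using \<delta>1(2)[of w] wv \<delta>2(2) r by fastforce
  qed
qed

subsection \<open>Convergence\<close>

lemma strict_mono_on_ge:
  fixes \<kappa> :: "nat \<Rightarrow> nat"
  assumes "strict_mono_on {1..} \<kappa>" "\<kappa> ` {1..} \<subseteq> {1..}" "n \<ge> 1"
  shows "n \<le> \<kappa> n"
  using assms(3)
proof (induction n rule: nat_induct_at_least)
  case base
  then show ?case using assms(2) by auto
next
  case (Suc n)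
  then show ?case using strict_mono_onD[OF assms(1), of n "Suc n"] by auto
qed

lemma filterlim_strict_mono_on:
  fixes \<kappa> :: "nat \<Rightarrow> nat"
  assumes "strict_mono_on {1..} \<kappa>" "\<kappa> ` {1..} \<subseteq> {1..}"
  shows "filterlim \<kappa> sequentially sequentially"
  by (rule filterlim_at_top_mono[OF filterlim_ident])
    (use strict_mono_on_ge[OF assms] in \<open>auto intro: eventually_sequentiallyI[of 1]\<close>)

lemma star_polytope_cong:
  assumes "\<And>I i. I \<in> T \<Longrightarrow> i \<in> I \<Longrightarrow> \<beta> i = \<beta>' i"
  shows "star_polytope T p \<beta> = star_polytope T p \<beta>'"
proof -
  have "(\<lambda>i. \<beta> i *\<^sub>R p i) ` I = (\<lambda>i. \<beta>' i *\<^sub>R p i) ` I" if "I \<in> T" for I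
    using assms[OF that] by (intro image_cong) auto
  then show ?thesis unfolding star_polytope_def by simp
qed

lemma open_star_region_bdry:
  assumes "star_domain \<Omega>"
  shows "open (star_region (bdry \<Omega>))"
proof -
  have "star_region (bdry \<Omega>) = (\<lambda>x. centroid \<Omega> + x) -` \<Omega>"
    using in_star_domain_iff[OF assms] by auto
  then show ?thesis
    using star_domain_open[OF assms] by (auto intro!: open_vimage continuous_intros)
qed

text \<open>The apex of the decoded polytope is the centroid of the encoded domain, so
  \<open>star_domain_stability\<close> applies to that domain directly, with its own boundary
  function as interpolated data. The error splits into \<open>\<epsilon> / 2\<close> for the domain,
  \<open>\<epsilon> / 4\<close> for averaging near \<open>G0\<close>, and
  \<open>\<epsilon> / 4\<close> for the distance from \<open>F0\<close>.\<close>

lemma projection_converges_locally: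
  fixes e :: "nat \<Rightarrow> nat \<Rightarrow> 'a::euclidean_space" and W :: "nat \<Rightarrow> nat \<Rightarrow> 'a set"
  assumes unit: "\<And>n i. n \<ge> 1 \<Longrightarrow> i < n \<Longrightarrow> e n i \<in> sphere 0 1"
    and T: "\<And>n. T n \<subseteq> {I. I \<subseteq> {..<n} \<and> card I = DIM('a)}"
    and evenly_placed: "\<forall>\<^sub>F n in sequentially. 0 \<in> interior (convex hull (e n ` {..<n}))"
    and boundary: "\<forall>\<^sub>F n in sequentially. boundary_triangulation n (e n) (T n)"
    and mesh_sphere: "(\<lambda>n. MAX I\<in>T n. diameter (convex hull (e n ` I))) \<longlonglongrightarrow> 0"
    and cells_borel: "\<And>n i. n \<ge> 1 \<Longrightarrow> i < n \<Longrightarrow> W n i \<in> sets borel"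
    and cells_disjoint: "\<And>n. n \<ge> 1 \<Longrightarrow> disjoint_family_on (W n) {..<n}"
    and cells_cover: "\<And>n. n \<ge> 1 \<Longrightarrow> (\<Union>i<n. W n i) = ball 0 1"
    and mesh_ball: "(\<lambda>n. MAX i\<in>{..<n}. diameter (W n i)) \<longlonglongrightarrow> 0"
    and \<kappa>1: "strict_mono_on {1..} \<kappa>1" "\<kappa>1 ` {1..} \<subseteq> {1..}"
    and \<kappa>2: "strict_mono_on {1..} \<kappa>2" "\<kappa>2 ` {1..} \<subseteq> {1..}"
    and F0: "F0 \<in> star_funs L" and \<epsilon>: "\<epsilon> > 0"
  shows "\<exists>r>0. \<forall>\<^sub>F n in sequentially. \<forall>F\<in>star_funs L. dX F0 F < r \<longrightarrow>
    dX F (psi e T W \<kappa>1 \<kappa>2 n (phi e W \<kappa>1 \<kappa>2 n F)) \<le> \<epsilon>"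
proof -
  obtain \<Omega>0 f0 where F0eq: "F0 = (\<Omega>0, f0)" by (metis surj_pair)
  note d0 = star_funsD[OF F0[unfolded F0eq]]
  define G0 where "G0 x = f0 (deform \<Omega>0 x)" for x
  have L: "0 \<le> L" by (rule lipschitz_on_nonneg[OF d0(2)])
  obtain m M where m: "0 < m" "\<And>e. e \<in> sphere 0 1 \<Longrightarrow> m \<le> bdry \<Omega>0 e"
    and M: "\<And>e. e \<in> sphere 0 1 \<Longrightarrow> bdry \<Omega>0 e \<le> M"
    using bdry_bounds[OF d0(1)] by blast
  obtain e0 :: 'a where e0: "e0 \<in> sphere 0 1" using sphere_nonempty by blast
  then have M0: "0 < M + m" using m(1) m(2)[of e0] M[of e0] by linarith
  have m2: "0 < m / 2" and \<epsilon>2: "0 < \<epsilon> / 2" and \<epsilon>4: "0 < \<epsilon> / 4" using m \<epsilon> by auto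
  obtain \<tau> where \<tau>: "\<tau> > 1" and stab: "\<And>\<Omega>0 \<Omega> :: 'a set.
      \<lbrakk>star_domain \<Omega>0; L-lipschitz_on (sphere 0 1) (bdry \<Omega>0);
       \<And>e. e \<in> sphere 0 1 \<Longrightarrow> m / 2 \<le> bdry \<Omega>0 e; \<And>e. e \<in> sphere 0 1 \<Longrightarrow> bdry \<Omega>0 e \<le> M + m; open \<Omega>;
       \<And>x. centroid \<Omega>0 + x \<in> \<Omega>0 \<Longrightarrow> centroid \<Omega>0 + x /\<^sub>R \<tau> \<in> \<Omega>;
       \<And>x. centroid \<Omega>0 + x \<in> \<Omega> \<Longrightarrow> centroid \<Omega>0 + x /\<^sub>R \<tau> \<in> \<Omega>0\<rbrakk>
      \<Longrightarrow> dU \<Omega>0 \<Omega> \<le> \<epsilon> / 2 \<and> (\<forall>e\<in>sphere 0 1. 0 < bdry \<Omega> e)"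
    using star_domain_stability[OF L m2 M0 \<epsilon>2, where ?'a = 'a] by blast
  obtain h where h: "0 < h" "h < 1" "(1 + 2 * L * h / (m / 2)) / (1 - h) < \<tau>"
  proof -
    \<comment> \<open>The factor required by \<open>star_polytope_approx\<close> tends to 1 as the
      mesh \<open>h\<close> tends to 0, while \<open>\<tau> > 1\<close> is already fixed.\<close>
    have "((\<lambda>h. (1 + 2 * L * h / (m / 2)) / (1 - h)) \<longlongrightarrow> (1 + 2 * L * 0 / (m / 2)) / (1 - 0)) (at_right 0)"
      using m2 by (intro tendsto_intros) auto
    then have "\<forall>\<^sub>F h in at_right 0. (1 + 2 * L * h / (m / 2)) / (1 - h) < \<tau>"
      using \<tau> by (intro order_tendstoD(2)) auto
    moreover have "\<forall>\<^sub>F h in at_right 0. (h::real) < 1" by (intro order_tendstoD(2)[OF tendsto_ident_at]) simp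
    moreover have "\<forall>\<^sub>F h in at_right 0. (0::real) < h" by (rule eventually_at_right_less)
    ultimately have "\<forall>\<^sub>F h in at_right 0. (1 + 2 * L * h / (m / 2)) / (1 - h) < \<tau> \<and> h < 1 \<and> 0 < h"
      by eventually_elim auto
    from eventually_happens'[OF trivial_limit_at_right_real this] that show thesis by blast
  qed
  have finT: "finite (T n)" for n
    using T[of n] by (rule finite_subset) (auto intro: finite_subset[of _ "Pow {..<n}"])
  have Tn: "I \<subseteq> {..<n}" "finite I" if "I \<in> T n" for n I
    using T[of n] that finite_subset by blast+
  have bdd: "bounded (convex hull (e n ` I))" if "finite I" for n I
    by (intro bounded_convex_hull finite_imp_bounded finite_imageI that)
  have "\<forall>\<^sub>F n in sequentially. \<forall>I\<in>T n. \<forall>x\<in>convex hull (e n ` I). \<forall>y\<in>convex hull (e n ` I). dist x y \<le> h"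
    by (rule eventually_mesh_le[OF mesh_sphere finT bdd[OF Tn(2)] h(1)])
  from this evenly_placed boundary have ev1: "\<forall>\<^sub>F n in sequentially.
      (\<forall>I\<in>T n. \<forall>x\<in>convex hull (e n ` I). \<forall>y\<in>convex hull (e n ` I). dist x y \<le> h) \<and>
      0 \<in> interior (convex hull (e n ` {..<n})) \<and> boundary_triangulation n (e n) (T n)"
    by eventually_elim auto
  have ev2: "\<forall>\<^sub>F n in sequentially. \<forall>G\<in>bdd_measurable ball_measure.
    L2norm ball_measure (\<lambda>x. G x - cell_step n (W n) (cell_average ball_measure (W n) G) x)
      \<le> L2norm ball_measure (\<lambda>x. G x - G0 x) + \<epsilon> / 4"
    using cell_average_converges[OF cells_borel cells_disjoint cells_cover mesh_ball _ \<epsilon>4, of G0] d0(4)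
    unfolding G0_def by blast
  \<comment> \<open>\<open>r \<le> m / 2\<close> keeps all boundary functions near
    \<open>\<Omega>0\<close> between \<open>m / 2\<close> and \<open>M + m\<close>, the bounds for
    which \<open>\<tau>\<close> was chosen.\<close>
  define r where "r = min (m / 2) (\<epsilon> / 4)"
  have r: "r > 0" "r \<le> m / 2" "r \<le> \<epsilon> / 4" using m \<epsilon> by (auto simp: r_def)
  have "\<forall>\<^sub>F n in sequentially. \<forall>F\<in>star_funs L. dX F0 F < r \<longrightarrow>
    dX F (psi e T W \<kappa>1 \<kappa>2 n (phi e W \<kappa>1 \<kappa>2 n F)) \<le> \<epsilon>"
    using eventually_compose_filterlim[OF ev1 filterlim_strict_mono_on[OF \<kappa>1]]
      eventually_compose_filterlim[OF ev2 filterlim_strict_mono_on[OF \<kappa>2]] eventually_ge_at_top[of 1]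
  proof eventually_elim
    case (elim n)
    define k where "k = \<kappa>1 n"
    have k1: "1 \<le> k" and k2: "1 \<le> \<kappa>2 n" using \<kappa>1(2) \<kappa>2(2) elim(3) by (auto simp: k_def)
    have cells: "W (\<kappa>2 n) i \<in> sets borel" "W (\<kappa>2 n) i \<subseteq> ball 0 1" if "i < \<kappa>2 n" for i
      using cells_borel[OF k2 that] cells_cover[OF k2] that by auto
    show ?case
    proof (intro ballI impI)
      fix F assume F: "F \<in> star_funs L" "dX F0 F < r"
      obtain \<Omega> f where Feq: "F = (\<Omega>, f)" by (metis surj_pair)
      note d = star_funsD[OF F(1)[unfolded Feq]]
      define G where "G x = f (deform \<Omega> x)" for x
      define v where "v = phi e W \<kappa>1 \<kappa>2 n F"
      define \<Omega>' where "\<Omega>' = psi1 e T k v"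
      define b where "b = bdry \<Omega>"
      have X: "dX F0 F = dU \<Omega>0 \<Omega> + L2norm ball_measure (\<lambda>x. G0 x - G x)"
        by (simp add: F0eq Feq dX_eq G_def G0_def)
      have dU0: "dU \<Omega>0 \<Omega> < r"
        using F(2) L2norm_nonneg[of ball_measure "\<lambda>x. G0 x - G x"] unfolding X by linarith
      have "0 \<le> dU \<Omega>0 \<Omega>" using order_trans[OF zero_le_dist dist_centroid_le_dU[OF d0(1) d(1)]] .
      then have LG: "L2norm ball_measure (\<lambda>x. G x - G0 x) < r"
        using F(2) L2norm_minus_commute[of ball_measure G G0] unfolding X by linarith
      have bm: "m / 2 \<le> b u" and bM: "b u \<le> M + m" if "u \<in> sphere 0 1" for u
        using bdry_diff_le_dU[OF d0(1) d(1) that] dU0 r(2) m(1) m(2)[OF that] M[OF that]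
        unfolding b_def abs_le_iff by linarith+
      note simps = phi_simps[of \<kappa>1 n e \<kappa>2 W, OF unit[OF k1[unfolded k_def]] cells]
      have vb: "v (DIM('a) + i) = (b \<circ> e k) i" if "i < k" for i
        unfolding v_def Feq b_def k_def using simps(2) that by (simp add: k_def)
      have "(\<Sum>j<DIM('a). v j *\<^sub>R basis_enum j) = (\<Sum>j<DIM('a). (centroid \<Omega> \<bullet> basis_enum j) *\<^sub>R basis_enum j)"
        unfolding v_def Feq using simps(1) by (intro sum.cong) auto
      also have "\<dots> = centroid \<Omega>" by (rule sum_basis_enum)
      finally have cv: "(\<Sum>j<DIM('a). v j *\<^sub>R basis_enum j) = centroid \<Omega>" .
      have "star_polytope (T k) (e k) (\<lambda>i. v (DIM('a) + i)) = star_polytope (T k) (e k) (b \<circ> e k)"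
        using Tn(1) vb by (intro star_polytope_cong) blast
      then have \<Omega>': "\<Omega>' = (+) (centroid \<Omega>) ` star_polytope (T k) (e k) (b \<circ> e k)"
        unfolding \<Omega>'_def psi1_eq_star_polytope cv by simp
      then have mem': "centroid \<Omega> + x \<in> \<Omega>' \<longleftrightarrow> x \<in> star_polytope (T k) (e k) (b \<circ> e k)" for x by auto
      have mem: "centroid \<Omega> + x \<in> \<Omega> \<longleftrightarrow> x \<in> star_region b" for x
        using in_star_domain_iff[OF d(1)] by (simp add: b_def)
      have lipb: "L-lipschitz_on (sphere 0 1) b" using d(2) by (simp add: b_def)
      have un: "e k i \<in> sphere 0 1" if "I \<in> T k" "i \<in> I" for I i
        using unit[OF k1] Tn(1)[OF that(1)] that(2) by blast
      have ms: "dist x y \<le> h" if "I \<in> T k" "x \<in> convex hull (e k ` I)" "y \<in> convex hull (e k ` I)" for I x y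
        using elim(1) that unfolding k_def by blast
      have fin: "finite I" if "I \<in> T k" for I by (rule Tn(2)[OF that])
      note ap = lipb m2 bm fin un ms h
      have hull: "bounded (convex hull (e k ` {..<k}))" "0 \<in> interior (convex hull (e k ` {..<k}))"
        "(\<Union>I\<in>T k. convex hull (e k ` I)) = frontier (convex hull (e k ` {..<k}))"
        using elim(1) bdd unfolding k_def boundary_triangulation_def by blast+
      have opb: "open (star_region b)" using open_star_region_bdry[OF d(1)] by (simp add: b_def)
      have inner: "x /\<^sub>R \<tau> \<in> star_polytope (T k) (e k) (b \<circ> e k)" if "x \<in> star_region b" for x
        by (rule star_polytope_approx_inner[OF ap hull opb that])
      have outer: "x /\<^sub>R \<tau> \<in> star_region b" if "x \<in> star_polytope (T k) (e k) (b \<circ> e k)" for x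
        by (rule star_polytope_approx_outer[OF ap that])
      have inn: "centroid \<Omega> + x /\<^sub>R \<tau> \<in> \<Omega>'" if "centroid \<Omega> + x \<in> \<Omega>" for x
        using inner that mem mem' by blast
      have out: "centroid \<Omega> + x /\<^sub>R \<tau> \<in> \<Omega>" if "centroid \<Omega> + x \<in> \<Omega>'" for x
        using outer that mem mem' by blast
      have opO: "open \<Omega>'" unfolding \<Omega>'_def by (rule open_psi1)
      \<comment> \<open>Stability is applied around the varying domain \<open>\<Omega>\<close>, not
        around \<open>\<Omega>0\<close>, with one \<open>\<tau>\<close> for all
        \<open>\<Omega>\<close> in the neighbourhood.\<close>
      from stab[OF d(1,2) bm[unfolded b_def] bM[unfolded b_def] opO inn out]
      have dU1: "dU \<Omega> \<Omega>' \<le> \<epsilon> / 2" and pos: "\<And>u. u \<in> sphere 0 1 \<Longrightarrow> 0 < bdry \<Omega>' u" by auto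
      define g where "g = psi2 W (\<kappa>2 n) (\<lambda>i. v (\<kappa>1 n + DIM('a) + i))"
      have g: "g x = cell_step (\<kappa>2 n) (W (\<kappa>2 n)) (cell_average ball_measure (W (\<kappa>2 n)) G) x"
        if "x \<in> ball 0 1" for x
        using that simps(3) unfolding g_def psi2_eq_cell_step[OF that] v_def Feq G_def cell_step_def
        by (intro sum.cong) auto
      have "dX F (psi e T W \<kappa>1 \<kappa>2 n v) = dU \<Omega> \<Omega>' + L2norm ball_measure (\<lambda>x. G x - g x)"
        using dX_sigma_inv[OF deform_inj_on[OF pos]]
        unfolding psi_def Feq g_def \<Omega>'_def k_def G_def by blast
      also have "L2norm ball_measure (\<lambda>x. G x - g x) = L2norm ball_measure
          (\<lambda>x. G x - cell_step (\<kappa>2 n) (W (\<kappa>2 n)) (cell_average ball_measure (W (\<kappa>2 n)) G) x)"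
        using g by (intro L2norm_cong) simp
      also have "\<dots> \<le> L2norm ball_measure (\<lambda>x. G x - G0 x) + \<epsilon> / 4"
        using bspec[OF elim(2), of G] d(4) by (simp add: G_def[abs_def])
      finally show "dX F (psi e T W \<kappa>1 \<kappa>2 n (phi e W \<kappa>1 \<kappa>2 n F)) \<le> \<epsilon>"
        using dU1 LG r(3) unfolding v_def by linarith
    qed
  qed
  then show ?thesis using r(1) by blast
qed

theorem theorem4:
  fixes L :: real
    and e :: "nat \<Rightarrow> nat \<Rightarrow> 'a::euclidean_space"
    and T :: "nat \<Rightarrow> nat set set"
    and W :: "nat \<Rightarrow> nat \<Rightarrow> 'a set"
    and \<kappa>1 \<kappa>2 :: "nat \<Rightarrow> nat"
  assumes unit: "\<And>n i. n \<ge> 1 \<Longrightarrow> i < n \<Longrightarrow> e n i \<in> sphere 0 1"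
    and index_simplices: "\<And>n. T n \<subseteq> {I. I \<subseteq> {..<n} \<and> card I = DIM('a)}"
    and evenly_placed: "\<forall>\<^sub>F n in sequentially. 0 \<in> interior (convex hull (e n ` {..<n}))"
    and boundary: "\<forall>\<^sub>F n in sequentially. boundary_triangulation n (e n) (T n)"
    and mesh_sphere: "(\<lambda>n. MAX I\<in>T n. diameter (convex hull (e n ` I))) \<longlonglongrightarrow> 0"
    and cells_borel: "\<And>n i. n \<ge> 1 \<Longrightarrow> i < n \<Longrightarrow> W n i \<in> sets borel"
    and cells_disjoint: "\<And>n. n \<ge> 1 \<Longrightarrow> disjoint_family_on (W n) {..<n}"
    and cells_cover: "\<And>n. n \<ge> 1 \<Longrightarrow> (\<Union>i<n. W n i) = ball 0 1"
    and mesh_ball: "(\<lambda>n. MAX i\<in>{..<n}. diameter (W n i)) \<longlonglongrightarrow> 0"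
    and \<kappa>1: "strict_mono_on {1..} \<kappa>1" "\<kappa>1 ` {1..} \<subseteq> {1..}"
    and \<kappa>2: "strict_mono_on {1..} \<kappa>2" "\<kappa>2 ` {1..} \<subseteq> {1..}"
  shows "discretization_assumption (star_funs L) all_star_funs dX
           (\<lambda>n. \<kappa>1 n + DIM('a) + \<kappa>2 n) (phi e W \<kappa>1 \<kappa>2) (psi e T W \<kappa>1 \<kappa>2)"
  unfolding discretization_assumption_def
proof (intro conjI allI impI)
  show "star_funs L \<subseteq> (all_star_funs :: ('a set \<times> ('a \<Rightarrow> real)) set)"
    by (auto simp: star_funs_def all_star_funs_def star_domains_def)
  show "strict_mono_on {1..} (\<lambda>n. \<kappa>1 n + DIM('a) + \<kappa>2 n)"
    using \<kappa>1(1) \<kappa>2(1) unfolding strict_mono_on_def by (auto intro: add_strict_mono)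
  show "(\<lambda>n. \<kappa>1 n + DIM('a) + \<kappa>2 n) ` {1..} \<subseteq> {1..}" by (auto simp: Suc_le_eq)
next
  fix n :: nat assume n: "n \<ge> 1"
  have k1: "1 \<le> \<kappa>1 n" and k2: "1 \<le> \<kappa>2 n" using \<kappa>1(2) \<kappa>2(2) n by auto
  have cells: "W (\<kappa>2 n) i \<in> sets borel" "W (\<kappa>2 n) i \<subseteq> ball 0 1" if "i < \<kappa>2 n" for i
    using cells_borel[OF k2 that] cells_cover[OF k2] that by auto
  note ctx = unit[OF k1] cells
  show "continuous_map (pm_topology (star_funs L) dX) (Euclidean_space (\<kappa>1 n + DIM('a) + \<kappa>2 n)) (phi e W \<kappa>1 \<kappa>2 n)"
    by (rule phi_continuous[of \<kappa>1 n e \<kappa>2 W, OF ctx])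
  show "continuous_map (subtopology (Euclidean_space (\<kappa>1 n + DIM('a) + \<kappa>2 n))
      {v \<in> phi e W \<kappa>1 \<kappa>2 n ` star_funs L. psi e T W \<kappa>1 \<kappa>2 n v \<in> all_star_funs})
    (pm_topology all_star_funs dX) (psi e T W \<kappa>1 \<kappa>2 n)"
  proof (rule psi_continuous)
    show "I \<subseteq> {..<\<kappa>1 n}" if "I \<in> T (\<kappa>1 n)" for I using index_simplices that by blast
    show "W (\<kappa>2 n) i \<in> sets ball_measure" if "i < \<kappa>2 n" for i
      using cells[OF that] by (auto simp: sets_restrict_space_iff)
    fix v assume v: "v \<in> {v \<in> phi e W \<kappa>1 \<kappa>2 n ` star_funs L. psi e T W \<kappa>1 \<kappa>2 n v \<in> all_star_funs}"
    then show "psi e T W \<kappa>1 \<kappa>2 n v \<in> all_star_funs" by simp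
    fix i assume i: "i < \<kappa>1 n"
    obtain \<Omega> f where F: "(\<Omega>, f) \<in> star_funs L" "v = phi e W \<kappa>1 \<kappa>2 n (\<Omega>, f)" using v by auto
    \<comment> \<open>A code of a star domain carries values of its boundary function, which are
      positive.\<close>
    show "0 < v (DIM('a) + i)"
      using bdry_pos[OF star_funsD(1)[OF F(1)] unit[OF k1 i]] phi_bdry[of \<kappa>1 n e \<kappa>2 W, OF ctx i] F(2) by simp
  qed
next
  fix K :: "('a set \<times> ('a \<Rightarrow> real)) set"
  assume K: "compactin (pm_topology (star_funs L) dX) K"
  show "(\<lambda>n. SUP F\<in>K. ennreal (dX F (psi e T W \<kappa>1 \<kappa>2 n (phi e W \<kappa>1 \<kappa>2 n F)))) \<longlonglongrightarrow> 0"
  proof (rule compactin_pm_uniform_limit[OF K])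
    fix F :: "'a set \<times> ('a \<Rightarrow> real)" and \<epsilon> :: real
    assume F: "F \<in> star_funs L" "\<epsilon> > 0"
    show "\<exists>r>0. \<forall>\<^sub>F n in sequentially. \<forall>F'\<in>star_funs L. dX F F' < r \<longrightarrow>
        dX F' (psi e T W \<kappa>1 \<kappa>2 n (phi e W \<kappa>1 \<kappa>2 n F')) \<le> \<epsilon>"
      by (rule projection_converges_locally[OF unit index_simplices evenly_placed boundary mesh_sphere
          cells_borel cells_disjoint cells_cover mesh_ball \<kappa>1 \<kappa>2 F])
  qed (simp_all add: dX_triangle dX_refl)
qed

end
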